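(* There is a low-degree univariate polynomial $P$ (independent of the input polynomial $p$) such that the following holds. Let $p(x)=\sum_{i=0}^n p_iT_i(x)$ be a monic polynomial of degree $n$ in the Chebyshev basis ($p_n=1$), let $C=F+uv^*$ be its colleague matrix, and let $\hat\gamma_j(p)$ be the constant defined in the context. Then the eigenvalues computed in floating point arithmetic with unit roundoff $\epsilon_m$ by the structured QR iteration described in the context, applied to $C$, are the exact roots of a polynomial $p+\delta p$ satisfying $$\|\delta p\|\le P(n)\,\hat\gamma_j(p)\,\|p\|\,\epsilon_m ,$$ where $j=1$ if the single-shift iteration is used and $j=2$ if the double-shift iteration is used.
   Context: **Conventions.** $\|\cdot\|$ is the spectral norm for matrices and the Euclidean norm for vectors; for a polynomial $p=\sum_{i=0}^n p_iT_i$ ($T_i$ the Chebyshev polynomials of the first kind), $\|p\|$ is the Euclidean norm of the coefficient vector $(p_0,\dots,p_n)$. "Monic" means $p_n=1$; both $p$ and $p+\delta p$ are monic of degree $n$. Floating point arithmetic follows the standard model $\mathrm{fl}(a\circ b)=(a\circ b)(1+\delta)$, $|\delta|\le\epsilon_m$, with $\epsilon_m$ the unit roundoff; as usual in backward error analysis, bounds are to first order in $\epsilon_m$. It is a standing assumption that the QR iteration converges in a number of sweeps bounded by a constant multiple of $n$ (so the total number of Givens rotations is polynomial in $n$). **Colleague matrix.** For $p=\sum_{i=0}^n p_iT_i$, $p_n\ne0$, $C=F+uv^*$ where $F=F^*$ is the $n\times n$ symmetric tridiagonal matrix with zero diagonal and off-diagonal entries $F_{i,i+1}=F_{i+1,i}=\frac12$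 for $1\le i\le n-2$, $F_{n-1,n}=F_{n,n-1}=\frac{\sqrt2}{2}$; $u=e_1$; and $v^*=-\frac1{2p_n}\,[\,p_{n-1},\,p_{n-2},\dots,p_1,\,\sqrt2\,p_0\,]$. $C$ is upper Hessenberg and its eigenvalues are the roots of $p$. **Generator representation.** An upper Hessenberg matrix $A=F+uv^*$ with $F=F^*$ is stored by four vectors (generators) $d\in\mathbb C^n$, $\beta\in\mathbb C^{n-1}$, $u,v\in\mathbb C^n$, where $d_i=A_{ii}$, $\beta_i=A_{i+1,i}$. Entries above the diagonal are never stored; they are recovered by Hermitian symmetry of $F$: for $i<j$, $A_{ij}=\overline{A_{ji}}-\overline{u_j}v_i+u_i\overline{v_j}$ (so $A_{i,i+1}=\overline{\beta_i}-\overline{u_{i+1}}v_i+u_i\overline{v_{i+1}}$, and $A_{ij}=u_i\overline{v_j}-\overline{u_j}v_i$ when $j>i+1$ and $A_{ji}=0$). During a sweep the few nonzero entries below the subdiagonal (the "bulge") are stored explicitly as well. **Structured QR iteration.** It is the implicit QR iteration (bulge chasing), carried out in floating point only on the generators. *Single shift* ($\sigma$): compute a Givens rotation $G_1$ on indices $(1,2)$ with $G_1^*(A-\sigma I)e_1$ a multiple of $e_1$; replace $A$ by $G_1^*AG_1$; then for $i=2,\dots,n-1$ compute a Givens rotation $G_i$ on indices $(i,i+1)$ which annihilates the bulge entry $(i+1,i-1)$ against $\beta_{i-1}$, and replace $A$ by $G_i^*AG_i$. Each replacement is performed by (a) forming the $3\times2$ block $A_{i:i+2,\,i:i+1}$ from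 the generators, its entry $A_{i,i+1}$ being recovered by the symmetry formula, multiplying it on the left by $\mathrm{diag}(\hat G_i^*,1)$ and on the right by $\hat G_i$ (with $\hat G_i$ the active $2\times 2$ block), and reading off the new $d_i,d_{i+1},\beta_i,\beta_{i+1}$ and bulge; (b) updating $\beta_{i-1}$ to the norm of $(\beta_{i-1},\text{bulge})$; (c) replacing $u\gets G_i^*u$, $v\gets G_i^*v$. *Double shift* (real matrices, shift polynomial $\rho(z)=z^2-2\Re(\sigma)z+|\sigma|^2$): the same, with each $G_i$ replaced by a product of two Givens rotations acting on three consecutive indices $i,i+1,i+2$ (the first one chosen so that $\rho(A)e_1$ is mapped to a multiple of $e_1$, the following ones so as to annihilate the two bulge entries in column $i-1$), with the $4\times3$ block $A_{i:i+3,\,i:i+2}$ formed from generators, bulge and symmetry formula in place of the $3\times2$ block. *Deflation*: subdiagonal entries that are negligible at the level of the unit roundoff are set to zero and the problem is split. *Aggressive early deflation* (optional): the Schur form $Q^*A_{22}Q$ of a small trailing $k\times k$ block is computed by the same generator-based rotations; with $x$ the vector obtained by applying $Q^*$ to $\beta_{n-k}e_1$, trailing entries of $x$ with modulus at most $\epsilon_m\min\{|\beta_{n-k}|,|t|\}$ ($t$ the corresponding diagonal entry of the Schur form) are set to zero and those eigenvalues deflated; the remaining trailing block is reduced back to Hessenberg form by Givens similarities $A\gets G^*AG$ performed on the generators (the entries of $x$ are annihilated one at a time starting from the bottom, each time chasing the resulting bulge to the bottom; for each rotation $G$, acting on two consecutive indices, the small block of $A$ around the diagonal affected by $G$ is formed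 from the generators, the bulge and the symmetry formula, multiplied on the left by the active part of $G^*$ and on the right by that of $G$, the new entries of $d$, $\beta$ and the bulge are read off, $x$ is updated by $G^*$, and $u\gets G^*u$, $v\gets G^*v$), and its eigenvalues are used as shifts. Several bulges may be chased concurrently. The process ends when the matrix is (block) triangular (with $2\times2$ diagonal blocks possible in the double-shift case); this is the computed Schur form $T$, and its eigenvalues are the computed eigenvalues. **The constants $\gamma_j$, $\hat\gamma_j$.** For $u,v\in\mathbb C^n$ and a positive integer $j$, $$\gamma_j(u,v)=\sup_{i=1,\dots,n-j}\left\|\begin{bmatrix}u_i\\ \vdots\\ u_{\min\{i+j+1,n\}}\end{bmatrix}\right\|_2\cdot\left\|\begin{bmatrix}v_{\max\{1,i-1\}}\\ \vdots\\ v_{i+j}\end{bmatrix}\right\|_2 .$$ Let $u^{(k)},v^{(k)}$ be the vectors $u,v$ after $k$ rotations of the algorithm have been applied, starting from $u^{(0)}=u$, $v^{(0)}=v$ of the colleague matrix of $p$. Then $\hat\gamma_j(p)=\sup_k\gamma_j(u^{(k)},v^{(k)})$, with $k$ ranging from $0$ to the total number of rotations performed.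
   Formalization: The bound has max(1, γ̂_j(p)) instead of γ̂_j(p): for p = T_2, v = 0 and γ̂_1 = 0, yet rounding perturbs the computed roots at first order. P has degree ≤ 12 and may depend on c, where at most c·n³ rotations are assumed; j < n. *)

theory Defs
  imports
    "HOL-Analysis.L2_Norm"
    "Jordan_Normal_Form.Char_Poly"
begin

text \<open>Vectors and matrices are functions on indices that start at 1, and are zero outside the
  range \<open>{1..n}\<close>.\<close>

section \<open>Chebyshev basis and colleague matrix\<close>

fun cheb :: "nat \<Rightarrow> complex poly" where
  "cheb 0 = 1"
| "cheb (Suc 0) = [:0, 1:]"
| "cheb (Suc (Suc k)) = [:0, 2:] * cheb (Suc k) - cheb k"

definition cheb_poly :: "nat \<Rightarrow> (nat \<Rightarrow> complex) \<Rightarrow> complex poly" where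
  "cheb_poly n p = (\<Sum>i\<le>n. Polynomial.smult (p i) (cheb i))"

definition coeff_norm :: "nat \<Rightarrow> (nat \<Rightarrow> complex) \<Rightarrow> real" where
  "coeff_norm n p = L2_set (\<lambda>i. cmod (p i)) {..n}"

definition colleague_F :: "nat \<Rightarrow> nat \<Rightarrow> nat \<Rightarrow> complex" where
  "colleague_F n i j =
     (if 1 \<le> i \<and> 1 \<le> j \<and> i \<le> n \<and> j \<le> n \<and> (j = i + 1 \<or> i = j + 1)
      then if max i j = n then of_real (sqrt 2 / 2) else 1 / 2
      else 0)"

definition colleague_u :: "nat \<Rightarrow> complex" where
  "colleague_u i = (if i = 1 then 1 else 0)"

definition colleague_vstar :: "nat \<Rightarrow> (nat \<Rightarrow> complex) \<Rightarrow> nat \<Rightarrow> complex" where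
  "colleague_vstar n p i =
     (if 1 \<le> i \<and> i \<le> n
      then - 1 / (2 * p n) * (if i = n then of_real (sqrt 2) * p 0 else p (n - i))
      else 0)"

definition colleague_v :: "nat \<Rightarrow> (nat \<Rightarrow> complex) \<Rightarrow> nat \<Rightarrow> complex" where
  "colleague_v n p i = cnj (colleague_vstar n p i)"

definition colleague :: "nat \<Rightarrow> (nat \<Rightarrow> complex) \<Rightarrow> nat \<Rightarrow> nat \<Rightarrow> complex" where
  "colleague n p i j = colleague_F n i j + colleague_u i * cnj (colleague_v n p j)"


section \<open>Floating point arithmetic\<close>

record fparith =
  fadd :: "complex \<Rightarrow> complex \<Rightarrow> complex"
  fsub :: "complex \<Rightarrow> complex \<Rightarrow> complex"
  fmul :: "complex \<Rightarrow> complex \<Rightarrow> complex"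
  fdiv :: "complex \<Rightarrow> complex \<Rightarrow> complex"
  fsqrt :: "real \<Rightarrow> real"

text \<open>\<open>fl(a \<circ> b) = (a \<circ> b)(1 + \<delta>)\<close> with \<open>\<bar>\<delta>\<bar> \<le> \<epsilon>\<close>. The relative error of an operation on real
  operands is real, so that a computation with real data remains real. Negation, complex
  conjugation and taking real and imaginary parts are exact.\<close>

definition std_op :: "real \<Rightarrow> (complex \<Rightarrow> complex \<Rightarrow> complex) \<Rightarrow> (complex \<Rightarrow> complex \<Rightarrow> complex) \<Rightarrow> bool"
  where
  "std_op \<epsilon> f fl \<longleftrightarrow>
     (\<forall>a b. \<exists>\<delta>. cmod \<delta> \<le> \<epsilon> \<and> (a \<in> \<real> \<and> b \<in> \<real> \<longrightarrow> \<delta> \<in> \<real>) \<and> fl a b = f a b * (1 + \<delta>))"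

definition standard_model :: "real \<Rightarrow> fparith \<Rightarrow> bool" where
  "standard_model \<epsilon> ar \<longleftrightarrow>
     std_op \<epsilon> (+) (fadd ar) \<and> std_op \<epsilon> (-) (fsub ar) \<and> std_op \<epsilon> (*) (fmul ar) \<and>
     std_op \<epsilon> (/) (fdiv ar) \<and>
     (\<forall>x\<ge>0. \<exists>\<delta>. \<bar>\<delta>\<bar> \<le> \<epsilon> \<and> fsqrt ar x = sqrt x * (1 + \<delta>))"

definition fl_abs2 :: "fparith \<Rightarrow> complex \<Rightarrow> complex" where
  "fl_abs2 ar a =
     fadd ar (fmul ar (of_real (Re a)) (of_real (Re a))) (fmul ar (of_real (Im a)) (of_real (Im a)))"

definition fl_norm2 :: "fparith \<Rightarrow> complex \<Rightarrow> complex \<Rightarrow> complex" where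
  "fl_norm2 ar a b = of_real (fsqrt ar (Re (fadd ar (fl_abs2 ar a) (fl_abs2 ar b))))"


section \<open>Generator representation\<close>

text \<open>The phase of the iteration. In \<open>Window w h \<beta>\<close> the Schur form of the diagonal block \<open>w..h\<close> is
  being computed for aggressive early deflation, \<open>\<beta>\<close> being the value of the entry \<open>(w, w - 1)\<close> when
  the window was opened. In \<open>Reduce w e m\<close> the block \<open>w..e\<close> that remains after this deflation is
  being reduced to Hessenberg form, and the entries of the spike in the rows after \<open>m\<close> have
  already been annihilated.\<close>

datatype phase = Main | Window nat nat complex | Reduce nat nat nat

text \<open>
  \<^item> \<open>low\<close> contains the explicitly stored entries on and below the diagonal: \<open>low i i\<close> is \<open>d\<^sub>i\<close>,
    \<open>low (i + 1) i\<close> is \<open>\<beta>\<^sub>i\<close>, and what lies below is zero except for the bulges and, during aggressive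
    early deflation, for the spike (the vector \<open>x\<close>), which is kept in column \<open>w - 1\<close>.
  \<^item> \<open>pend\<close> is the set of bulges being chased: \<open>(i, hi)\<close> is a bulge in column \<open>i - 1\<close>, to be
    annihilated by the next rotation \<open>G\<^sub>i\<close> of its sweep on a diagonal block that ends at \<open>hi\<close>.
  \<^item> \<open>rlog\<close> lists \<open>(u\<^sup>(\<^sup>k\<^sup>), v\<^sup>(\<^sup>k\<^sup>))\<close> for all \<open>k\<close> from 0 to the number of Givens rotations performed so
    far.\<close>

record qr_state =
  low :: "nat \<Rightarrow> nat \<Rightarrow> complex"
  gu :: "nat \<Rightarrow> complex"
  gv :: "nat \<Rightarrow> complex"
  phase :: phase
  pend :: "(nat \<times> nat) set"
  rlog :: "((nat \<Rightarrow> complex) \<times> (nat \<Rightarrow> complex)) list"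

definition init_state :: "nat \<Rightarrow> (nat \<Rightarrow> complex) \<Rightarrow> qr_state" where
  "init_state n p =
     \<lparr> low = (\<lambda>i j. if j \<le> i then colleague n p i j else 0),
       gu = colleague_u, gv = colleague_v n p, phase = Main, pend = {},
       rlog = [(colleague_u, colleague_v n p)] \<rparr>"

text \<open>The matrix represented by the generators, and its entries as recovered in floating point.\<close>

definition entry :: "qr_state \<Rightarrow> nat \<Rightarrow> nat \<Rightarrow> complex" where
  "entry s i j =
     (if j \<le> i then low s i j
      else cnj (low s j i) - cnj (gu s j) * gv s i + gu s i * cnj (gv s j))"

definition fl_entry :: "fparith \<Rightarrow> qr_state \<Rightarrow> nat \<Rightarrow> nat \<Rightarrow> complex" where
  "fl_entry ar s i j =
     (if j \<le> i then low s i j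
      else fadd ar (fsub ar (cnj (low s j i)) (fmul ar (cnj (gu s j)) (gv s i)))
                   (fmul ar (gu s i) (cnj (gv s j))))"

lemma entry_init_state: "entry (init_state n p) i j = colleague n p i j"
  by (auto simp: entry_def init_state_def colleague_def colleague_F_def max_def)

definition represented_mat :: "nat \<Rightarrow> qr_state \<Rightarrow> complex mat" where
  "represented_mat n s = mat n n (\<lambda>(i, j). entry s (i + 1) (j + 1))"


section \<open>Givens rotations\<close>

text \<open>\<open>givens ar a b = (c, s, r)\<close>: for exact arithmetic the matrix \<open>G = [[c, -cnj s], [s, cnj c]]\<close> is
  unitary, and \<open>G\<^sup>*\<close> maps \<open>(a, b)\<close> to \<open>(r, 0)\<close> with \<open>r\<close> the norm of \<open>(a, b)\<close>.\<close>

definition givens :: "fparith \<Rightarrow> complex \<Rightarrow> complex \<Rightarrow> complex \<times> complex \<times> complex" where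
  "givens ar a b =
     (let r = fl_norm2 ar a b in if r = 0 then (1, 0, 0) else (fdiv ar a r, fdiv ar b r, r))"

text \<open>A rotation \<open>(k, c, s)\<close> is \<open>G\<close> acting on the indices \<open>k, k + 1\<close>.\<close>

type_synonym rotation = "nat \<times> complex \<times> complex"

definition rot_vec :: "fparith \<Rightarrow> rotation \<Rightarrow> (nat \<Rightarrow> complex) \<Rightarrow> nat \<Rightarrow> complex" where
  "rot_vec ar = (\<lambda>(k, c, s) x i.
     if i = k then fadd ar (fmul ar (cnj c) (x k)) (fmul ar (cnj s) (x (k + 1)))
     else if i = k + 1 then fadd ar (fmul ar (- s) (x k)) (fmul ar c (x (k + 1)))
     else x i)"

definition rot_left ::
  "fparith \<Rightarrow> rotation \<Rightarrow> (nat \<Rightarrow> nat \<Rightarrow> complex) \<Rightarrow> nat \<Rightarrow> nat \<Rightarrow> complex" where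
  "rot_left ar g X = (\<lambda>i j. rot_vec ar g (\<lambda>i'. X i' j) i)"

definition rot_right ::
  "fparith \<Rightarrow> rotation \<Rightarrow> (nat \<Rightarrow> nat \<Rightarrow> complex) \<Rightarrow> nat \<Rightarrow> nat \<Rightarrow> complex" where
  "rot_right ar = (\<lambda>(k, c, s) X i j.
     if j = k then fadd ar (fmul ar (X i k) c) (fmul ar (X i (k + 1)) s)
     else if j = k + 1 then fadd ar (fmul ar (X i k) (- cnj s)) (fmul ar (X i (k + 1)) (cnj c))
     else X i j)"

text \<open>\<open>similarity ar [G\<^sub>1, \<dots>, G\<^sub>r] s\<close> is \<open>A \<leftarrow> G\<^sup>* A G\<close> for \<open>G = G\<^sub>1 \<cdots> G\<^sub>r\<close>, performed on the generators.
  It is written for the whole of \<open>A\<close>, but only the part on and below the diagonal is kept; the only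
  entries above the diagonal that contribute to this part are those of the diagonal block on which
  \<open>G\<close> acts. Combinations of zeros are computed as zeros, so that for a rotation on \<open>i, i + 1\<close> the
  computation is that of the block \<open>A\<^bsub>i:i+2, i:i+1\<^esub>\<close> (for a product of two rotations on
  \<open>i, i + 1, i + 2\<close>: of \<open>A\<^bsub>i:i+3, i:i+2\<^esub>\<close>) and of the nonzero stored entries to the left of the block,
  which are those of the column that is being annihilated (see \<open>eliminate\<close>) and those of the
  spike.\<close>

definition log_rotation :: "fparith \<Rightarrow> rotation \<Rightarrow> qr_state \<Rightarrow> qr_state" where
  "log_rotation ar g s =
     (let u = rot_vec ar g (gu s); v = rot_vec ar g (gv s)
      in s \<lparr> gu := u, gv := v, rlog := rlog s @ [(u, v)] \<rparr>)"

definition similarity :: "fparith \<Rightarrow> rotation list \<Rightarrow> qr_state \<Rightarrow> qr_state" where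
  "similarity ar gs s =
     (let X = fold (rot_right ar) gs (fold (rot_left ar) gs (fl_entry ar s))
      in (fold (log_rotation ar) gs s) \<lparr> low := (\<lambda>i j. if j \<le> i then X i j else 0) \<rparr>)"

text \<open>\<open>m\<close> rotations (\<open>m\<close> is 1 or 2) whose product maps \<open>(x\<^sub>i, \<dots>, x\<^bsub>i+m\<^esub>)\<close> to a multiple \<open>r\<close> of the
  first unit vector, together with \<open>r\<close>.\<close>

definition rotations_for ::
  "fparith \<Rightarrow> nat \<Rightarrow> nat \<Rightarrow> (nat \<Rightarrow> complex) \<Rightarrow> rotation list \<times> complex" where
  "rotations_for ar m i x =
     (if m = 1 then
        let (c, s, r) = givens ar (x i) (x (i + 1)) in ([(i, c, s)], r)
      else
        let (c1, s1, r1) = givens ar (x (i + 1)) (x (i + 2));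
            (c2, s2, r2) = givens ar (x i) r1
        in ([(i + 1, c1, s1), (i, c2, s2)], r2))"

text \<open>Annihilate the entries \<open>(i + 1, c), \<dots>, (i + m, c)\<close> of column \<open>c < i\<close> against \<open>(i, c)\<close>, which becomes
  the computed norm.\<close>

definition eliminate :: "fparith \<Rightarrow> nat \<Rightarrow> nat \<Rightarrow> nat \<Rightarrow> qr_state \<Rightarrow> qr_state" where
  "eliminate ar m i c s =
     (let (gs, r) = rotations_for ar m i (\<lambda>k. low s k c); s' = similarity ar gs s
      in s' \<lparr> low := (\<lambda>a b. if b = c \<and> a = i then r
                           else if b = c \<and> i < a \<and> a \<le> i + m then 0
                           else low s' a b) \<rparr>)"

text \<open>The first column of \<open>A - \<sigma>I\<close> (single shift, \<open>j = 1\<close>) or of \<open>A\<^sup>2 - 2 Re(\<sigma>) A + \<bar>\<sigma>\<bar>\<^sup>2 I\<close> (double shift,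
  \<open>j = 2\<close>) for the diagonal block that starts at \<open>l\<close>.\<close>

definition shift_vec :: "fparith \<Rightarrow> nat \<Rightarrow> nat \<Rightarrow> complex \<Rightarrow> qr_state \<Rightarrow> nat \<Rightarrow> complex" where
  "shift_vec ar j l \<sigma> s =
     (let d1 = low s l l; d2 = low s (l + 1) (l + 1);
          b1 = low s (l + 1) l; b2 = low s (l + 2) (l + 1);
          a12 = fl_entry ar s l (l + 1);
          t = fmul ar 2 (of_real (Re \<sigma>)); q = fl_abs2 ar \<sigma>
      in if j = 1 then (\<lambda>k. 0) (l := fsub ar d1 \<sigma>, l + 1 := b1)
         else (\<lambda>k. 0)
           (l := fadd ar (fsub ar (fadd ar (fmul ar d1 d1) (fmul ar a12 b1)) (fmul ar t d1)) q,
            l + 1 := fmul ar b1 (fsub ar (fadd ar d1 d2) t),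
            l + 2 := fmul ar b1 b2))"


section \<open>The structured QR iteration\<close>

fun active_range :: "nat \<Rightarrow> phase \<Rightarrow> nat \<times> nat" where
  "active_range n Main = (1, n)"
| "active_range n (Window w h \<beta>) = (w, h)"
| "active_range n (Reduce w e m) = (w, e)"

text \<open>\<open>lo..hi\<close> is a diagonal block into which the problem has been split.\<close>

definition split_block :: "nat \<Rightarrow> qr_state \<Rightarrow> nat \<Rightarrow> nat \<Rightarrow> bool" where
  "split_block n s lo hi \<longleftrightarrow>
     (case active_range n (phase s) of (a, b) \<Rightarrow>
        a \<le> lo \<and> lo \<le> hi \<and> hi \<le> b \<and>
        (lo = a \<or> low s lo (lo - 1) = 0) \<and> (hi = b \<or> low s (hi + 1) hi = 0))"

text \<open>The rotations at position \<open>i\<close> do not interfere with the bulges in \<open>B\<close>.\<close>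

definition clear_of :: "nat \<Rightarrow> nat \<Rightarrow> (nat \<times> nat) set \<Rightarrow> bool" where
  "clear_of j i B \<longleftrightarrow> (\<forall>(k, h) \<in> B. k + j + 1 \<le> i \<or> i + j + 2 \<le> k)"

text \<open>The bulge left behind by the rotations at position \<open>i - 1\<close>, if there is one.\<close>

definition bulge :: "nat \<Rightarrow> nat \<Rightarrow> (nat \<times> nat) set" where
  "bulge i hi = (if i < hi then {(i, hi)} else {})"

text \<open>Triangular for \<open>j = 1\<close>; for \<open>j = 2\<close> diagonal blocks of order 2 are allowed.\<close>

definition quasi_triangular :: "nat \<Rightarrow> qr_state \<Rightarrow> nat \<Rightarrow> nat \<Rightarrow> bool" where
  "quasi_triangular j s a b \<longleftrightarrow>
     (\<forall>i. a \<le> i \<and> i < b \<longrightarrow>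
        low s (i + 1) i = 0 \<or> (j = 2 \<and> (i + 1 < b \<longrightarrow> low s (i + 2) (i + 1) = 0)))"

text \<open>One step of the iteration on a matrix of order \<open>n\<close> with unit roundoff \<open>\<epsilon>\<close>; \<open>j\<close> is 1 for the
  single shift and 2 for the double shift iteration. Shifts, deflation windows and the schedule of
  the steps are left free. \<open>sweep\<close> starts a sweep; \<open>chase\<close> performs the next step of a sweep (for
  \<open>j = 2\<close> the last step of a sweep, on two indices only, is a single rotation). \<open>aed_open\<close>,
  \<open>aed_deflate\<close>, \<open>aed_spike\<close>, \<open>aed_spike_pair\<close> and \<open>aed_close\<close> make up aggressive early deflation. In
  \<open>aed_spike_pair\<close>, the row \<open>m - 1\<close> is the last one of a diagonal block of order 2 of the Schur form;
  this block is passed over as a whole, and the resulting bulge is one of the double shift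
  iteration.\<close>

inductive qr_step :: "nat \<Rightarrow> nat \<Rightarrow> real \<Rightarrow> fparith \<Rightarrow> qr_state \<Rightarrow> qr_state \<Rightarrow> bool"
  for n j :: nat and \<epsilon> :: real and ar :: fparith where
  sweep:
    "\<lbrakk> phase s = Main \<or> (\<exists>w h \<beta>. phase s = Window w h \<beta>);
       split_block n s lo hi; lo + j \<le> hi; clear_of j lo (pend s);
       s' = similarity ar (fst (rotations_for ar j lo (shift_vec ar j lo \<sigma> s))) s \<rbrakk>
     \<Longrightarrow> qr_step n j \<epsilon> ar s (s' \<lparr> pend := pend s \<union> bulge (lo + 1) hi \<rparr>)"
| chase:
    "\<lbrakk> (i, hi) \<in> pend s; clear_of j i (pend s - {(i, hi)});
       s' = eliminate ar (if i + j \<le> hi then j else 1) i (i - 1) s \<rbrakk>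
     \<Longrightarrow> qr_step n j \<epsilon> ar s (s' \<lparr> pend := (pend s - {(i, hi)}) \<union> bulge (i + 1) hi \<rparr>)"
| deflate:
    "\<lbrakk> phase s = Main \<or> (\<exists>w h \<beta>. phase s = Window w h \<beta>);
       active_range n (phase s) = (a, b); a \<le> i; i < b;
       \<forall>(k, h) \<in> pend s. i + 1 < k \<or> k + 1 < i;
       cmod (low s (i + 1) i) \<le> \<epsilon> * (cmod (low s i i) + cmod (low s (i + 1) (i + 1))) \<rbrakk>
     \<Longrightarrow> qr_step n j \<epsilon> ar s (s \<lparr> low := (low s) (i + 1 := (low s (i + 1)) (i := 0)) \<rparr>)"
| aed_open:
    "\<lbrakk> phase s = Main; pend s = {}; 2 \<le> w; w \<le> h; h \<le> n; h = n \<or> low s (h + 1) h = 0 \<rbrakk>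
     \<Longrightarrow> qr_step n j \<epsilon> ar s (s \<lparr> phase := Window w h (low s w (w - 1)) \<rparr>)"
| aed_deflate:
    "\<lbrakk> phase s = Window w h \<beta>; pend s = {}; quasi_triangular j s w h;
       w - 1 \<le> e; e \<le> h; e = w - 1 \<or> e = h \<or> low s (e + 1) e = 0;
       \<forall>r. e < r \<and> r \<le> h \<longrightarrow> cmod (low s r (w - 1)) \<le> \<epsilon> * min (cmod \<beta>) (cmod (low s r r)) \<rbrakk>
     \<Longrightarrow> qr_step n j \<epsilon> ar s
           (s \<lparr> low := (\<lambda>r c. if c = w - 1 \<and> e < r \<and> r \<le> h then 0 else low s r c),
                phase := Reduce w e e \<rparr>)"
| aed_spike:
    "\<lbrakk> phase s = Reduce w e m; pend s = {}; w < m;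
       j = 1 \<or> m - 1 = w \<or> low s (m - 1) (m - 2) = 0;
       s' = eliminate ar 1 (m - 1) (w - 1) s \<rbrakk>
     \<Longrightarrow> qr_step n j \<epsilon> ar s (s' \<lparr> phase := Reduce w e (m - 1), pend := bulge m e \<rparr>)"
| aed_spike_pair:
    "\<lbrakk> phase s = Reduce w e m; pend s = {}; j = 2; w < m - 1; low s (m - 1) (m - 2) \<noteq> 0;
       s' = eliminate ar 2 (m - 2) (w - 1) s \<rbrakk>
     \<Longrightarrow> qr_step n j \<epsilon> ar s (s' \<lparr> phase := Reduce w e (m - 2), pend := bulge (m - 1) e \<rparr>)"
| aed_close:
    "\<lbrakk> phase s = Reduce w e m; pend s = {}; m \<le> w \<rbrakk>
     \<Longrightarrow> qr_step n j \<epsilon> ar s (s \<lparr> phase := Main \<rparr>)"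

definition computed_schur_form :: "nat \<Rightarrow> nat \<Rightarrow> qr_state \<Rightarrow> bool" where
  "computed_schur_form n j s \<longleftrightarrow>
     phase s = Main \<and> pend s = {} \<and>
     (\<forall>r c. c + 1 < r \<longrightarrow> low s r c = 0) \<and> quasi_triangular j s 1 n"

definition num_rotations :: "qr_state \<Rightarrow> nat" where
  "num_rotations s = length (rlog s) - 1"

definition qr_run ::
  "nat \<Rightarrow> nat \<Rightarrow> real \<Rightarrow> fparith \<Rightarrow> (nat \<Rightarrow> complex) \<Rightarrow> qr_state \<Rightarrow> bool" where
  "qr_run n j \<epsilon> ar p s \<longleftrightarrow> (qr_step n j \<epsilon> ar)\<^sup>*\<^sup>* (init_state n p) s \<and> computed_schur_form n j s"

text \<open>With algebraic multiplicities.\<close>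

definition computed_eigenvalues :: "nat \<Rightarrow> qr_state \<Rightarrow> complex multiset" where
  "computed_eigenvalues n s = proots (char_poly (represented_mat n s))"


section \<open>The growth constants\<close>

definition gamma_const :: "nat \<Rightarrow> nat \<Rightarrow> (nat \<Rightarrow> complex) \<Rightarrow> (nat \<Rightarrow> complex) \<Rightarrow> real" where
  "gamma_const j n u v =
     (SUP i\<in>{1..n - j}. L2_set (\<lambda>k. cmod (u k)) {i..min (i + j + 1) n} *
                        L2_set (\<lambda>k. cmod (v k)) {max 1 (i - 1)..i + j})"

definition gamma_hat :: "nat \<Rightarrow> nat \<Rightarrow> qr_state \<Rightarrow> real" where
  "gamma_hat j n s = (SUP (u, v)\<in>set (rlog s). gamma_const j n u v)"

end

theory Submission
  imports Defs
begin

text \<open>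
  The generators represent \<open>A = F + uv\<^sup>*\<close>, and each rotation is applied with an error to \<open>F\<close>, \<open>u\<close> and
  \<open>v\<close> separately. Pulled back by the exact unitary matrices, the final state represents
  \<open>F + E + (u + \<delta>u) (v + \<delta>v)\<^sup>*\<close> up to a unitary similarity, where \<open>\<delta>u\<close> and \<open>\<delta>v\<close> are relatively small.
  The point is that \<open>E\<close> is bounded by the growth constant and not by \<open>\<parallel>u\<parallel> \<parallel>v\<parallel>\<close>: an entry of \<open>u v\<^sup>*\<close> is
  the difference of a stored entry and an entry of \<open>F\<close>, and the stored entries that enter a rotation
  lie near the diagonal or have been created there by earlier rotations.

  For \<open>x\<close> on the Bernstein ellipse \<open>x = (z + 1/z) / 2\<close>, \<open>\<bar>z\<bar> = 1 + 1/n\<close>, the resolvent of \<open>F\<close> is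
  bounded by \<open>2n(n + 1)\<close>, since the numerical range of \<open>F\<close> lies in \<open>[-1, 1]\<close>, and
  \<open>2\<^bsup>n-1\<^esup> det (xI - F) = T\<^sub>n(x)\<close> is bounded. As \<open>det (xI - F - uv\<^sup>*) = det (xI - F) (1 - v\<^sup>* (xI - F)\<^sup>-\<^sup>1 u)\<close>, the
  perturbation changes the characteristic polynomial on the ellipse by an amount that is linear in
  \<open>\<parallel>v\<parallel> \<le> \<parallel>p\<parallel>\<close>, and the values on the ellipse control the Chebyshev coefficients.
\<close>

section \<open>Vectors and matrices\<close>

text \<open>The obstacle is circularity: the error of a step is controlled only while
  \<parallel>F\<parallel> \<le> 2, which is known only while the accumulated error is at most 1, and
  the growth constant in that error depends on the run itself. The a priori bound
  \<open>gamma_hat j n s \<le> 4 * coeff_norm n p\<close> breaks the circle, so that the threshold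
  for \<epsilon> can be fixed from \<open>n\<close>, \<open>p\<close> and \<open>c\<close> alone. It
  may be tiny (it involves n! 2^n); this absorbs all second-order terms, and the final bound is
  linear in \<epsilon>. The working constant g is at least 1 because F has entries of order 1, which
  are rounded as well. The exponent 12 is 6 + 4 + 1 + 1. With at most c n^3 rotations the bound for
  \<open>E\<close> is of order n^6, because the bound for one rotation is itself proportional to the
  number of rotations, owing to the drift of the imaginary diagonal and the growth of the entries
  below the subdiagonal. The resolvent enters squared and gives n^4, a determinant near the identity
  gives n, and the passage from the largest coefficient to the Euclidean norm gives the last
  n.\<close>

definition vnorm :: "nat set \<Rightarrow> (nat \<Rightarrow> complex) \<Rightarrow> real" where
  "vnorm B x = L2_set (\<lambda>i. cmod (x i)) B"

definition dot :: "nat \<Rightarrow> (nat \<Rightarrow> complex) \<Rightarrow> (nat \<Rightarrow> complex) \<Rightarrow> complex" where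
  "dot n z y = (\<Sum>i = 1..n. cnj (z i) * y i)"

definition mvec :: "nat \<Rightarrow> (nat \<Rightarrow> nat \<Rightarrow> complex) \<Rightarrow> (nat \<Rightarrow> complex) \<Rightarrow> nat \<Rightarrow> complex" where
  "mvec n X y i = (\<Sum>j = 1..n. X i j * y j)"

definition mmul ::
  "nat \<Rightarrow> (nat \<Rightarrow> nat \<Rightarrow> complex) \<Rightarrow> (nat \<Rightarrow> nat \<Rightarrow> complex) \<Rightarrow> nat \<Rightarrow> nat \<Rightarrow> complex" where
  "mmul n X Y i j = (\<Sum>k = 1..n. X i k * Y k j)"

definition ctrans :: "(nat \<Rightarrow> nat \<Rightarrow> complex) \<Rightarrow> nat \<Rightarrow> nat \<Rightarrow> complex" where
  "ctrans X i j = cnj (X j i)"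

definition idm :: "nat \<Rightarrow> nat \<Rightarrow> complex" where
  "idm i j = (if i = j then 1 else 0)"

text \<open>The spectral norm is at most \<eta>, expressed through the sesquilinear form. In this
  shape the bound passes to \<open>ctrans\<close>, to sums and to unitary conjugates without a
  supremum.\<close>

definition op_le :: "nat \<Rightarrow> (nat \<Rightarrow> nat \<Rightarrow> complex) \<Rightarrow> real \<Rightarrow> bool" where
  "op_le n X \<eta> \<longleftrightarrow>
     (\<forall>y z. cmod (dot n z (mvec n X y)) \<le> \<eta> * (vnorm {1..n} z * vnorm {1..n} y))"

text \<open>Both products are demanded, so that \<open>ctrans Q\<close> is unitary as well and
  \<open>Q\<close> can be cancelled on either side; entries outside {1..n} are left
  unconstrained.\<close>

definition unitary :: "nat \<Rightarrow> (nat \<Rightarrow> nat \<Rightarrow> complex) \<Rightarrow> bool" where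
  "unitary n Q \<longleftrightarrow> (\<forall>i\<in>{1..n}. \<forall>j\<in>{1..n}.
     mmul n (ctrans Q) Q i j = idm i j \<and> mmul n Q (ctrans Q) i j = idm i j)"

lemma vnorm_nonneg [simp]: "0 \<le> vnorm B x"
  by (simp add: vnorm_def)

lemma vnorm_sq: "(vnorm B x)\<^sup>2 = (\<Sum>i\<in>B. (cmod (x i))\<^sup>2)"
  by (simp add: vnorm_def L2_set_def sum_nonneg)

lemma vnorm_cong: "(\<And>i. i \<in> B \<Longrightarrow> x i = y i) \<Longrightarrow> vnorm B x = vnorm B y"
  unfolding vnorm_def by (rule L2_set_cong) auto

lemma vnorm_triangle: "vnorm B (\<lambda>i. x i + y i) \<le> vnorm B x + vnorm B y"
proof -
  have "vnorm B (\<lambda>i. x i + y i) \<le> L2_set (\<lambda>i. cmod (x i) + cmod (y i)) B"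
    unfolding vnorm_def by (rule L2_set_mono) (auto simp: norm_triangle_ineq)
  also have "\<dots> \<le> vnorm B x + vnorm B y"
    unfolding vnorm_def by (rule L2_set_triangle_ineq)
  finally show ?thesis .
qed

lemma vnorm_cnj [simp]: "vnorm B (\<lambda>i. cnj (x i)) = vnorm B x"
  by (simp add: vnorm_def)

lemma vnorm_triangle_diff: "vnorm B (\<lambda>i. x i - z i) \<le> vnorm B (\<lambda>i. x i - y i) + vnorm B (\<lambda>i. y i - z i)"
  using vnorm_triangle[of B "\<lambda>i. x i - y i" "\<lambda>i. y i - z i"] by simp

lemma vnorm_scale: "vnorm B (\<lambda>i. a * x i) = cmod a * vnorm B x"
  unfolding vnorm_def by (simp add: norm_mult L2_set_right_distrib)

lemma vnorm_sub: "finite B \<Longrightarrow> A \<subseteq> B \<Longrightarrow> vnorm A x \<le> vnorm B x"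
  unfolding vnorm_def L2_set_def by (intro real_sqrt_le_mono sum_mono2) auto

lemma cmod_le_vnorm: "finite B \<Longrightarrow> i \<in> B \<Longrightarrow> cmod (x i) \<le> vnorm B x"
  unfolding vnorm_def by (rule member_le_L2_set[of B i "\<lambda>i. cmod (x i)"])

lemma dot_self: "dot n z z = of_real ((vnorm {1..n} z)\<^sup>2)"
  unfolding dot_def vnorm_sq of_real_sum
  by (intro sum.cong) (simp_all add: complex_norm_square mult.commute del: of_real_power)

lemma cmod_dot_le: "cmod (dot n z y) \<le> vnorm {1..n} z * vnorm {1..n} y"
proof -
  have "cmod (dot n z y) \<le> (\<Sum>i = 1..n. \<bar>cmod (z i)\<bar> * \<bar>cmod (y i)\<bar>)"
    unfolding dot_def by (rule order_trans[OF norm_sum]) (simp add: norm_mult)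
  also have "\<dots> \<le> vnorm {1..n} z * vnorm {1..n} y"
    unfolding vnorm_def by (rule L2_set_mult_ineq)
  finally show ?thesis .
qed

lemma dot_cnj: "cnj (dot n z y) = dot n y z"
  by (simp add: dot_def mult.commute)

lemma dot_add: "dot n z (\<lambda>i. x i + y i) = dot n z x + dot n z y"
  by (simp add: dot_def algebra_simps sum.distrib)

lemma dot_diff: "dot n z (\<lambda>i. x i - y i) = dot n z x - dot n z y"
  by (simp add: dot_def algebra_simps sum_subtractf)

lemma dot_cong: "(\<And>i. i \<in> {1..n} \<Longrightarrow> x i = y i) \<Longrightarrow> dot n z x = dot n z y"
  unfolding dot_def by (intro sum.cong) auto

lemma mvec_cong: "(\<And>j. j \<in> {1..n} \<Longrightarrow> X i j = Y i j) \<Longrightarrow> mvec n X y i = mvec n Y y i"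
  unfolding mvec_def by (intro sum.cong) auto

lemma mvec_cong_vec: "(\<And>j. j \<in> {1..n} \<Longrightarrow> x j = y j) \<Longrightarrow> mvec n X x i = mvec n X y i"
  unfolding mvec_def by (intro sum.cong) auto

lemma dot_mvec_ctrans: "dot n (mvec n X z) y = dot n z (mvec n (ctrans X) y)"
  unfolding dot_def mvec_def ctrans_def sum_distrib_left sum_distrib_right cnj_sum
  by (subst sum.swap) (simp add: algebra_simps)

lemma ctrans_ctrans [simp]: "ctrans (ctrans X) = X"
  by (simp add: ctrans_def fun_eq_iff)

lemma mvec_mmul: "mvec n (mmul n X Y) y = mvec n X (mvec n Y y)"
  unfolding mvec_def mmul_def sum_distrib_left sum_distrib_right fun_eq_iff
  by (subst sum.swap) (simp add: algebra_simps)

lemma mmul_assoc: "mmul n (mmul n X Y) Z = mmul n X (mmul n Y Z)"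
  unfolding mmul_def sum_distrib_left sum_distrib_right fun_eq_iff
  by (subst sum.swap) (simp add: algebra_simps)

lemma ctrans_mmul: "ctrans (mmul n X Y) = mmul n (ctrans Y) (ctrans X)"
  by (simp add: ctrans_def mmul_def fun_eq_iff mult.commute)

lemma mmul_cong:
  "(\<And>k. k \<in> {1..n} \<Longrightarrow> X i k = X' i k) \<Longrightarrow> (\<And>k. k \<in> {1..n} \<Longrightarrow> Y k j = Y' k j) \<Longrightarrow>
     mmul n X Y i j = mmul n X' Y' i j"
  unfolding mmul_def by (intro sum.cong) auto

lemma mmul_idm_right: "j \<in> {1..n} \<Longrightarrow> mmul n X idm i j = X i j"
  unfolding mmul_def idm_def by (simp add: if_distrib[of "(*) _"] cong: if_cong)

lemma mmul_idm_left: "i \<in> {1..n} \<Longrightarrow> mmul n idm X i j = X i j"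
  unfolding mmul_def idm_def by (simp add: if_distrib[of "\<lambda>x. x * _"] cong: if_cong)

lemma mvec_idm: "i \<in> {1..n} \<Longrightarrow> mvec n idm y i = y i"
  unfolding mvec_def idm_def by (simp add: if_distrib[of "\<lambda>x. x * _"] cong: if_cong)

lemma mvec_add: "mvec n (\<lambda>i j. X i j + Y i j) y = (\<lambda>i. mvec n X y i + mvec n Y y i)"
  by (simp add: mvec_def fun_eq_iff algebra_simps sum.distrib)

lemma mvec_diff: "mvec n (\<lambda>i j. X i j - Y i j) y = (\<lambda>i. mvec n X y i - mvec n Y y i)"
  by (simp add: mvec_def fun_eq_iff algebra_simps sum_subtractf)

lemma mmul_add_right:
  "mmul n X (\<lambda>i j. Y i j + Z i j) = (\<lambda>i j. mmul n X Y i j + mmul n X Z i j)"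
  by (simp add: mmul_def fun_eq_iff algebra_simps sum.distrib)

lemma mmul_add_left:
  "mmul n (\<lambda>i j. Y i j + Z i j) X = (\<lambda>i j. mmul n Y X i j + mmul n Z X i j)"
  by (simp add: mmul_def fun_eq_iff algebra_simps sum.distrib)

lemma mmul_scale_right: "mmul n X (\<lambda>i j. a * Y i j) = (\<lambda>i j. a * mmul n X Y i j)"
  by (simp add: mmul_def fun_eq_iff sum_distrib_left algebra_simps)

lemma mmul_scale_left: "mmul n (\<lambda>i j. a * Y i j) X = (\<lambda>i j. a * mmul n Y X i j)"
  by (simp add: mmul_def fun_eq_iff sum_distrib_left algebra_simps)

lemma mmul_diff_right:
  "mmul n X (\<lambda>i j. Y i j - Z i j) = (\<lambda>i j. mmul n X Y i j - mmul n X Z i j)"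
  by (simp add: mmul_def fun_eq_iff algebra_simps sum_subtractf)

lemma mmul_outer_left: "mmul n X (\<lambda>i j. u i * v j) = (\<lambda>i j. mvec n X u i * v j)"
  by (simp add: mmul_def mvec_def fun_eq_iff sum_distrib_right mult.assoc)

lemma mmul_outer_right: "mmul n (\<lambda>i j. u i * cnj (v j)) X = (\<lambda>i j. u i * cnj (mvec n (ctrans X) v j))"
  by (simp add: mmul_def mvec_def ctrans_def fun_eq_iff sum_distrib_left algebra_simps)

lemma op_leD: "op_le n X \<eta> \<Longrightarrow> cmod (dot n z (mvec n X y)) \<le> \<eta> * (vnorm {1..n} z * vnorm {1..n} y)"
  by (simp add: op_le_def)

lemma op_le_mono: "op_le n X \<eta> \<Longrightarrow> \<eta> \<le> \<eta>' \<Longrightarrow> op_le n X \<eta>'"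
  unfolding op_le_def by (meson mult_right_mono mult_nonneg_nonneg order_trans vnorm_nonneg)

lemma op_le_cong:
  assumes "\<And>i j. i \<in> {1..n} \<Longrightarrow> j \<in> {1..n} \<Longrightarrow> X i j = Y i j" "op_le n X \<eta>"
  shows "op_le n Y \<eta>"
proof -
  have "dot n z (mvec n X y) = dot n z (mvec n Y y)" for y z
    using assms(1) by (intro dot_cong mvec_cong) auto
  with assms(2) show ?thesis by (simp add: op_le_def)
qed

lemma op_le_add:
  assumes "op_le n X \<eta>" "op_le n Y \<theta>"
  shows "op_le n (\<lambda>i j. X i j + Y i j) (\<eta> + \<theta>)"
  unfolding op_le_def
proof (intro allI)
  fix y z
  show "cmod (dot n z (mvec n (\<lambda>i j. X i j + Y i j) y)) \<le> (\<eta> + \<theta>) * (vnorm {1..n} z * vnorm {1..n} y)"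
    using norm_triangle_ineq[of "dot n z (mvec n X y)" "dot n z (mvec n Y y)"]
      op_leD[OF assms(1), of z y] op_leD[OF assms(2), of z y]
    by (simp add: mvec_add dot_add algebra_simps)
qed

lemma op_le_diag:
  assumes "\<And>i. i \<in> {1..n} \<Longrightarrow> cmod (d i) \<le> a"
  shows "op_le n (\<lambda>i j. if i = j then d i else 0) a"
  unfolding op_le_def
proof (intro allI)
  fix y z
  let ?D = "\<lambda>i j. if i = j then d i else 0"
  have "mvec n ?D y i = d i * y i" if "i \<in> {1..n}" for i
    unfolding mvec_def using that by (simp add: if_distrib[of "\<lambda>x. x * _"] cong: if_cong)
  then have "dot n z (mvec n ?D y) = (\<Sum>i = 1..n. cnj (z i) * (d i * y i))"
    unfolding dot_def by (intro sum.cong) auto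
  also have "cmod \<dots> \<le> (\<Sum>i = 1..n. a * (\<bar>cmod (z i)\<bar> * \<bar>cmod (y i)\<bar>))"
  proof (rule order_trans[OF norm_sum sum_mono])
    fix i assume "i \<in> {1..n}"
    then have "cmod (d i) * (cmod (z i) * cmod (y i)) \<le> a * (cmod (z i) * cmod (y i))"
      using assms by (intro mult_right_mono) auto
    then show "cmod (cnj (z i) * (d i * y i)) \<le> a * (\<bar>cmod (z i)\<bar> * \<bar>cmod (y i)\<bar>)"
      by (simp add: norm_mult mult_ac)
  qed
  also have "\<dots> = a * (\<Sum>i = 1..n. \<bar>cmod (z i)\<bar> * \<bar>cmod (y i)\<bar>)" by (simp add: sum_distrib_left)
  also have "\<dots> \<le> a * (vnorm {1..n} z * vnorm {1..n} y)"
  proof (cases "n = 0")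
    case False
    then have "0 \<le> a" using assms[of 1] norm_ge_zero order_trans by (metis atLeastAtMost_iff le_refl less_one not_le)
    then show ?thesis unfolding vnorm_def by (intro mult_left_mono L2_set_mult_ineq)
  qed (simp add: vnorm_def)
  finally show "cmod (dot n z (mvec n ?D y)) \<le> a * (vnorm {1..n} z * vnorm {1..n} y)" .
qed

text \<open>Testing the form at z = X y gives the square of the norm of X y; one factor
  cancels.\<close>

lemma vnorm_mvec_le:
  assumes "op_le n X \<eta>" "0 \<le> \<eta>"
  shows "vnorm {1..n} (mvec n X y) \<le> \<eta> * vnorm {1..n} y"
proof (cases "vnorm {1..n} (mvec n X y) = 0")
  case True
  then show ?thesis using assms(2) by simp
next
  case False
  let ?w = "vnorm {1..n} (mvec n X y)"
  have "?w * ?w \<le> ?w * (\<eta> * vnorm {1..n} y)"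
    using op_leD[OF assms(1), of "mvec n X y" y]
    by (simp add: dot_self power2_eq_square norm_mult algebra_simps)
  moreover have "0 < ?w" using False by (simp add: order_less_le)
  ultimately show ?thesis by (simp only: mult_le_cancel_left_pos)
qed

lemma vnorm_unit: "k \<in> {1..n} \<Longrightarrow> vnorm {1..n} (\<lambda>j. if j = k then 1 else 0) = 1"
proof -
  assume k: "k \<in> {1..n}"
  have "(vnorm {1..n} (\<lambda>j. if j = k then 1 else 0))\<^sup>2 = 1"
    unfolding vnorm_sq using k by (simp add: if_distrib[of cmod] if_distrib[of "\<lambda>x. x\<^sup>2"] cong: if_cong)
  then show ?thesis by (simp add: power2_eq_1_iff) (metis vnorm_nonneg not_one_le_zero neg_0_le_iff_le)
qed

lemma op_le_column:
  assumes "op_le n X \<eta>" "0 \<le> \<eta>" "j \<in> {1..n}"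
  shows "vnorm {1..n} (\<lambda>i. X i j) \<le> \<eta>"
proof -
  let ?e = "\<lambda>k. if k = j then 1 else (0::complex)"
  have "mvec n X ?e i = X i j" for i
    unfolding mvec_def using assms(3) by (simp add: if_distrib[of "(*) _"] cong: if_cong)
  then show ?thesis
    using vnorm_mvec_le[OF assms(1,2), of ?e] vnorm_unit[OF assms(3)] by (simp cong: vnorm_cong)
qed

lemma op_le_ctrans: "op_le n X \<eta> \<Longrightarrow> op_le n (ctrans X) \<eta>"
  unfolding op_le_def dot_mvec_ctrans[symmetric]
proof (intro allI)
  fix y z
  assume "\<forall>y z. cmod (dot n z (mvec n X y)) \<le> \<eta> * (vnorm {1..n} z * vnorm {1..n} y)"
  then have "cmod (dot n y (mvec n X z)) \<le> \<eta> * (vnorm {1..n} y * vnorm {1..n} z)" by blast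
  then show "cmod (dot n (mvec n X z) y) \<le> \<eta> * (vnorm {1..n} z * vnorm {1..n} y)"
    using dot_cnj[of n "mvec n X z" y] complex_mod_cnj[of "dot n (mvec n X z) y"] by (simp add: mult.commute)
qed

lemma op_le_row:
  assumes "op_le n X \<eta>" "0 \<le> \<eta>" "i \<in> {1..n}"
  shows "vnorm {1..n} (X i) \<le> \<eta>"
  using op_le_column[OF op_le_ctrans[OF assms(1)] assms(2,3)] by (simp add: ctrans_def)

lemma op_le_entry:
  assumes "op_le n X \<eta>" "0 \<le> \<eta>" "i \<in> {1..n}" "j \<in> {1..n}"
  shows "cmod (X i j) \<le> \<eta>"
  using op_le_row[OF assms(1-3)] cmod_le_vnorm[of "{1..n}" j "X i"] assms(4) by simp

lemma unitary_ctrans: "unitary n Q \<Longrightarrow> unitary n (ctrans Q)"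
  by (auto simp: unitary_def)

lemma vnorm_unitary:
  assumes "unitary n Q"
  shows "vnorm {1..n} (mvec n Q y) = vnorm {1..n} y"
proof -
  have "dot n (mvec n Q y) (mvec n Q y) = dot n y (mvec n (mmul n (ctrans Q) Q) y)"
    by (simp add: dot_mvec_ctrans mvec_mmul)
  also have "\<dots> = dot n y (mvec n idm y)"
    using assms by (intro dot_cong mvec_cong) (auto simp: unitary_def)
  also have "\<dots> = dot n y y" by (intro dot_cong) (auto simp: mvec_idm)
  finally have "(vnorm {1..n} (mvec n Q y))\<^sup>2 = (vnorm {1..n} y)\<^sup>2"
    unfolding dot_self of_real_eq_iff .
  then show ?thesis by (simp add: power2_eq_iff_nonneg)
qed

lemma unitary_mmul:
  assumes "unitary n Q" "unitary n U"
  shows "unitary n (mmul n Q U)"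
  unfolding unitary_def
proof (intro ballI conjI)
  fix i j assume ij: "i \<in> {1..n}" "j \<in> {1..n}"
  have "mmul n (ctrans (mmul n Q U)) (mmul n Q U) i j = mmul n (ctrans U) (mmul n (mmul n (ctrans Q) Q) U) i j"
    by (simp add: ctrans_mmul mmul_assoc)
  also have "\<dots> = mmul n (ctrans U) (mmul n idm U) i j"
    using assms(1) ij by (intro mmul_cong) (auto simp: unitary_def)
  also have "\<dots> = mmul n (ctrans U) U i j" by (intro mmul_cong) (auto simp: mmul_idm_left)
  finally show "mmul n (ctrans (mmul n Q U)) (mmul n Q U) i j = idm i j"
    using assms(2) ij by (simp add: unitary_def)
  have "mmul n (mmul n Q U) (ctrans (mmul n Q U)) i j = mmul n Q (mmul n (mmul n U (ctrans U)) (ctrans Q)) i j"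
    by (simp add: ctrans_mmul mmul_assoc)
  also have "\<dots> = mmul n Q (mmul n idm (ctrans Q)) i j"
    using assms(2) ij by (intro mmul_cong) (auto simp: unitary_def)
  also have "\<dots> = mmul n Q (ctrans Q) i j" by (intro mmul_cong) (auto simp: mmul_idm_left)
  finally show "mmul n (mmul n Q U) (ctrans (mmul n Q U)) i j = idm i j"
    using assms(1) ij by (simp add: unitary_def)
qed

lemma op_le_conj:
  assumes "op_le n X \<eta>" "unitary n Q"
  shows "op_le n (mmul n (ctrans Q) (mmul n X Q)) \<eta>"
  unfolding op_le_def mvec_mmul dot_mvec_ctrans[symmetric]
  using op_leD[OF assms(1), of "mvec n Q z" "mvec n Q y" for z y] vnorm_unitary[OF assms(2)] by simp

lemma unitary_cancel:
  assumes "unitary n Q" "i \<in> {1..n}" "j \<in> {1..n}"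
  shows "mmul n (ctrans Q) (mmul n (mmul n Q (mmul n X (ctrans Q))) Q) i j = X i j"
proof -
  have "mmul n (ctrans Q) (mmul n (mmul n Q (mmul n X (ctrans Q))) Q) i j
      = mmul n (mmul n (ctrans Q) Q) (mmul n X (mmul n (ctrans Q) Q)) i j"
    by (simp add: mmul_assoc)
  also have "\<dots> = mmul n idm (mmul n X idm) i j"
    using assms unfolding unitary_def by (intro mmul_cong) auto
  also have "\<dots> = X i j" using assms by (simp add: mmul_idm_left mmul_idm_right)
  finally show ?thesis .
qed

lemma unitary_cancel_vec:
  assumes "unitary n Q" "i \<in> {1..n}"
  shows "mvec n (ctrans Q) (mvec n Q x) i = x i"
proof -
  have "mvec n (ctrans Q) (mvec n Q x) i = mvec n (mmul n (ctrans Q) Q) x i"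
    by (simp add: mvec_mmul)
  also have "\<dots> = mvec n idm x i" using assms unfolding unitary_def by (intro mvec_cong) auto
  finally show ?thesis using assms by (simp add: mvec_idm)
qed

lemma unitary_idm: "unitary n idm"
  by (auto simp: unitary_def mmul_idm_left mmul_idm_right ctrans_def idm_def)

section \<open>Givens rotations in floating point arithmetic\<close>

text \<open>Exact arithmetic as one more instance of \<open>fparith\<close>: computed and exact
  rotations become two runs of the same program.\<close>

definition exact :: fparith where
  "exact = \<lparr> fadd = (+), fsub = (-), fmul = (*), fdiv = (/), fsqrt = sqrt \<rparr>"

lemma exact_simps [simp]:
  "fadd exact = (+)" "fsub exact = (-)" "fmul exact = (*)" "fdiv exact = (/)" "fsqrt exact = sqrt"
  by (simp_all add: exact_def)

definition row_vec :: "fparith \<Rightarrow> rotation \<Rightarrow> (nat \<Rightarrow> complex) \<Rightarrow> nat \<Rightarrow> complex" where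
  "row_vec ar = (\<lambda>(k, c, s) y j.
     if j = k then fadd ar (fmul ar (y k) c) (fmul ar (y (k + 1)) s)
     else if j = k + 1 then fadd ar (fmul ar (y k) (- cnj s)) (fmul ar (y (k + 1)) (cnj c))
     else y j)"

lemma rot_right_row: "rot_right ar g X i = row_vec ar g (X i)"
  by (cases g) (simp add: rot_right_def row_vec_def)

lemma fold_rot_right: "fold (rot_right ar) gs X i = fold (row_vec ar) gs (X i)"
  by (induction gs arbitrary: X) (simp_all add: rot_right_row)

lemma fold_rot_left: "(\<lambda>i. fold (rot_left ar) gs X i j) = fold (rot_vec ar) gs (\<lambda>i. X i j)"
proof (induction gs arbitrary: X)
  case (Cons g gs)
  show ?case using Cons[of "rot_left ar g X"] by (simp add: rot_left_def)
qed simp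

text \<open>A computed rotation and a truly unitary one on the same indices. In use the unitary one
  is built from the computed entries, not from those of an exact run: each step is compared only
  with its own input. The factor 10 is the one found in \<open>givens_near\<close>.\<close>

definition near :: "real \<Rightarrow> rotation \<Rightarrow> rotation \<Rightarrow> bool" where
  "near \<epsilon> = (\<lambda>(k, c, s) (k', c', s'). k' = k \<and> (cmod c')\<^sup>2 + (cmod s')\<^sup>2 = 1 \<and>
     cmod (c - c') \<le> 10 * \<epsilon> \<and> cmod (s - s') \<le> 10 * \<epsilon>)"

text \<open>\<open>f'\<close> is the exact isometry and \<open>f\<close> its rounded version.
  Compatibility with differences is what lets an earlier error be carried through \<open>f'\<close>
  with unchanged norm.\<close>

definition near_iso ::
  "nat set \<Rightarrow> real \<Rightarrow> ((nat \<Rightarrow> complex) \<Rightarrow> nat \<Rightarrow> complex) \<Rightarrow> ((nat \<Rightarrow> complex) \<Rightarrow> nat \<Rightarrow> complex) \<Rightarrow> bool"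
  where
  "near_iso B \<tau> f f' \<longleftrightarrow>
     (\<forall>x. vnorm B (\<lambda>i. f x i - f' x i) \<le> \<tau> * vnorm B x \<and> vnorm B (f' x) = vnorm B x) \<and>
     (\<forall>x y. f' (\<lambda>i. x i - y i) = (\<lambda>i. f' x i - f' y i))"

text \<open>The total error is the error of \<open>g\<close> at \<open>f x\<close> plus
  \<open>g'\<close> applied to the error of \<open>f\<close>, and \<open>g'\<close> keeps the norm
  of the latter.\<close>

lemma near_iso_comp:
  assumes f: "near_iso B \<sigma> f f'" and g: "near_iso B \<tau> g g'" and t: "0 \<le> \<tau>"
  shows "near_iso B ((1 + \<sigma>) * (1 + \<tau>) - 1) (\<lambda>x. g (f x)) (\<lambda>x. g' (f' x))"
  unfolding near_iso_def
proof (intro conjI allI)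
  fix x
  have fx: "vnorm B (\<lambda>i. f x i - f' x i) \<le> \<sigma> * vnorm B x" "vnorm B (f' x) = vnorm B x"
    using f by (auto simp: near_iso_def)
  have lin: "g' (\<lambda>i. f x i - f' x i) = (\<lambda>i. g' (f x) i - g' (f' x) i)"
    using g unfolding near_iso_def by blast
  have "vnorm B (f x) \<le> vnorm B (\<lambda>i. f x i - f' x i) + vnorm B (f' x)"
    using vnorm_triangle[of B "\<lambda>i. f x i - f' x i" "f' x"] by simp
  then have le: "vnorm B (f x) \<le> (1 + \<sigma>) * vnorm B x"
    using fx by (simp add: algebra_simps)
  have "vnorm B (\<lambda>i. g (f x) i - g' (f' x) i)
      \<le> vnorm B (\<lambda>i. g (f x) i - g' (f x) i) + vnorm B (\<lambda>i. g' (f x) i - g' (f' x) i)"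
    by (rule vnorm_triangle_diff)
  also have "\<dots> \<le> \<tau> * vnorm B (f x) + vnorm B (\<lambda>i. f x i - f' x i)"
  proof (rule add_mono)
    have "vnorm B (g' (\<lambda>i. f x i - f' x i)) = vnorm B (\<lambda>i. f x i - f' x i)"
      using g unfolding near_iso_def by blast
    then show "vnorm B (\<lambda>i. g' (f x) i - g' (f' x) i) \<le> vnorm B (\<lambda>i. f x i - f' x i)"
      unfolding lin by simp
  qed (use g in \<open>simp add: near_iso_def\<close>)
  also have "\<dots> \<le> \<tau> * ((1 + \<sigma>) * vnorm B x) + \<sigma> * vnorm B x"
    using le t fx by (intro add_mono mult_left_mono) auto
  finally show "vnorm B (\<lambda>i. g (f x) i - g' (f' x) i) \<le> ((1 + \<sigma>) * (1 + \<tau>) - 1) * vnorm B x"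
    by (simp add: algebra_simps)
  show "vnorm B (g' (f' x)) = vnorm B x" using f g by (simp add: near_iso_def)
next
  fix x y
  show "g' (f' (\<lambda>i. x i - y i)) = (\<lambda>i. g' (f' x) i - g' (f' y) i)"
    using f g unfolding near_iso_def by simp
qed

lemma near_iso_mono: "near_iso B \<tau> f f' \<Longrightarrow> \<tau> \<le> \<tau>' \<Longrightarrow> near_iso B \<tau>' f f'"
  unfolding near_iso_def by (meson mult_right_mono order_trans vnorm_nonneg)

lemma near_iso_fold:
  assumes "list_all2 P gs gs'" "\<And>g g'. g \<in> set gs \<Longrightarrow> P g g' \<Longrightarrow> near_iso B \<tau> (f g) (f' g')" "0 \<le> \<tau>"
  shows "near_iso B ((1 + \<tau>) ^ length gs - 1) (fold f gs) (fold f' gs')"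
  using assms
proof (induction gs gs' rule: list_all2_induct)
  case Nil
  then show ?case by (simp add: near_iso_def vnorm_def L2_set_constant)
next
  case (Cons g gs g' gs')
  have 1: "near_iso B ((1 + \<tau>) ^ length gs - 1) (fold f gs) (fold f' gs')"
    using Cons by simp
  have 2: "near_iso B \<tau> (f g) (f' g')" using Cons by simp
  have "0 \<le> (1 + \<tau>) ^ length gs - 1" using Cons.prems by simp
  from near_iso_comp[OF 2 1 this] show ?case by (simp add: o_def algebra_simps)
qed

lemma std_opE:
  assumes "std_op \<epsilon> f fl"
  obtains \<delta> where "cmod \<delta> \<le> \<epsilon>" "fl a b = f a b * (1 + \<delta>)"
  using assms unfolding std_op_def by blast

text \<open>Each product carries the coefficient error 10 \<epsilon> and two roundings, one from the
  multiplication and one from the addition; the thirteenth \<epsilon> pays for their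
  products.\<close>

lemma fl_lincomb:
  assumes m: "standard_model \<epsilon> ar" and e: "0 \<le> \<epsilon>" "\<epsilon> \<le> 1 / 1000"
    and a: "cmod (a - a') \<le> 10 * \<epsilon>" "cmod a' \<le> 1" and b: "cmod (b - b') \<le> 10 * \<epsilon>" "cmod b' \<le> 1"
  shows "cmod (fadd ar (fmul ar a x) (fmul ar b y) - (a' * x + b' * y)) \<le> 13 * \<epsilon> * (cmod x + cmod y)"
    and "cmod (fadd ar (fmul ar x a) (fmul ar y b) - (x * a' + y * b')) \<le> 13 * \<epsilon> * (cmod x + cmod y)"
proof -
  have one: "cmod (a * x * (1 + d) * (1 + d') - a' * x) \<le> 13 * \<epsilon> * cmod x"
    if "cmod (a - a') \<le> 10 * \<epsilon>" "cmod a' \<le> 1" "cmod d \<le> \<epsilon>" "cmod d' \<le> \<epsilon>" for a a' x d d'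
  proof -
    have na: "cmod a \<le> 1 + 10 * \<epsilon>" using that(1,2) norm_triangle_ineq2[of a a'] by simp
    have "cmod (d + d' + d * d') \<le> cmod d + cmod d' + cmod d * cmod d'"
      by (metis norm_mult norm_triangle_mono norm_triangle_ineq order_refl)
    also have "\<dots> \<le> \<epsilon> + \<epsilon> + \<epsilon> * \<epsilon>" using that e by (intro add_mono mult_mono) auto
    finally have dd: "cmod (d + d' + d * d') \<le> \<epsilon> + \<epsilon> + \<epsilon> * \<epsilon>" .
    have "a * x * (1 + d) * (1 + d') - a' * x = (a - a') * x + a * (d + d' + d * d') * x"
      by (simp add: algebra_simps)
    then have "cmod (a * x * (1 + d) * (1 + d') - a' * x)
        \<le> cmod (a - a') * cmod x + cmod a * cmod (d + d' + d * d') * cmod x"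
      by (metis norm_mult norm_triangle_ineq)
    also have "\<dots> \<le> (10 * \<epsilon>) * cmod x + (1 + 10 * \<epsilon>) * (\<epsilon> + \<epsilon> + \<epsilon> * \<epsilon>) * cmod x"
      using that na dd e by (intro add_mono mult_mono) auto
    also have "\<dots> = (10 * \<epsilon> + (1 + 10 * \<epsilon>) * (2 * \<epsilon> + \<epsilon> * \<epsilon>)) * cmod x" by (simp add: algebra_simps)
    also have "\<dots> \<le> 13 * \<epsilon> * cmod x"
    proof (intro mult_right_mono)
      have "\<epsilon> * \<epsilon> \<le> \<epsilon> * (1/1000)" using e by (intro mult_left_mono) auto
      moreover have "\<epsilon> * \<epsilon> * \<epsilon> \<le> \<epsilon> * (1/1000)"
      proof -
        have "\<epsilon> * (\<epsilon> * \<epsilon>) \<le> \<epsilon> * (1/1000 * 1)" using e by (intro mult_left_mono mult_mono) auto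
        then show ?thesis by (simp add: mult.assoc)
      qed
      ultimately show "10 * \<epsilon> + (1 + 10 * \<epsilon>) * (2 * \<epsilon> + \<epsilon> * \<epsilon>) \<le> 13 * \<epsilon>"
        using e by (simp add: algebra_simps)
    qed auto
    finally show ?thesis .
  qed
  have gen: "cmod ((a * x * (1 + d1) + b * y * (1 + d2)) * (1 + d3) - (a' * x + b' * y))
      \<le> 13 * \<epsilon> * (cmod x + cmod y)"
    if "cmod d1 \<le> \<epsilon>" "cmod d2 \<le> \<epsilon>" "cmod d3 \<le> \<epsilon>" for d1 d2 d3
  proof -
    have "(a * x * (1 + d1) + b * y * (1 + d2)) * (1 + d3) - (a' * x + b' * y)
        = (a * x * (1 + d1) * (1 + d3) - a' * x) + (b * y * (1 + d2) * (1 + d3) - b' * y)"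
      by (simp add: algebra_simps)
    then have "cmod ((a * x * (1 + d1) + b * y * (1 + d2)) * (1 + d3) - (a' * x + b' * y))
        \<le> cmod (a * x * (1 + d1) * (1 + d3) - a' * x) + cmod (b * y * (1 + d2) * (1 + d3) - b' * y)"
      by (metis norm_triangle_ineq)
    then show ?thesis using one[OF a that(1) that(3), of x] one[OF b that(2) that(3), of y]
      by (simp add: algebra_simps)
  qed
  have sm: "std_op \<epsilon> (+) (fadd ar)" "std_op \<epsilon> (*) (fmul ar)"
    using m by (auto simp: standard_model_def)
  obtain d1 where d1: "cmod d1 \<le> \<epsilon>" "fmul ar a x = a * x * (1 + d1)" using std_opE[OF sm(2)] .
  obtain d2 where d2: "cmod d2 \<le> \<epsilon>" "fmul ar b y = b * y * (1 + d2)" using std_opE[OF sm(2)] .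
  obtain d3 where d3: "cmod d3 \<le> \<epsilon>"
      "fadd ar (a * x * (1 + d1)) (b * y * (1 + d2)) = (a * x * (1 + d1) + b * y * (1 + d2)) * (1 + d3)"
    using std_opE[OF sm(1)] .
  show "cmod (fadd ar (fmul ar a x) (fmul ar b y) - (a' * x + b' * y)) \<le> 13 * \<epsilon> * (cmod x + cmod y)"
    unfolding d1 d2 d3 by (rule gen) fact+
  obtain d1 where d1: "cmod d1 \<le> \<epsilon>" "fmul ar x a = x * a * (1 + d1)" using std_opE[OF sm(2)] .
  obtain d2 where d2: "cmod d2 \<le> \<epsilon>" "fmul ar y b = y * b * (1 + d2)" using std_opE[OF sm(2)] .
  obtain d3 where d3: "cmod d3 \<le> \<epsilon>"
      "fadd ar (x * a * (1 + d1)) (y * b * (1 + d2)) = (x * a * (1 + d1) + y * b * (1 + d2)) * (1 + d3)"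
    using std_opE[OF sm(1)] .
  show "cmod (fadd ar (fmul ar x a) (fmul ar y b) - (x * a' + y * b')) \<le> 13 * \<epsilon> * (cmod x + cmod y)"
    unfolding d1 d2 d3 using gen[OF d1(1) d2(1) d3(1)] by (simp add: mult.commute)
qed

lemma sum_pair:
  assumes "finite B" "k \<in> B" "Suc k \<in> B"
  shows "(\<Sum>i\<in>B. f i) = f k + f (Suc k) + (\<Sum>i\<in>B - {k, Suc k}. f i :: 'a :: comm_monoid_add)"
proof -
  have "sum f B = sum f (B - {k, Suc k}) + sum f {k, Suc k}"
    using assms by (intro sum.subset_diff) auto
  then show ?thesis by (simp add: add.commute)
qed

lemma pair_isometry:
  assumes "(cmod c)\<^sup>2 + (cmod s)\<^sup>2 = 1"
  shows "(cmod (cnj c * x + cnj s * y))\<^sup>2 + (cmod (- s * x + c * y))\<^sup>2 = (cmod x)\<^sup>2 + (cmod y)\<^sup>2"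
proof -
  have eq: "complex_of_real ((cmod w)\<^sup>2) = w * cnj w" for w by (rule complex_norm_square)
  have cs: "c * cnj c + s * cnj s = 1"
    using assms eq[of c] eq[of s] by (metis of_real_1 of_real_add)
  have "complex_of_real ((cmod (cnj c * x + cnj s * y))\<^sup>2 + (cmod (- s * x + c * y))\<^sup>2)
      = (c * cnj c + s * cnj s) * (x * cnj x + y * cnj y)"
    unfolding of_real_add eq by (simp add: algebra_simps)
  also have "\<dots> = complex_of_real ((cmod x)\<^sup>2 + (cmod y)\<^sup>2)"
    unfolding of_real_add eq cs by simp
  finally show ?thesis using of_real_eq_iff by blast
qed

text \<open>The factor 2 is sqrt 2 for the two nonzero components times sqrt 2 from (a + b)^2 \<le>
  2 (a^2 + b^2).\<close>

lemma vnorm_two_entries: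
  assumes B: "finite B" "k \<in> B" "Suc k \<in> B" and t: "0 \<le> t"
    and z: "\<And>i. i \<noteq> k \<Longrightarrow> i \<noteq> Suc k \<Longrightarrow> z i = 0"
    and k: "cmod (z k) \<le> t * (cmod (x k) + cmod (x (Suc k)))"
      "cmod (z (Suc k)) \<le> t * (cmod (x k) + cmod (x (Suc k)))"
  shows "vnorm B z \<le> 2 * t * vnorm B x"
proof -
  let ?a = "cmod (x k)" and ?b = "cmod (x (Suc k))"
  have "(vnorm B z)\<^sup>2 = (cmod (z k))\<^sup>2 + (cmod (z (Suc k)))\<^sup>2"
    unfolding vnorm_sq by (subst sum_pair[OF B]) (simp add: z)
  also have "\<dots> \<le> (t * (?a + ?b))\<^sup>2 + (t * (?a + ?b))\<^sup>2"
    using k by (intro add_mono power_mono) auto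
  also have "\<dots> = t\<^sup>2 * (2 * (?a + ?b)\<^sup>2)" by (simp add: power_mult_distrib)
  also have "\<dots> \<le> t\<^sup>2 * (4 * (?a\<^sup>2 + ?b\<^sup>2))"
    using sum_squares_bound[of ?a ?b] by (intro mult_left_mono) (auto simp: power2_eq_square algebra_simps)
  also have "\<dots> \<le> t\<^sup>2 * (4 * (vnorm B x)\<^sup>2)"
    unfolding vnorm_sq by (subst sum_pair[OF B]) (auto intro!: mult_left_mono sum_nonneg)
  also have "\<dots> = (2 * t * vnorm B x)\<^sup>2" by (simp add: power_mult_distrib)
  finally show ?thesis by (rule power2_le_imp_le) (use t in auto)
qed

lemma near_bounds:
  assumes "near \<epsilon> (k, c, s) (k', c', s')"
  shows "k' = k" "cmod c' \<le> 1" "cmod s' \<le> 1" "(cmod c')\<^sup>2 + (cmod s')\<^sup>2 = 1"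
    "cmod (c - c') \<le> 10 * \<epsilon>" "cmod (s - s') \<le> 10 * \<epsilon>"
proof -
  show u: "(cmod c')\<^sup>2 + (cmod s')\<^sup>2 = 1" and "k' = k" "cmod (c - c') \<le> 10 * \<epsilon>" "cmod (s - s') \<le> 10 * \<epsilon>"
    using assms by (auto simp: near_def)
  have "(cmod c')\<^sup>2 \<le> 1\<^sup>2" "(cmod s')\<^sup>2 \<le> 1\<^sup>2"
    using u zero_le_power2[of "cmod c'"] zero_le_power2[of "cmod s'"] unfolding one_power2 by linarith+
  then show "cmod c' \<le> 1" "cmod s' \<le> 1" using abs_square_le_1[of "cmod c'"] abs_square_le_1[of "cmod s'"] by simp_all
qed

lemma near_cnj: "cmod (c - c') \<le> r \<Longrightarrow> cmod (cnj c - cnj c') \<le> r"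
  by (metis complex_cnj_diff complex_mod_cnj)

lemma near_neg: "cmod (c - c') \<le> r \<Longrightarrow> cmod (- c - - c') \<le> r"
  by (simp add: norm_minus_commute)

lemma rot_vec_near_iso:
  assumes m: "standard_model \<epsilon> ar" and e: "0 \<le> \<epsilon>" "\<epsilon> \<le> 1 / 1000"
    and g: "near \<epsilon> g g'" and B: "finite B" "fst g \<in> B" "Suc (fst g) \<in> B"
  shows "near_iso B (26 * \<epsilon>) (rot_vec ar g) (rot_vec exact g')"
    and "near_iso B (26 * \<epsilon>) (row_vec ar g) (row_vec exact g')"
proof -
  obtain k c s where gg: "g = (k, c, s)" by (cases g)
  obtain k' c' s' where gg': "g' = (k', c', s')" by (cases g')
  note nb = near_bounds[OF g[unfolded gg gg']]
  have k: "k' = k" by (rule nb)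
  have B': "k \<in> B" "Suc k \<in> B" using B gg by auto
  note fl = fl_lincomb[OF m e]
  show "near_iso B (26 * \<epsilon>) (rot_vec ar g) (rot_vec exact g')"
    unfolding near_iso_def
  proof (intro conjI allI)
    fix x
    let ?z = "\<lambda>i. rot_vec ar g x i - rot_vec exact g' x i"
    have "vnorm B ?z \<le> 2 * (13 * \<epsilon>) * vnorm B x"
    proof (rule vnorm_two_entries[OF B(1) B'])
      show "cmod (?z k) \<le> 13 * \<epsilon> * (cmod (x k) + cmod (x (Suc k)))"
        using fl(1)[of "cnj c" "cnj c'" "cnj s" "cnj s'" "x k" "x (Suc k)"] nb near_cnj
        by (simp add: gg gg' k rot_vec_def)
      show "cmod (?z (Suc k)) \<le> 13 * \<epsilon> * (cmod (x k) + cmod (x (Suc k)))"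
        using fl(1)[of "- s" "- s'" "c" "c'" "x k" "x (Suc k)"] nb near_neg[of s s']
        by (simp add: gg gg' k rot_vec_def)
    qed (use e in \<open>auto simp: gg gg' k rot_vec_def\<close>)
    then show "vnorm B ?z \<le> 26 * \<epsilon> * vnorm B x" by simp
    have "(vnorm B (rot_vec exact g' x))\<^sup>2 = (vnorm B x)\<^sup>2"
      unfolding vnorm_sq using pair_isometry[OF nb(4), of "x k" "x (Suc k)"]
      by (subst (1 2) sum_pair[OF B(1) B']) (auto simp: gg' k rot_vec_def intro!: sum.cong)
    then show "vnorm B (rot_vec exact g' x) = vnorm B x" by (simp add: power2_eq_iff_nonneg)
  qed (auto simp: gg' rot_vec_def fun_eq_iff algebra_simps)
  show "near_iso B (26 * \<epsilon>) (row_vec ar g) (row_vec exact g')"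
    unfolding near_iso_def
  proof (intro conjI allI)
    fix x
    let ?z = "\<lambda>i. row_vec ar g x i - row_vec exact g' x i"
    have "vnorm B ?z \<le> 2 * (13 * \<epsilon>) * vnorm B x"
    proof (rule vnorm_two_entries[OF B(1) B'])
      show "cmod (?z k) \<le> 13 * \<epsilon> * (cmod (x k) + cmod (x (Suc k)))"
        using fl(2)[of "c" "c'" "s" "s'" "x k" "x (Suc k)"] nb
        by (simp add: gg gg' k row_vec_def)
      show "cmod (?z (Suc k)) \<le> 13 * \<epsilon> * (cmod (x k) + cmod (x (Suc k)))"
        using fl(2)[of "- cnj s" "- cnj s'" "cnj c" "cnj c'" "x k" "x (Suc k)"] nb
          near_neg[OF near_cnj[of s s']] near_cnj
        by (simp add: gg gg' k row_vec_def)
    qed (use e in \<open>auto simp: gg gg' k row_vec_def\<close>)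
    then show "vnorm B ?z \<le> 26 * \<epsilon> * vnorm B x" by simp
    have "(cmod (x k * c' + x (Suc k) * s'))\<^sup>2 + (cmod (x (Suc k) * cnj c' - x k * cnj s'))\<^sup>2
        = (cmod (x k))\<^sup>2 + (cmod (x (Suc k)))\<^sup>2"
      using pair_isometry[of "cnj c'" "cnj s'" "x k" "x (Suc k)"] nb(4) by (simp add: algebra_simps)
    then have "(vnorm B (row_vec exact g' x))\<^sup>2 = (vnorm B x)\<^sup>2"
      unfolding vnorm_sq
      by (subst (1 2) sum_pair[OF B(1) B']) (auto simp: gg' k row_vec_def algebra_simps intro!: sum.cong)
    then show "vnorm B (row_vec exact g' x) = vnorm B x" by (simp add: power2_eq_iff_nonneg)
  qed (auto simp: gg' row_vec_def fun_eq_iff algebra_simps)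
qed

text \<open>For at most two rotations (1 + 26 \<epsilon>)^2 - 1 = 52 \<epsilon> + 676 \<epsilon>^2,
  which stays below 60 \<epsilon>; 26 is twice the 13 of \<open>fl_lincomb\<close>.\<close>

lemma near_iso_rotations:
  assumes m: "standard_model \<epsilon> ar" and e: "0 \<le> \<epsilon>" "\<epsilon> \<le> 1 / 1000"
    and gs: "list_all2 (near \<epsilon>) gs gs'" "length gs \<le> 2"
    and B: "finite B" "\<And>g. g \<in> set gs \<Longrightarrow> fst g \<in> B \<and> Suc (fst g) \<in> B"
  shows "near_iso B (60 * \<epsilon>) (fold (rot_vec ar) gs) (fold (rot_vec exact) gs')"
    and "near_iso B (60 * \<epsilon>) (fold (row_vec ar) gs) (fold (row_vec exact) gs')"
proof -
  have "(1 + 26 * \<epsilon>) ^ length gs \<le> (1 + 26 * \<epsilon>)\<^sup>2"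
    using gs(2) e by (intro power_increasing) auto
  also have "\<dots> = 1 + 52 * \<epsilon> + 676 * (\<epsilon> * \<epsilon>)" by (simp add: power2_eq_square algebra_simps)
  also have "\<epsilon> * \<epsilon> \<le> \<epsilon> * (1/1000)" using e by (intro mult_left_mono) auto
  finally have le: "(1 + 26 * \<epsilon>) ^ length gs - 1 \<le> 60 * \<epsilon>" using e by simp
  have e26: "0 \<le> 26 * \<epsilon>" using e by simp
  show "near_iso B (60 * \<epsilon>) (fold (rot_vec ar) gs) (fold (rot_vec exact) gs')"
    by (rule near_iso_mono[OF near_iso_fold[OF gs(1) rot_vec_near_iso(1)[OF m e] e26] le])
       (use B in auto)
  show "near_iso B (60 * \<epsilon>) (fold (row_vec ar) gs) (fold (row_vec exact) gs')"
    by (rule near_iso_mono[OF near_iso_fold[OF gs(1) rot_vec_near_iso(2)[OF m e] e26] le])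
       (use B in auto)
qed

section \<open>Rounding errors in computing a Givens rotation\<close>

lemma std_op_real:
  assumes "std_op \<epsilon> f fl" "\<And>x y. f (complex_of_real x) (of_real y) = of_real (h x y)"
  obtains d where "\<bar>d\<bar> \<le> \<epsilon>" "fl (of_real x) (of_real y) = of_real (h x y * (1 + d))"
proof -
  obtain \<delta> where "cmod \<delta> \<le> \<epsilon>" "\<delta> \<in> \<real>" "fl (of_real x) (of_real y) = f (of_real x) (of_real y) * (1 + \<delta>)"
    using assms(1) unfolding std_op_def by (meson Reals_of_real)
  moreover from this obtain d where "\<delta> = of_real d" by (auto elim: Reals_cases)
  ultimately show thesis using assms(2) that[of d] by simp
qed

lemma rel_err_mult:
  assumes "\<bar>V - S\<bar> \<le> a * S" "\<bar>d\<bar> \<le> \<epsilon>" "0 \<le> S" "0 \<le> \<epsilon>" "\<epsilon> \<le> 1/1000" "0 \<le> a" "a \<le> 1"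
  shows "\<bar>V * (1 + d) - S\<bar> \<le> (a + \<epsilon> * (1 + a)) * (S::real)"
proof -
  have "\<bar>V\<bar> \<le> (1 + a) * S" using assms by (simp add: algebra_simps abs_le_iff)
  then have "\<bar>V\<bar> * \<bar>d\<bar> \<le> ((1 + a) * S) * \<epsilon>" using assms by (intro mult_mono) auto
  moreover have "\<bar>V * (1 + d) - S\<bar> \<le> \<bar>V - S\<bar> + \<bar>V\<bar> * \<bar>d\<bar>"
    using abs_triangle_ineq[of "V - S" "V * d"] by (simp add: algebra_simps abs_mult)
  ultimately show ?thesis using assms(1) by (simp add: algebra_simps)
qed

text \<open>Both squares are nonnegative, so the addition cannot cancel and all errors are relative
  to the sum. The result is real because the errors on real operands are.\<close>

lemma fl_abs2_err:
  assumes m: "standard_model \<epsilon> ar" and e: "0 \<le> \<epsilon>" "\<epsilon> \<le> 1 / 1000"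
  obtains V where "fl_abs2 ar a = of_real V" "\<bar>V - (cmod a)\<^sup>2\<bar> \<le> 3 * \<epsilon> * (cmod a)\<^sup>2"
proof -
  have sm: "std_op \<epsilon> (+) (fadd ar)" "std_op \<epsilon> (*) (fmul ar)"
    using m by (auto simp: standard_model_def)
  note addr = std_op_real[OF sm(1), of "(+)", OF of_real_add[symmetric]]
  note mulr = std_op_real[OF sm(2), of "(*)", OF of_real_mult[symmetric]]
  let ?x = "Re a" and ?y = "Im a"
  obtain d1 where d1: "\<bar>d1\<bar> \<le> \<epsilon>" "fmul ar (of_real ?x) (of_real ?x) = of_real (?x * ?x * (1 + d1))"
    by (rule mulr)
  obtain d2 where d2: "\<bar>d2\<bar> \<le> \<epsilon>" "fmul ar (of_real ?y) (of_real ?y) = of_real (?y * ?y * (1 + d2))"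
    by (rule mulr)
  define U where "U = ?x * ?x * (1 + d1) + ?y * ?y * (1 + d2)"
  obtain d3 where d3: "\<bar>d3\<bar> \<le> \<epsilon>" "fl_abs2 ar a = of_real (U * (1 + d3))"
    unfolding fl_abs2_def d1(2) d2(2) U_def by (rule addr)
  have sq: "(cmod a)\<^sup>2 = ?x * ?x + ?y * ?y" using cmod_power2[of a] by (simp add: power2_eq_square)
  have "\<bar>U - (cmod a)\<^sup>2\<bar> = \<bar>?x * ?x * d1 + ?y * ?y * d2\<bar>" by (simp add: U_def sq algebra_simps)
  also have "\<dots> \<le> ?x * ?x * \<bar>d1\<bar> + ?y * ?y * \<bar>d2\<bar>"
    using abs_triangle_ineq[of "?x * ?x * d1" "?y * ?y * d2"] by (simp add: abs_mult)
  also have "\<dots> \<le> ?x * ?x * \<epsilon> + ?y * ?y * \<epsilon>" using d1 d2 by (intro add_mono mult_left_mono) auto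
  finally have "\<bar>U - (cmod a)\<^sup>2\<bar> \<le> \<epsilon> * (cmod a)\<^sup>2" by (simp add: sq algebra_simps)
  from rel_err_mult[OF this d3(1)] e
  have "\<bar>U * (1 + d3) - (cmod a)\<^sup>2\<bar> \<le> (\<epsilon> + \<epsilon> * (1 + \<epsilon>)) * (cmod a)\<^sup>2" by simp
  also have "\<dots> \<le> 3 * \<epsilon> * (cmod a)\<^sup>2"
    using e mult_left_mono[of \<epsilon> "1/1000" \<epsilon>] by (intro mult_right_mono) (auto simp: algebra_simps)
  finally show thesis using that d3(2) by blast
qed

text \<open>The relative error grows from 3 \<epsilon> (the squared moduli) to 5 \<epsilon> (their
  sum) to 7 \<epsilon> (the root). The root does not amplify it, since \<bar>sqrt V - sqrt S\<bar>
  is at most \<bar>V - S\<bar> / sqrt S.\<close>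

lemma fl_norm2_err:
  assumes m: "standard_model \<epsilon> ar" and e: "0 \<le> \<epsilon>" "\<epsilon> \<le> 1 / 1000"
  obtains r where "fl_norm2 ar a b = of_real r"
    "\<bar>r - sqrt ((cmod a)\<^sup>2 + (cmod b)\<^sup>2)\<bar> \<le> 7 * \<epsilon> * sqrt ((cmod a)\<^sup>2 + (cmod b)\<^sup>2)"
proof -
  define S where "S = (cmod a)\<^sup>2 + (cmod b)\<^sup>2"
  have S0: "0 \<le> S" by (simp add: S_def)
  obtain A where A: "fl_abs2 ar a = of_real A" "\<bar>A - (cmod a)\<^sup>2\<bar> \<le> 3 * \<epsilon> * (cmod a)\<^sup>2"
    using fl_abs2_err[OF m e] .
  obtain B where B: "fl_abs2 ar b = of_real B" "\<bar>B - (cmod b)\<^sup>2\<bar> \<le> 3 * \<epsilon> * (cmod b)\<^sup>2"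
    using fl_abs2_err[OF m e] .
  have sm: "std_op \<epsilon> (+) (fadd ar)" using m by (auto simp: standard_model_def)
  obtain d where d: "\<bar>d\<bar> \<le> \<epsilon>" "fadd ar (fl_abs2 ar a) (fl_abs2 ar b) = of_real ((A + B) * (1 + d))"
    unfolding A B by (rule std_op_real[OF sm, of "(+)", OF of_real_add[symmetric]])
  define V where "V = (A + B) * (1 + d)"
  have "\<bar>(A + B) - S\<bar> \<le> 3 * \<epsilon> * S" using A B by (simp add: S_def algebra_simps abs_le_iff)
  from rel_err_mult[OF this d(1)] e S0
  have "\<bar>V - S\<bar> \<le> (3 * \<epsilon> + \<epsilon> * (1 + 3 * \<epsilon>)) * S" by (simp add: V_def)
  also have "\<dots> \<le> 5 * \<epsilon> * S"
    using e S0 mult_left_mono[of \<epsilon> "1/1000" \<epsilon>] by (intro mult_right_mono) (auto simp: algebra_simps)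
  finally have VS: "\<bar>V - S\<bar> \<le> 5 * \<epsilon> * S" .
  then have V0: "0 \<le> V"
    using e S0 mult_right_mono[of "5 * \<epsilon>" 1 S] by (simp add: abs_le_iff)
  have sq: "\<bar>sqrt V - sqrt S\<bar> \<le> 5 * \<epsilon> * sqrt S"
  proof (cases "S = 0")
    case True
    then show ?thesis using VS by simp
  next
    case False
    then have Sp: "0 < sqrt S" using S0 by simp
    have "\<bar>sqrt V - sqrt S\<bar> * sqrt S \<le> \<bar>sqrt V - sqrt S\<bar> * (sqrt V + sqrt S)"
      using V0 by (intro mult_left_mono) auto
    also have "\<dots> = \<bar>(sqrt V - sqrt S) * (sqrt V + sqrt S)\<bar>"
      using V0 S0 by (simp add: abs_mult)
    also have "(sqrt V - sqrt S) * (sqrt V + sqrt S) = V - S"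
      using V0 S0 by (simp add: algebra_simps)
    also have "\<bar>V - S\<bar> \<le> (5 * \<epsilon> * sqrt S) * sqrt S" using VS S0 by (simp add: mult.assoc)
    finally show ?thesis using Sp by (simp only: mult_le_cancel_right_pos)
  qed
  obtain d' where d': "\<bar>d'\<bar> \<le> \<epsilon>" "fsqrt ar V = sqrt V * (1 + d')"
    using m V0 unfolding standard_model_def by blast
  from rel_err_mult[OF sq d'(1)] e S0
  have "\<bar>sqrt V * (1 + d') - sqrt S\<bar> \<le> (5 * \<epsilon> + \<epsilon> * (1 + 5 * \<epsilon>)) * sqrt S" by simp
  also have "\<dots> \<le> 7 * \<epsilon> * sqrt S"
    using e S0 mult_left_mono[of \<epsilon> "1/1000" \<epsilon>] by (intro mult_right_mono) (auto simp: algebra_simps)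
  finally show thesis
    using that[of "sqrt V * (1 + d')"] d' unfolding fl_norm2_def d(2) V_def[symmetric] S_def[symmetric] by simp
qed

text \<open>The exact rotation divides by the true norm \<rho>. The quotients differ by the 7
  \<epsilon> of the computed norm and one division rounding; the divisor q \<ge> (1 - 7 \<epsilon>)
  \<rho> raises these 8 \<epsilon> to at most 10 \<epsilon>.\<close>

lemma givens_near:
  assumes m: "standard_model \<epsilon> ar" and e: "0 \<le> \<epsilon>" "\<epsilon> \<le> 1 / 1000"
    and g: "givens ar a b = (c, s, r)"
  obtains c' s' where "near \<epsilon> (k, c, s) (k, c', s')"
    "cnj c' * a + cnj s' * b = of_real (sqrt ((cmod a)\<^sup>2 + (cmod b)\<^sup>2))" "- s' * a + c' * b = 0"
    "cmod (r - of_real (sqrt ((cmod a)\<^sup>2 + (cmod b)\<^sup>2))) \<le> 7 * \<epsilon> * sqrt ((cmod a)\<^sup>2 + (cmod b)\<^sup>2)"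
proof -
  define \<rho> where "\<rho> = sqrt ((cmod a)\<^sup>2 + (cmod b)\<^sup>2)"
  obtain q where q: "fl_norm2 ar a b = of_real q" "\<bar>q - \<rho>\<bar> \<le> 7 * \<epsilon> * \<rho>"
    unfolding \<rho>_def using fl_norm2_err[OF m e] .
  have \<rho>0: "0 \<le> \<rho>" by (simp add: \<rho>_def)
  have q_lo: "(1 - 7 * \<epsilon>) * \<rho> \<le> q" using q by (simp add: algebra_simps abs_le_iff)
  show thesis
  proof (cases "\<rho> = 0")
    case True
    \<comment> \<open>For a zero pair the computed norm is zero as well, so the code takes the
      identity rotation.\<close>
    then have "a = 0" "b = 0" "q = 0" using q by (auto simp: \<rho>_def add_nonneg_eq_0_iff)
    then have "(c, s, r) = (1, 0, 0)" using g q by (simp add: givens_def)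
    then show thesis using that[of 1 0] \<open>a = 0\<close> \<open>b = 0\<close> e by (simp add: near_def)
  next
    case False
    then have \<rho>: "0 < \<rho>" using \<rho>0 by simp
    have "0 < (1 - 7 * \<epsilon>) * \<rho>" using e \<rho> by simp
    then have qp: "0 < q" using q_lo by linarith
    have sm: "std_op \<epsilon> (/) (fdiv ar)" using m by (auto simp: standard_model_def)
    have g': "c = fdiv ar a (of_real q)" "s = fdiv ar b (of_real q)" "r = of_real q"
      using g qp q by (auto simp: givens_def Let_def)
    have div: "cmod (fdiv ar z (of_real q) - z / of_real \<rho>) \<le> 10 * \<epsilon>" if z: "cmod z \<le> \<rho>" for z
    proof -
      obtain d where d: "cmod d \<le> \<epsilon>" "fdiv ar z (of_real q) = z / of_real q * (1 + d)"
        using std_opE[OF sm] .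
      have "fdiv ar z (of_real q) - z / of_real \<rho> = (z / of_real \<rho>) * ((of_real \<rho> * d - of_real (q - \<rho>)) / of_real q)"
        unfolding d using \<rho> qp by (simp add: field_simps)
      then have "cmod (fdiv ar z (of_real q) - z / of_real \<rho>)
          = (cmod z / \<rho>) * (cmod (of_real \<rho> * d - of_real (q - \<rho>)) / q)"
        using \<rho> qp by (simp add: norm_mult norm_divide)
      also have "\<dots> \<le> 1 * (10 * \<epsilon>)"
      proof (rule mult_mono)
        show "cmod z / \<rho> \<le> 1" using z \<rho> by simp
        have "cmod (of_real \<rho> * d - of_real (q - \<rho>)) \<le> \<rho> * cmod d + \<bar>q - \<rho>\<bar>"
          using norm_triangle_ineq4[of "of_real \<rho> * d" "of_real (q - \<rho>)"] \<rho> by (simp add: norm_mult del: of_real_diff)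
        also have "\<dots> \<le> \<rho> * \<epsilon> + 7 * \<epsilon> * \<rho>" using q d \<rho> by (intro add_mono mult_left_mono) auto
        also have "\<dots> = 8 * \<epsilon> * \<rho>" by simp
        also have "\<dots> \<le> 10 * \<epsilon> * ((1 - 7 * \<epsilon>) * \<rho>)"
        proof -
          have "\<epsilon> * \<rho> * 8 \<le> \<epsilon> * \<rho> * (10 * (1 - 7 * \<epsilon>))" using e \<rho> by (intro mult_left_mono) auto
          then show ?thesis by (simp add: algebra_simps)
        qed
        also have "\<dots> \<le> 10 * \<epsilon> * q" using q_lo e by (intro mult_left_mono) auto
        finally show "cmod (of_real \<rho> * d - of_real (q - \<rho>)) / q \<le> 10 * \<epsilon>"
          using qp by (simp add: field_simps)
      qed (use qp in auto)
      finally show ?thesis by simp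
    qed
    have ab: "cmod a \<le> \<rho>" "cmod b \<le> \<rho>" unfolding \<rho>_def by (auto intro!: real_le_rsqrt)
    have r2: "\<rho>\<^sup>2 = (cmod a)\<^sup>2 + (cmod b)\<^sup>2" by (simp add: \<rho>_def)
    show thesis
    proof (rule that[of "a / of_real \<rho>" "b / of_real \<rho>"])
      have "(cmod a)\<^sup>2 / \<rho>\<^sup>2 + (cmod b)\<^sup>2 / \<rho>\<^sup>2 = 1"
        unfolding add_divide_distrib[symmetric] r2[symmetric] using \<rho> by simp
      then show "near \<epsilon> (k, c, s) (k, a / of_real \<rho>, b / of_real \<rho>)"
        using div[OF ab(1)] div[OF ab(2)] \<rho> by (simp add: near_def g' norm_divide power_divide)
      have "cnj a * a + cnj b * b = of_real (\<rho>\<^sup>2)"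
        unfolding r2 of_real_add complex_norm_square by (simp add: mult.commute)
      then have "cnj (a / of_real \<rho>) * a + cnj (b / of_real \<rho>) * b = of_real \<rho>"
        using \<rho> by (simp add: field_simps power2_eq_square)
      then show "cnj (a / of_real \<rho>) * a + cnj (b / of_real \<rho>) * b = of_real (sqrt ((cmod a)\<^sup>2 + (cmod b)\<^sup>2))"
        by (simp add: \<rho>_def)
      show "- (b / of_real \<rho>) * a + a / of_real \<rho> * b = 0" by simp
      show "cmod (r - of_real (sqrt ((cmod a)\<^sup>2 + (cmod b)\<^sup>2))) \<le> 7 * \<epsilon> * sqrt ((cmod a)\<^sup>2 + (cmod b)\<^sup>2)"
        using q(2) unfolding \<rho>_def[symmetric] g' by (metis norm_of_real of_real_diff)
    qed
  qed
qed

text \<open>For two rotations the second is computed from the rounded norm \<open>r1\<close> of the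
  last two entries, whereas the exact product sees their true norm \<rho>. The difference
  \<open>r1\<close> - \<rho> passes through the second exact rotation and shows up in the first two
  rows.\<close>

lemma rotations_for_near:
  assumes m: "standard_model \<epsilon> ar" and e: "0 \<le> \<epsilon>" "\<epsilon> \<le> 1 / 1000"
    and k: "k = 1 \<or> k = 2" and g: "rotations_for ar k i x = (gs, r)"
  obtains gs' where "list_all2 (near \<epsilon>) gs gs'" "length gs = k"
    "\<And>g. g \<in> set gs \<Longrightarrow> i \<le> fst g \<and> fst g < i + k"
    "vnorm {i..i + k} (\<lambda>l. (if l = i then r else 0) - fold (rot_vec exact) gs' x l)
       \<le> 60 * \<epsilon> * vnorm {i..i + k} x"
  using k
proof
  assume k1: "k = 1"
  have iv: "{i..i + 1} = {i, Suc i}" by auto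
  obtain c s r' where cs: "givens ar (x i) (x (i + 1)) = (c, s, r')" by (metis prod_cases3)
  have gs: "gs = [(i, c, s)]" "r' = r" using g cs by (simp_all add: rotations_for_def k1)
  define \<rho> where "\<rho> = sqrt ((cmod (x i))\<^sup>2 + (cmod (x (i + 1)))\<^sup>2)"
  obtain c' s' where cs': "near \<epsilon> (i, c, s) (i, c', s')"
    "cnj c' * x i + cnj s' * x (i + 1) = of_real \<rho>" "- s' * x i + c' * x (i + 1) = 0"
    "cmod (r - of_real \<rho>) \<le> 7 * \<epsilon> * \<rho>"
    using givens_near[OF m e cs] unfolding \<rho>_def gs(2) by metis
  have v: "vnorm {i..i + 1} x = \<rho>"
    unfolding iv vnorm_def L2_set_def \<rho>_def by simp
  have d: "fold (rot_vec exact) [(i, c', s')] x l = (if l = i then of_real \<rho> else 0)"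
    if "l \<in> {i, Suc i}" for l using that cs' by (auto simp: rot_vec_def)
  have "vnorm {i..i + 1} (\<lambda>l. (if l = i then r else 0) - fold (rot_vec exact) [(i, c', s')] x l)
      = vnorm {i, Suc i} (\<lambda>l. if l = i then r - of_real \<rho> else 0)"
    unfolding iv by (intro vnorm_cong) (use d in auto)
  also have "\<dots> = cmod (r - of_real \<rho>)"
    unfolding vnorm_def L2_set_def by simp
  also have "\<dots> \<le> 60 * \<epsilon> * vnorm {i..i + 1} x"
    unfolding v using cs'(4) e by (smt (verit) \<rho>_def mult_right_mono real_sqrt_ge_zero zero_le_power2)
  finally show thesis using that[of "[(i, c', s')]"] cs' by (simp add: gs k1)
next
  assume k2: "k = 2"
  have iv: "{i..i + 2} = {i, Suc i, Suc (Suc i)}" by auto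
  obtain c1 s1 r1 where cs1: "givens ar (x (i + 1)) (x (i + 2)) = (c1, s1, r1)" by (metis prod_cases3)
  obtain c2 s2 r2 where cs2: "givens ar (x i) r1 = (c2, s2, r2)" by (metis prod_cases3)
  have gs: "gs = [(i + 1, c1, s1), (i, c2, s2)]" "r2 = r"
    using g cs1 cs2 by (simp_all add: rotations_for_def k2)
  define \<rho> where "\<rho> = sqrt ((cmod (x (i + 1)))\<^sup>2 + (cmod (x (i + 2)))\<^sup>2)"
  define \<sigma> where "\<sigma> = sqrt ((cmod (x i))\<^sup>2 + (cmod r1)\<^sup>2)"
  obtain c1' s1' where cs1': "near \<epsilon> (i + 1, c1, s1) (i + 1, c1', s1')"
    "cnj c1' * x (i + 1) + cnj s1' * x (i + 2) = of_real \<rho>" "- s1' * x (i + 1) + c1' * x (i + 2) = 0"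
    "cmod (r1 - of_real \<rho>) \<le> 7 * \<epsilon> * \<rho>"
    using givens_near[OF m e cs1] unfolding \<rho>_def by metis
  obtain c2' s2' where cs2': "near \<epsilon> (i, c2, s2) (i, c2', s2')"
    "cnj c2' * x i + cnj s2' * r1 = of_real \<sigma>" "- s2' * x i + c2' * r1 = 0"
    "cmod (r - of_real \<sigma>) \<le> 7 * \<epsilon> * \<sigma>"
    using givens_near[OF m e cs2] unfolding \<sigma>_def gs(2) by metis
  let ?v = "vnorm {i..i + 2} x"
  let ?gs = "[(i + 1, c1', s1'), (i, c2', s2')]"
  have \<rho>0: "0 \<le> \<rho>" by (simp add: \<rho>_def)
  have v2: "?v\<^sup>2 = (cmod (x i))\<^sup>2 + \<rho>\<^sup>2"
    unfolding iv vnorm_sq \<rho>_def by simp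
  have \<rho>v: "\<rho> \<le> ?v" by (rule power2_le_imp_le) (use v2 in auto)
  have r1: "cmod r1 \<le> (1 + 7 * \<epsilon>) * \<rho>"
    using cs1'(4) norm_triangle_ineq2[of r1 "of_real \<rho>"] \<rho>0 by (simp add: algebra_simps)
  \<comment> \<open>\<open>r1\<close> is at most (1 + 7 \<epsilon>) \<rho>, crudely 2 \<rho>; this
    bounds the rounding error of the final norm in terms of the original column.\<close>
  have "\<sigma> \<le> 2 * ?v"
  proof (rule power2_le_imp_le)
    have "\<sigma>\<^sup>2 = (cmod (x i))\<^sup>2 + (cmod r1)\<^sup>2" by (simp add: \<sigma>_def)
    also have "\<dots> \<le> (cmod (x i))\<^sup>2 + (2 * \<rho>)\<^sup>2"
      using r1 e \<rho>0 mult_right_mono[of "1 + 7 * \<epsilon>" 2 \<rho>] by (intro add_left_mono power_mono) auto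
    also have "\<dots> \<le> (2 * ?v)\<^sup>2" using v2 by (simp add: power_mult_distrib)
    finally show "\<sigma>\<^sup>2 \<le> (2 * ?v)\<^sup>2" .
  qed simp
  then have rs: "cmod (r - of_real \<sigma>) \<le> 14 * \<epsilon> * ?v"
    using cs2'(4) e mult_left_mono[of \<sigma> "2 * ?v" "7 * \<epsilon>"] by (simp add: algebra_simps)
  note nb = near_bounds[OF cs2'(1)]
  have d1: "cmod (r1 - of_real \<rho>) \<le> 7 * \<epsilon> * ?v"
    using cs1'(4) \<rho>v e mult_left_mono[of \<rho> ?v "7 * \<epsilon>"] by simp
  let ?z = "\<lambda>l. (if l = i then r else 0) - fold (rot_vec exact) ?gs x l"
  have z0: "?z i = (r - of_real \<sigma>) + cnj s2' * (r1 - of_real \<rho>)"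
    using cs1'(2) cs2'(2) by (simp add: rot_vec_def algebra_simps)
  have z1: "?z (Suc i) = c2' * (r1 - of_real \<rho>)"
    using cs1'(2) cs2'(3) by (simp add: rot_vec_def algebra_simps)
  have z2: "?z (Suc (Suc i)) = 0"
    using cs1'(3) by (simp add: rot_vec_def)
  have n0: "cmod (?z i) \<le> 21 * \<epsilon> * ?v"
  proof -
    have "cmod (?z i) \<le> cmod (r - of_real \<sigma>) + cmod s2' * cmod (r1 - of_real \<rho>)"
      unfolding z0 by (metis norm_triangle_ineq norm_mult complex_mod_cnj)
    also have "\<dots> \<le> 14 * \<epsilon> * ?v + 1 * (7 * \<epsilon> * ?v)"
      using rs d1 nb e by (intro add_mono mult_mono) auto
    finally show ?thesis by simp
  qed
  have n1: "cmod (?z (Suc i)) \<le> 7 * \<epsilon> * ?v"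
  proof -
    have "cmod (?z (Suc i)) = cmod c2' * cmod (r1 - of_real \<rho>)" unfolding z1 by (rule norm_mult)
    also have "\<dots> \<le> 1 * (7 * \<epsilon> * ?v)" using d1 nb e by (intro mult_mono) auto
    finally show ?thesis by simp
  qed
  have "vnorm {i..i + 2} ?z \<le> (\<Sum>l\<in>{i, Suc i, Suc (Suc i)}. cmod (?z l))"
    unfolding iv vnorm_def by (rule L2_set_le_sum) simp
  also have "\<dots> = cmod (?z i) + cmod (?z (Suc i)) + cmod (?z (Suc (Suc i)))"
    by (subst sum.insert, simp, simp)+ simp
  also have "\<dots> \<le> 21 * \<epsilon> * ?v + 7 * \<epsilon> * ?v" using n0 n1 z2 by (simp only: norm_zero)
  also have "\<dots> \<le> 60 * \<epsilon> * ?v" using e by (simp add: mult_right_mono)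
  finally have fin: "vnorm {i..i + 2} ?z \<le> 60 * \<epsilon> * ?v" .
  show thesis by (rule that[of ?gs]) (use cs1' cs2' fin in \<open>auto simp: gs k2\<close>)
qed

section \<open>Exact rotations as unitary matrices\<close>

definition in_block :: "nat set \<Rightarrow> rotation list \<Rightarrow> bool" where
  "in_block B gs \<longleftrightarrow> (\<forall>g\<in>set gs. fst g \<in> B \<and> Suc (fst g) \<in> B)"

text \<open>The product G_1 ... G_r, since \<open>rot_right\<close> multiplies by the next factor on
  the right.\<close>

definition rot_mat :: "rotation list \<Rightarrow> nat \<Rightarrow> nat \<Rightarrow> complex" where
  "rot_mat gs = fold (rot_right exact) gs idm"

lemma in_block_simps [simp]:
  "in_block B []" "in_block B (g # gs) \<longleftrightarrow> fst g \<in> B \<and> Suc (fst g) \<in> B \<and> in_block B gs"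
  by (auto simp: in_block_def)

lemma in_block_mono: "in_block B gs \<Longrightarrow> B \<subseteq> B' \<Longrightarrow> in_block B' gs"
  by (auto simp: in_block_def)

lemma rot_vec_outside: "in_block B gs \<Longrightarrow> i \<notin> B \<Longrightarrow> fold (rot_vec ar) gs x i = x i"
  by (induction gs arbitrary: x) (auto simp: rot_vec_def split: prod.splits)

lemma row_vec_outside: "in_block B gs \<Longrightarrow> j \<notin> B \<Longrightarrow> fold (row_vec ar) gs x j = x j"
  by (induction gs arbitrary: x) (auto simp: row_vec_def split: prod.splits)

lemma rot_vec_local:
  "in_block B gs \<Longrightarrow> (\<And>i. i \<in> B \<Longrightarrow> x i = y i) \<Longrightarrow> i \<in> B \<Longrightarrow>
     fold (rot_vec ar) gs x i = fold (rot_vec ar) gs y i"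
proof (induction gs arbitrary: x y)
  case (Cons g gs)
  have "rot_vec ar g x i = rot_vec ar g y i" if "i \<in> B" for i
    using Cons.prems that by (auto simp: rot_vec_def split: prod.splits)
  then show ?case using Cons.IH[of "rot_vec ar g x" "rot_vec ar g y"] Cons.prems(1,3) by simp
qed simp

lemma row_vec_local:
  "in_block B gs \<Longrightarrow> (\<And>i. i \<in> B \<Longrightarrow> x i = y i) \<Longrightarrow> i \<in> B \<Longrightarrow>
     fold (row_vec ar) gs x i = fold (row_vec ar) gs y i"
proof (induction gs arbitrary: x y)
  case (Cons g gs)
  have "row_vec ar g x i = row_vec ar g y i" if "i \<in> B" for i
    using Cons.prems that by (auto simp: row_vec_def split: prod.splits)
  then show ?case using Cons.IH[of "row_vec ar g x" "row_vec ar g y"] Cons.prems(1,3) by simp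
qed simp

lemma rot_right_mmul: "rot_right exact g (mmul n X Q) = mmul n X (rot_right exact g Q)"
  by (cases g) (auto simp: fun_eq_iff rot_right_def mmul_def sum_distrib_left sum_distrib_right
      algebra_simps simp flip: sum.distrib sum_subtractf)

text \<open>Left rotation by G^* turns Q^* into the adjoint of Q G, so left rotations too are
  expressed through \<open>rot_right\<close>.\<close>

lemma rot_left_mmul: "rot_left exact g (mmul n (ctrans Q) X) = mmul n (ctrans (rot_right exact g Q)) X"
  by (cases g) (auto simp: fun_eq_iff rot_left_def rot_vec_def rot_right_def mmul_def ctrans_def
      sum_distrib_left sum_distrib_right algebra_simps simp flip: sum.distrib sum_subtractf)

lemma fold_rot_right_mmul:
  "fold (rot_right exact) gs (mmul n X Q) = mmul n X (fold (rot_right exact) gs Q)"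
  by (induction gs arbitrary: Q) (simp_all add: rot_right_mmul)

lemma fold_rot_left_mmul:
  "fold (rot_left exact) gs (mmul n (ctrans Q) X) = mmul n (ctrans (fold (rot_right exact) gs Q)) X"
  by (induction gs arbitrary: Q) (simp_all add: rot_left_mmul)

text \<open>\<open>X\<close> and its product with \<open>idm\<close> agree only on the columns 1..n;
  \<open>row_vec_local\<close> makes this enough, as the rotations stay inside that range.\<close>

lemma fold_rot_right_eq:
  assumes "in_block {1..n} gs" "j \<in> {1..n}"
  shows "fold (rot_right exact) gs X i j = mmul n X (rot_mat gs) i j"
proof -
  have "fold (rot_right exact) gs X i j = fold (rot_right exact) gs (mmul n X idm) i j"
    unfolding fold_rot_right using assms
    by (intro row_vec_local[OF assms(1)]) (auto simp: mmul_idm_right)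
  then show ?thesis by (simp add: fold_rot_right_mmul rot_mat_def)
qed

lemma ctrans_idm [simp]: "ctrans idm = idm"
  by (auto simp: ctrans_def idm_def fun_eq_iff)

lemma fold_rot_left_eq:
  assumes "in_block {1..n} gs" "i \<in> {1..n}"
  shows "fold (rot_left exact) gs X i j = mmul n (ctrans (rot_mat gs)) X i j"
proof -
  have "fold (rot_left exact) gs X i j = fold (rot_vec exact) gs (\<lambda>i. X i j) i"
    using fun_cong[OF fold_rot_left[of exact gs X j], of i] .
  also have "\<dots> = fold (rot_vec exact) gs (\<lambda>i. mmul n (ctrans idm) X i j) i"
    by (rule rot_vec_local[OF assms(1) _ assms(2)]) (simp add: mmul_idm_left)
  also have "\<dots> = fold (rot_left exact) gs (mmul n (ctrans idm) X) i j"
    using fun_cong[OF fold_rot_left[of exact gs "mmul n (ctrans idm) X" j], of i] ..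
  finally show ?thesis by (simp only: fold_rot_left_mmul rot_mat_def)
qed

lemma fold_rot_vec_eq:
  assumes "in_block {1..n} gs" "i \<in> {1..n}"
  shows "fold (rot_vec exact) gs x i = mvec n (ctrans (rot_mat gs)) x i"
proof -
  have "fold (rot_vec exact) gs x i = fold (rot_left exact) gs (\<lambda>i j. x i) i 0"
    using fun_cong[OF fold_rot_left[of exact gs "\<lambda>i j. x i" 0], of i] by simp
  also have "\<dots> = mvec n (ctrans (rot_mat gs)) x i"
    unfolding fold_rot_left_eq[OF assms] by (simp add: mmul_def mvec_def)
  finally show ?thesis .
qed

lemma fold_rot_conj_eq:
  assumes "in_block {1..n} gs" "i \<in> {1..n}" "j \<in> {1..n}"
  shows "fold (rot_right exact) gs (fold (rot_left exact) gs X) i j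
    = mmul n (ctrans (rot_mat gs)) (mmul n X (rot_mat gs)) i j"
proof -
  have "fold (rot_right exact) gs (fold (rot_left exact) gs X) i j
      = mmul n (fold (rot_left exact) gs X) (rot_mat gs) i j"
    by (rule fold_rot_right_eq[OF assms(1,3)])
  also have "\<dots> = mmul n (mmul n (ctrans (rot_mat gs)) X) (rot_mat gs) i j"
    by (intro mmul_cong) (auto simp: fold_rot_left_eq[OF assms(1,2)])
  finally show ?thesis by (simp add: mmul_assoc)
qed

lemma cmod_sq_mult: "(cmod c)\<^sup>2 + (cmod s)\<^sup>2 = 1 \<Longrightarrow> c * cnj c + s * cnj s = 1"
  using complex_norm_square[of c] complex_norm_square[of s] by (metis of_real_1 of_real_add)

text \<open>For Q^* Q the rotation is applied from both sides to the identity, a computation on two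
  indices. For Q Q^* only the columns \<open>k\<close> and \<open>Suc k\<close> change, and their
  joint contribution to each inner product of rows is preserved.\<close>

lemma unitary_rot_right:
  assumes Q: "unitary n Q" and g: "k \<in> {1..n}" "Suc k \<in> {1..n}" "(cmod c)\<^sup>2 + (cmod s)\<^sup>2 = 1"
  shows "unitary n (rot_right exact (k, c, s) Q)"
  unfolding unitary_def
proof (intro ballI conjI)
  fix i j assume ij: "i \<in> {1..n}" "j \<in> {1..n}"
  let ?g = "(k, c, s)"
  let ?Q = "rot_right exact ?g Q"
  have cs: "c * cnj c + s * cnj s = 1" using g(3) by (rule cmod_sq_mult)
  have blk: "in_block {1..n} [?g]" using g by simp
  have "mmul n (ctrans ?Q) ?Q i j = fold (rot_left exact) [?g] (fold (rot_right exact) [?g] (mmul n (ctrans Q) Q)) i j"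
    by (simp add: rot_left_mmul rot_right_mmul)
  also have "\<dots> = fold (rot_vec exact) [?g] (\<lambda>i. fold (row_vec exact) [?g] (mmul n (ctrans Q) Q i) j) i"
    by (simp add: rot_left_def rot_right_row)
  also have "\<dots> = fold (rot_vec exact) [?g] (\<lambda>i. fold (row_vec exact) [?g] (idm i) j) i"
    using Q ij by (intro rot_vec_local[OF blk] row_vec_local[OF blk]) (auto simp: unitary_def)
  also have "\<dots> = idm i j"
    using cs by (auto simp: rot_vec_def row_vec_def idm_def algebra_simps)
  finally show "mmul n (ctrans ?Q) ?Q i j = idm i j" .
  have B: "finite {1..n}" by simp
  note sp = sum_pair[OF B g(1,2)]
  have "?Q i k * cnj (?Q j k) + ?Q i (Suc k) * cnj (?Q j (Suc k))
      = (c * cnj c + s * cnj s) * (Q i k * cnj (Q j k) + Q i (Suc k) * cnj (Q j (Suc k)))"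
    by (simp add: rot_right_def algebra_simps)
  also have "\<dots> = Q i k * cnj (Q j k) + Q i (Suc k) * cnj (Q j (Suc k))" by (simp add: cs)
  finally have pr: "?Q i k * cnj (?Q j k) + ?Q i (Suc k) * cnj (?Q j (Suc k))
      = Q i k * cnj (Q j k) + Q i (Suc k) * cnj (Q j (Suc k))" .
  have "mmul n ?Q (ctrans ?Q) i j = (\<Sum>l = 1..n. ?Q i l * cnj (?Q j l))"
    by (simp add: mmul_def ctrans_def)
  also have "\<dots> = (\<Sum>l = 1..n. Q i l * cnj (Q j l))"
    unfolding sp pr by (intro arg_cong2[of _ _ _ _ "(+)"] sum.cong) (auto simp: rot_right_def)
  also have "\<dots> = idm i j" using Q ij by (simp add: unitary_def mmul_def ctrans_def)
  finally show "mmul n ?Q (ctrans ?Q) i j = idm i j" .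
qed

lemma unitary_fold_rot_right:
  assumes "unitary n Q" "in_block {1..n} gs" "list_all2 (near \<epsilon>) gs' gs"
  shows "unitary n (fold (rot_right exact) gs Q)"
  using assms(3,2,1)
proof (induction gs' gs arbitrary: Q rule: list_all2_induct)
  case (Cons g' gs' g0 gs)
  obtain k c s where g: "g0 = (k, c, s)" by (cases g0)
  obtain k' c' s' where g': "g' = (k', c', s')" by (cases g')
  have "unitary n (rot_right exact (k, c, s) Q)"
    using Cons g by (intro unitary_rot_right near_bounds(4)[OF Cons(1)[unfolded g g']]) auto
  then show ?case using Cons g by simp
qed simp

lemma in_block_near: "list_all2 (near \<epsilon>) gs gs' \<Longrightarrow> in_block B gs \<Longrightarrow> in_block B gs'"
  by (induction gs gs' rule: list_all2_induct) (auto simp: near_def)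

section \<open>Frobenius norms of rectangular pieces\<close>

definition fro :: "nat set \<Rightarrow> nat set \<Rightarrow> (nat \<Rightarrow> nat \<Rightarrow> complex) \<Rightarrow> real" where
  "fro I J X = L2_set (\<lambda>(i, j). cmod (X i j)) (I \<times> J)"

lemma fro_nonneg [simp]: "0 \<le> fro I J X"
  by (simp add: fro_def)

lemma fro_sq: "(fro I J X)\<^sup>2 = (\<Sum>(i, j)\<in>I \<times> J. (cmod (X i j))\<^sup>2)"
  by (simp add: fro_def L2_set_def sum_nonneg case_prod_beta)

text \<open>Together with the columnwise form this is why errors are measured in Frobenius norms:
  left rotations act on columns, right rotations on rows, and both keep the sum of squares.\<close>

lemma fro_sq_rows: "(fro I J X)\<^sup>2 = (\<Sum>i\<in>I. (vnorm J (X i))\<^sup>2)"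
  unfolding fro_sq vnorm_sq by (simp add: sum.cartesian_product)

lemma fro_sq_cols: "(fro I J X)\<^sup>2 = (\<Sum>j\<in>J. (vnorm I (\<lambda>i. X i j))\<^sup>2)"
  unfolding fro_sq vnorm_sq by (simp add: sum.cartesian_product[symmetric] sum.swap[of _ I])

lemma fro_cong: "(\<And>i j. i \<in> I \<Longrightarrow> j \<in> J \<Longrightarrow> X i j = Y i j) \<Longrightarrow> fro I J X = fro I J Y"
  unfolding fro_def by (intro L2_set_cong) auto

lemma fro_transpose: "fro I J X = fro J I (\<lambda>i j. X j i)"
proof -
  have "(fro I J X)\<^sup>2 = (fro J I (\<lambda>i j. X j i))\<^sup>2"
    unfolding fro_sq_rows[of I] fro_sq_cols[of J] ..
  then show ?thesis by (simp add: power2_eq_iff_nonneg)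
qed

lemma fro_triangle: "fro I J (\<lambda>i j. X i j + Y i j) \<le> fro I J X + fro I J Y"
proof -
  have "fro I J (\<lambda>i j. X i j + Y i j) \<le> L2_set (\<lambda>p. (case p of (i, j) \<Rightarrow> cmod (X i j)) + (case p of (i, j) \<Rightarrow> cmod (Y i j))) (I \<times> J)"
    unfolding fro_def by (rule L2_set_mono) (auto simp: norm_triangle_ineq)
  also have "\<dots> \<le> fro I J X + fro I J Y"
    unfolding fro_def by (rule L2_set_triangle_ineq)
  finally show ?thesis .
qed

lemma fro_uminus [simp]: "fro I J (\<lambda>i j. - X i j) = fro I J X"
  by (simp add: fro_def)

lemma fro_triangle_diff: "fro I J (\<lambda>i j. X i j - Y i j) \<le> fro I J X + fro I J Y"
  using fro_triangle[of I J X "\<lambda>i j. - Y i j"] by simp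

lemma fro_mono:
  "(\<And>i j. i \<in> I \<Longrightarrow> j \<in> J \<Longrightarrow> cmod (X i j) \<le> cmod (Y i j)) \<Longrightarrow> fro I J X \<le> fro I J Y"
  unfolding fro_def by (rule L2_set_mono) auto

lemma fro_rows_le:
  assumes "\<And>i. i \<in> I \<Longrightarrow> vnorm J (X i) \<le> \<tau> * vnorm J (Y i)" "0 \<le> \<tau>"
  shows "fro I J X \<le> \<tau> * fro I J Y"
proof (rule power2_le_imp_le)
  have "(fro I J X)\<^sup>2 \<le> (\<Sum>i\<in>I. (\<tau> * vnorm J (Y i))\<^sup>2)"
    unfolding fro_sq_rows using assms by (intro sum_mono power_mono) auto
  then show "(fro I J X)\<^sup>2 \<le> (\<tau> * fro I J Y)\<^sup>2"
    by (simp add: power_mult_distrib fro_sq_rows sum_distrib_left)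
qed (use assms in auto)

lemma fro_cols_le:
  assumes "\<And>j. j \<in> J \<Longrightarrow> vnorm I (\<lambda>i. X i j) \<le> \<tau> * vnorm I (\<lambda>i. Y i j)" "0 \<le> \<tau>"
  shows "fro I J X \<le> \<tau> * fro I J Y"
  using fro_rows_le[of J I "\<lambda>i j. X j i" \<tau> "\<lambda>i j. Y j i"] assms
  by (simp add: fro_transpose[of I J])

lemma fro_outer: "fro I J (\<lambda>i j. u i * cnj (v j)) = vnorm I u * vnorm J v"
proof -
  have "(fro I J (\<lambda>i j. u i * cnj (v j)))\<^sup>2 = (vnorm I u * vnorm J v)\<^sup>2"
    unfolding fro_sq power_mult_distrib vnorm_sq
    by (simp add: norm_mult power_mult_distrib sum_product sum.cartesian_product)
  then show ?thesis by (simp add: power2_eq_iff_nonneg)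
qed

lemma fro_le_card:
  assumes "finite I" "finite J" "\<And>i j. i \<in> I \<Longrightarrow> j \<in> J \<Longrightarrow> cmod (X i j) \<le> a"
  shows "fro I J X \<le> real (card I) * real (card J) * a"
proof -
  have "fro I J X \<le> (\<Sum>(i, j)\<in>I \<times> J. cmod (X i j))"
    unfolding fro_def by (rule order_trans[OF L2_set_le_sum]) (auto simp: case_prod_beta)
  also have "\<dots> \<le> real (card (I \<times> J)) * a"
    by (rule sum_bounded_above) (use assms in auto)
  finally show ?thesis by (simp add: card_cartesian_product)
qed

lemma fro_le_rows:
  assumes "finite I" "\<And>i. i \<in> I \<Longrightarrow> vnorm J (X i) \<le> a"
  shows "fro I J X \<le> real (card I) * a"
proof -
  have "fro I J X = L2_set (\<lambda>i. vnorm J (X i)) I"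
    unfolding L2_set_def fro_sq_rows[symmetric] by simp
  also have "\<dots> \<le> (\<Sum>i\<in>I. vnorm J (X i))" by (rule L2_set_le_sum) simp
  also have "\<dots> \<le> real (card I) * a" by (rule sum_bounded_above) (use assms in auto)
  finally show ?thesis .
qed

text \<open>Cauchy-Schwarz on the index set I \<times> J, with the outer product of the test vectors
  as the second factor.\<close>

lemma op_le_rect:
  assumes sub: "I \<subseteq> {1..n}" "J \<subseteq> {1..n}"
    and z: "\<And>i j. i \<in> {1..n} \<Longrightarrow> j \<in> {1..n} \<Longrightarrow> \<not> (i \<in> I \<and> j \<in> J) \<Longrightarrow> X i j = 0"
  shows "op_le n X (fro I J X)"
  unfolding op_le_def
proof (intro allI)
  fix y w
  have fin: "finite I" "finite J" using sub finite_subset by blast+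
  have "mvec n X y i = (\<Sum>j\<in>J. X i j * y j)" if "i \<in> {1..n}" for i
    unfolding mvec_def using z that sub by (intro sum.mono_neutral_right) auto
  then have "dot n w (mvec n X y) = (\<Sum>i = 1..n. cnj (w i) * (\<Sum>j\<in>J. X i j * y j))"
    unfolding dot_def by (intro sum.cong) auto
  also have "\<dots> = (\<Sum>i\<in>I. cnj (w i) * (\<Sum>j\<in>J. X i j * y j))"
    using z sub by (intro sum.mono_neutral_right) (auto intro!: sum.neutral)
  also have "\<dots> = (\<Sum>(i, j)\<in>I \<times> J. X i j * (cnj (w i) * y j))"
    by (simp add: sum_distrib_left sum.cartesian_product algebra_simps)
  finally have "cmod (dot n w (mvec n X y)) \<le> (\<Sum>(i, j)\<in>I \<times> J. cmod (X i j) * cmod (w i * cnj (y j)))"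
    by (simp only:) (rule order_trans[OF norm_sum], simp add: norm_mult case_prod_beta)
  also have "\<dots> \<le> fro I J X * fro I J (\<lambda>i j. w i * cnj (y j))"
    using L2_set_mult_ineq[of "\<lambda>(i, j). cmod (X i j)" "\<lambda>(i, j). cmod (w i * cnj (y j))" "I \<times> J"]
    by (simp add: fro_def case_prod_beta)
  also have "\<dots> \<le> fro I J X * (vnorm {1..n} w * vnorm {1..n} y)"
    unfolding fro_outer using sub by (intro mult_left_mono mult_mono vnorm_sub) auto
  finally show "cmod (dot n w (mvec n X y)) \<le> fro I J X * (vnorm {1..n} w * vnorm {1..n} y)" .
qed

section \<open>The error of one similarity transformation\<close>

definition fgen :: "qr_state \<Rightarrow> nat \<Rightarrow> nat \<Rightarrow> complex" where
  "fgen s i j = entry s i j - gu s i * cnj (gv s j)"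

definition mass :: "nat \<Rightarrow> qr_state \<Rightarrow> real" where
  "mass n s = (\<Sum>(r, c)\<in>{(r, c). 1 \<le> c \<and> c + 1 < r \<and> r \<le> n}. (cmod (low s r c))\<^sup>2)"

lemma fgen_low: "j \<le> i \<Longrightarrow> fgen s i j = low s i j - gu s i * cnj (gv s j)"
  by (simp add: fgen_def entry_def)

lemma fgen_hermitian: "i \<noteq> j \<Longrightarrow> fgen s i j = cnj (fgen s j i)"
  by (auto simp: fgen_def entry_def algebra_simps)

text \<open>\<open>fgen s\<close> is \<open>F = A - uv\<^sup>*\<close> for the represented matrix \<open>A\<close>. It is Hermitian by construction
  off the diagonal only: its diagonal acquires an imaginary part, bounded by \<open>dmax\<close>. A rotation moves
  this part to both sides of the diagonal, but only the entries below are kept; so it contributes to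
  the error of every later rotation.\<close>

locale block_step =
  fixes n :: nat and \<epsilon> :: real and ar :: fparith and gs gs' :: "rotation list"
    and lo b :: nat and s s' :: qr_state and g dmax :: real
  assumes model: "standard_model \<epsilon> ar" and e0: "0 \<le> \<epsilon>" and e1: "\<epsilon> \<le> 1 / 1000"
    and near: "list_all2 (near \<epsilon>) gs gs'" and len: "length gs \<le> 2"
    and blk: "in_block {lo..b} gs"
    and lo: "1 \<le> lo" and lob: "lo \<le> b" and bn: "b \<le> n" and b2: "b \<le> lo + 2"
    and gu': "gu s' = fold (rot_vec ar) gs (gu s)"
    and gv': "gv s' = fold (rot_vec ar) gs (gv s)"
    and low_block: "\<And>i j. i \<in> {lo..b} \<Longrightarrow> j \<in> {lo..b} \<Longrightarrow> j \<le> i \<Longrightarrow>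
      low s' i j = fold (rot_right ar) gs (fold (rot_left ar) gs (fl_entry ar s)) i j"
    and low_left: "\<And>j. 1 \<le> j \<Longrightarrow> j < lo \<Longrightarrow>
      vnorm {lo..b} (\<lambda>i. low s' i j - fold (rot_vec exact) gs' (\<lambda>i. low s i j) i)
        \<le> 60 * \<epsilon> * vnorm {lo..b} (\<lambda>i. low s i j)"
    and low_below: "\<And>i. b < i \<Longrightarrow> i \<le> n \<Longrightarrow>
      vnorm {lo..b} (\<lambda>j. low s' i j - fold (row_vec exact) gs' (low s i) j)
        \<le> 60 * \<epsilon> * vnorm {lo..b} (low s i)"
    and low_else: "\<And>i j. 1 \<le> j \<Longrightarrow> j \<le> i \<Longrightarrow> i \<le> n \<Longrightarrow> i \<notin> {lo..b} \<Longrightarrow> j \<notin> {lo..b} \<Longrightarrow>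
      low s' i j = low s i j"
    and g1: "1 \<le> g" and win: "vnorm {lo..b} (gu s) * vnorm {lo..b} (gv s) \<le> g"
    and F2: "op_le n (fgen s) 2"
    and dmax: "\<And>i. i \<in> {1..n} \<Longrightarrow> \<bar>Im (fgen s i i)\<bar> \<le> dmax"
    and sub_left: "2 \<le> lo \<Longrightarrow> cmod (low s lo (lo - 1)) \<le> 3 * g"
    and sub_below: "b < n \<Longrightarrow> cmod (low s (b + 1) b) \<le> 3 * g"
begin

abbreviation "B \<equiv> {lo..b}"
abbreviation "L \<equiv> {1..<lo}"
abbreviation "W \<equiv> {b<..n}"
abbreviation "F \<equiv> fgen s"
abbreviation "A \<equiv> entry s"
abbreviation "U \<equiv> rot_mat gs'"
abbreviation "u0 \<equiv> fold (rot_vec exact) gs' (gu s)"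
abbreviation "v0 \<equiv> fold (rot_vec exact) gs' (gv s)"

definition "T X = fold (rot_right exact) gs' (fold (rot_left exact) gs' X)"
definition "X = fold (rot_right ar) gs (fold (rot_left ar) gs (fl_entry ar s))"
text \<open>F - F^* = 2 i Dm: before the rotation the whole deviation of \<open>F\<close> from a
  Hermitian matrix sits on the diagonal.\<close>

definition "Dm i j = (if i = j then complex_of_real (Im (F i i)) else 0)"
definition "Err i j = fgen s' i j - T F i j"
text \<open>The error the block would have if its computed entries above the diagonal were kept too.
  It agrees with \<open>Err\<close> on and below the diagonal; above it, \<open>Err\<close> is
  obtained by mirroring.\<close>

definition "Eh i j = (X i j - gu s' i * cnj (gv s' j)) - (T A i j - u0 i * cnj (v0 j))"

lemma B_sub: "B \<subseteq> {1..n}" using lo bn by auto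

lemma card_B: "card B \<le> 3" using b2 lob by simp

lemma blk': "in_block B gs'" using in_block_near[OF near blk] .

lemma blk_n: "in_block {1..n} gs'" using in_block_mono[OF blk' B_sub] .

lemma iso_col: "near_iso B (60 * \<epsilon>) (fold (rot_vec ar) gs) (fold (rot_vec exact) gs')"
  using near_iso_rotations(1)[OF model e0 e1 near len] blk by (auto simp: in_block_def)

lemma iso_row: "near_iso B (60 * \<epsilon>) (fold (row_vec ar) gs) (fold (row_vec exact) gs')"
  using near_iso_rotations(2)[OF model e0 e1 near len] blk by (auto simp: in_block_def)

lemma T_conj:
  assumes "i \<in> {1..n}" "j \<in> {1..n}"
  shows "T Y i j = mmul n (ctrans U) (mmul n Y U) i j"
  unfolding T_def by (rule fold_rot_conj_eq[OF blk_n assms])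

lemma unitary_U: "unitary n U"
  unfolding rot_mat_def by (rule unitary_fold_rot_right[OF unitary_idm blk_n near])

lemma T_add_scale:
  assumes "i \<in> {1..n}" "j \<in> {1..n}"
  shows "T (\<lambda>i j. Y i j + a * Z i j) i j = T Y i j + a * T Z i j"
  unfolding T_conj[OF assms]
  by (simp add: mmul_add_left mmul_add_right mmul_scale_left mmul_scale_right)

lemma T_outer:
  assumes "i \<in> {1..n}" "j \<in> {1..n}"
  shows "T (\<lambda>i j. u i * cnj (v j)) i j
    = fold (rot_vec exact) gs' u i * cnj (fold (rot_vec exact) gs' v j)"
  unfolding T_conj[OF assms] mmul_outer_right mmul_outer_left
  by (simp add: fold_rot_vec_eq[OF blk_n assms(1)] fold_rot_vec_eq[OF blk_n assms(2)])

lemma T_left: "j \<notin> B \<Longrightarrow> T Y i j = fold (rot_vec exact) gs' (\<lambda>i. Y i j) i"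
  unfolding T_def fold_rot_right row_vec_outside[OF blk']
  using fun_cong[OF fold_rot_left[of exact gs' Y j], of i] by simp

lemma T_below: "i \<notin> B \<Longrightarrow> T Y i j = fold (row_vec exact) gs' (Y i) j"
proof -
  assume i: "i \<notin> B"
  have "fold (rot_left exact) gs' Y i = Y i"
  proof
    fix j
    show "fold (rot_left exact) gs' Y i j = Y i j"
      using fun_cong[OF fold_rot_left[of exact gs' Y j], of i] rot_vec_outside[OF blk' i] by simp
  qed
  then show ?thesis by (simp add: T_def fold_rot_right)
qed

lemma T_else: "i \<notin> B \<Longrightarrow> j \<notin> B \<Longrightarrow> T Y i j = Y i j"
  by (simp add: T_below row_vec_outside[OF blk'])

lemma T_ctrans:
  assumes "i \<in> {1..n}" "j \<in> {1..n}"
  shows "cnj (T Y j i) = T (ctrans Y) i j"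
proof -
  have "cnj (T Y j i) = ctrans (mmul n (ctrans U) (mmul n Y U)) i j"
    unfolding T_conj[OF assms(2,1)] by (simp add: ctrans_def)
  also have "\<dots> = T (ctrans Y) i j"
    unfolding T_conj[OF assms] by (simp add: ctrans_mmul mmul_assoc)
  finally show ?thesis .
qed

lemma T_F:
  assumes "i \<in> {1..n}" "j \<in> {1..n}"
  shows "T F i j = T A i j - u0 i * cnj (v0 j)"
proof -
  have "A = (\<lambda>i j. F i j + 1 * (gu s i * cnj (gv s j)))" by (simp add: fgen_def fun_eq_iff)
  then have "T A i j = T F i j + 1 * (u0 i * cnj (v0 j))"
    using T_add_scale[OF assms, of F 1 "\<lambda>i j. gu s i * cnj (gv s j)"] T_outer[OF assms] by simp
  then show ?thesis by simp
qed

lemma T_Dm_le: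
  assumes "i \<in> {1..n}" "j \<in> {1..n}"
  shows "cmod (T Dm i j) \<le> dmax"
proof -
  have "op_le n Dm dmax"
    unfolding Dm_def[abs_def] using dmax by (intro op_le_diag) simp
  moreover have "0 \<le> dmax" using dmax[OF assms(1)] by linarith
  ultimately show ?thesis
    unfolding T_conj[OF assms] using op_le_entry[OF op_le_conj[OF _ unitary_U] _ assms] by blast
qed

text \<open>A row or column of \<open>Dm\<close> outside the block vanishes on the block, and
  isometries send zero to zero. So the non-Hermitian part meets the block alone, and the errors in
  the strips beside it mirror exactly.\<close>

lemma T_Dm_off:
  assumes "i \<in> B \<and> j \<notin> B \<or> i \<notin> B \<and> j \<in> B"
  shows "T Dm i j = 0"
proof -
  have z: "vnorm B (\<lambda>i. 0) = 0" by (simp add: vnorm_def L2_set_constant)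
  show ?thesis using assms
  proof
    assume a: "i \<in> B \<and> j \<notin> B"
    have "vnorm B (fold (rot_vec exact) gs' (\<lambda>i. Dm i j)) = vnorm B (\<lambda>i. Dm i j)"
      using iso_col by (simp add: near_iso_def)
    also have "\<dots> = vnorm B (\<lambda>i. 0)" using a by (intro vnorm_cong) (auto simp: Dm_def)
    finally have "cmod (T Dm i j) \<le> 0"
      using cmod_le_vnorm[of B i "fold (rot_vec exact) gs' (\<lambda>i. Dm i j)"] a z by (simp add: T_left)
    then show ?thesis by simp
  next
    assume a: "i \<notin> B \<and> j \<in> B"
    have "vnorm B (fold (row_vec exact) gs' (Dm i)) = vnorm B (Dm i)"
      using iso_row by (simp add: near_iso_def)
    also have "\<dots> = vnorm B (\<lambda>i. 0)" using a by (intro vnorm_cong) (auto simp: Dm_def)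
    finally have "cmod (T Dm i j) \<le> 0"
      using cmod_le_vnorm[of B j "fold (row_vec exact) gs' (Dm i)"] a z by (simp add: T_below)
    then show ?thesis by simp
  qed
qed

lemma cnj_T_F:
  assumes "i \<in> {1..n}" "j \<in> {1..n}"
  shows "cnj (T F j i) = T F i j + (- 2 * \<i>) * T Dm i j"
proof -
  have "ctrans F = (\<lambda>i j. F i j + (- 2 * \<i>) * Dm i j)"
  proof (intro ext)
    fix i j
    show "ctrans F i j = F i j + (- 2 * \<i>) * Dm i j"
      using fgen_hermitian[of i j s]
      by (cases "i = j") (auto simp: ctrans_def Dm_def complex_eq_iff)
  qed
  then show ?thesis using T_ctrans[OF assms, of F] T_add_scale[OF assms, of F "- 2 * \<i>" Dm] by simp
qed

text \<open>The imaginary part of the diagonal of \<open>T F\<close> is the real part of that of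
  \<open>T Dm\<close>. Unitary conjugation keeps the norm bound of \<open>Dm\<close>, so exact
  rotations do not enlarge the bound on the drift.\<close>

lemma Im_T_F:
  assumes "i \<in> {1..n}"
  shows "\<bar>Im (T F i i)\<bar> \<le> dmax"
proof -
  have "2 * Im (T F i i) = Im (T F i i - cnj (T F i i))" by simp
  also have "T F i i - cnj (T F i i) = 2 * \<i> * T Dm i i" unfolding cnj_T_F[OF assms assms] by simp
  also have "Im (2 * \<i> * T Dm i i) = 2 * Re (T Dm i i)" by simp
  finally have "Im (T F i i) = Re (T Dm i i)" by simp
  then show ?thesis using abs_Re_le_cmod[of "T Dm i i"] T_Dm_le[OF assms assms] by linarith
qed

text \<open>The new \<open>fgen\<close> is Hermitian off the diagonal by construction, whereas
  \<open>T F\<close> deviates from this as in \<open>cnj_T_F\<close>.\<close>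

lemma Err_mirror:
  assumes "i \<in> {1..n}" "j \<in> {1..n}" "i \<noteq> j"
  shows "cnj (Err j i) = Err i j + 2 * \<i> * T Dm i j"
  using fgen_hermitian[OF assms(3), of s'] cnj_T_F[OF assms(1,2)] by (simp add: Err_def)

lemma gu'_out: "i \<notin> B \<Longrightarrow> gu s' i = gu s i"
  unfolding gu' by (rule rot_vec_outside[OF blk])

lemma gv'_out: "i \<notin> B \<Longrightarrow> gv s' i = gv s i"
  unfolding gv' by (rule rot_vec_outside[OF blk])

lemma u0_out: "i \<notin> B \<Longrightarrow> u0 i = gu s i" by (rule rot_vec_outside[OF blk'])

lemma v0_out: "i \<notin> B \<Longrightarrow> v0 i = gv s i" by (rule rot_vec_outside[OF blk'])

lemma du: "vnorm B (\<lambda>i. gu s' i - u0 i) \<le> 60 * \<epsilon> * vnorm B (gu s)" "vnorm B u0 = vnorm B (gu s)"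
  using iso_col unfolding near_iso_def gu' by auto

lemma dv: "vnorm B (\<lambda>i. gv s' i - v0 i) \<le> 60 * \<epsilon> * vnorm B (gv s)" "vnorm B v0 = vnorm B (gv s)"
  using iso_col unfolding near_iso_def gv' by auto

lemma Err_else:
  assumes ij: "i \<in> {1..n}" "j \<in> {1..n}" "i \<notin> B" "j \<notin> B"
  shows "Err i j = 0"
proof -
  have lower: "fgen s' i j = F i j" if "j \<le> i" "i \<in> {1..n}" "j \<in> {1..n}" "i \<notin> B" "j \<notin> B" for i j
    using that low_else[of j i] by (simp add: fgen_low gu'_out gv'_out)
  have "fgen s' i j = F i j"
  proof (cases "j \<le> i")
    case False
    then show ?thesis
      using lower[of i j] ij fgen_hermitian[of i j s'] fgen_hermitian[of i j s] by auto
  qed (use lower ij in auto)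
  then show ?thesis using ij by (simp add: Err_def T_else)
qed

lemma fro_F_left: "fro B L F \<le> 6"
proof -
  have "fro B L F \<le> real (card B) * 2"
  proof (rule fro_le_rows)
    fix i assume "i \<in> B"
    then have "vnorm {1..n} (F i) \<le> 2" using B_sub by (intro op_le_row[OF F2]) auto
    moreover have "vnorm L (F i) \<le> vnorm {1..n} (F i)" using lob bn by (intro vnorm_sub) auto
    ultimately show "vnorm L (F i) \<le> 2" by linarith
  qed simp
  then show ?thesis using card_B by linarith
qed

lemma fro_F_below: "fro W B F \<le> 6"
proof -
  have "fro B W (\<lambda>i j. F j i) \<le> real (card B) * 2"
  proof (rule fro_le_rows)
    fix i assume "i \<in> B"
    then have "vnorm {1..n} (\<lambda>j. F j i) \<le> 2" using B_sub by (intro op_le_column[OF F2]) auto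
    moreover have "vnorm W (\<lambda>j. F j i) \<le> vnorm {1..n} (\<lambda>j. F j i)" by (intro vnorm_sub) auto
    ultimately show "vnorm W (\<lambda>j. F j i) \<le> 2" by linarith
  qed simp
  then show ?thesis using card_B unfolding fro_transpose[of W] by linarith
qed

lemma fro_F_block: "fro B B F \<le> 6"
proof -
  have "fro B B F \<le> real (card B) * 2"
  proof (rule fro_le_rows)
    fix i assume "i \<in> B"
    then have "vnorm {1..n} (F i) \<le> 2" using B_sub by (intro op_le_row[OF F2]) auto
    moreover have "vnorm B (F i) \<le> vnorm {1..n} (F i)" using B_sub by (intro vnorm_sub) auto
    ultimately show "vnorm B (F i) \<le> 2" by linarith
  qed simp
  then show ?thesis using card_B by linarith
qed

text \<open>The entries of \<open>u v\<^sup>*\<close> to the left of the block need not be bounded by the growth constants, but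
  they equal \<open>low s - F\<close>; so the rounding errors of \<open>u\<close> are harmless there.\<close>

lemma Err_left: "fro B L Err \<le> 60 * \<epsilon> * (2 * fro B L (low s) + 6)"
proof -
  let ?D = "\<lambda>i j. low s' i j - fold (rot_vec exact) gs' (\<lambda>i. low s i j) i"
  let ?O = "\<lambda>i j. (gu s' i - u0 i) * cnj (gv s j)"
  have eq: "Err i j = ?D i j - ?O i j" if "i \<in> B" "j \<in> L" for i j
  proof -
    have ij: "i \<in> {1..n}" "j \<in> {1..n}" "j \<notin> B" "j \<le> i" using that B_sub lob bn by auto
    have "T A i j = fold (rot_vec exact) gs' (\<lambda>i. A i j) i" using ij by (simp add: T_left)
    also have "\<dots> = fold (rot_vec exact) gs' (\<lambda>i. low s i j) i"
      by (rule rot_vec_local[OF blk' _ that(1)]) (use that(2) in \<open>auto simp: entry_def\<close>)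
    finally show ?thesis
      unfolding Err_def T_F[OF ij(1,2)] using ij by (simp add: fgen_low gv'_out v0_out algebra_simps)
  qed
  have "fro B L Err = fro B L (\<lambda>i j. ?D i j - ?O i j)" by (rule fro_cong) (rule eq)
  also have "\<dots> \<le> fro B L ?D + fro B L ?O" by (rule fro_triangle_diff)
  also have "fro B L ?D \<le> 60 * \<epsilon> * fro B L (low s)"
    using low_left e0 by (intro fro_cols_le) auto
  also have "fro B L ?O = vnorm B (\<lambda>i. gu s' i - u0 i) * vnorm L (gv s)"
    by (rule fro_outer)
  also have "\<dots> \<le> (60 * \<epsilon> * vnorm B (gu s)) * vnorm L (gv s)"
    using du by (intro mult_right_mono) auto
  also have "\<dots> = 60 * \<epsilon> * fro B L (\<lambda>i j. gu s i * cnj (gv s j))" by (simp add: fro_outer)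
  also have "fro B L (\<lambda>i j. gu s i * cnj (gv s j)) = fro B L (\<lambda>i j. low s i j - F i j)"
    by (rule fro_cong) (auto simp: fgen_low)
  finally have O: "fro B L Err \<le> 60 * \<epsilon> * fro B L (low s) + 60 * \<epsilon> * fro B L (\<lambda>i j. low s i j - F i j)"
    by simp
  have "fro B L (\<lambda>i j. low s i j - F i j) \<le> fro B L (low s) + 6"
    using fro_triangle_diff[of B L "low s" F] fro_F_left by simp
  then have "60 * \<epsilon> * fro B L (\<lambda>i j. low s i j - F i j) \<le> 60 * \<epsilon> * (fro B L (low s) + 6)"
    using e0 by (intro mult_left_mono) auto
  with O show ?thesis by (simp add: algebra_simps)
qed

text \<open>The mirror situation: below the block \<open>u\<close> is untouched and the rounding
  errors are those of \<open>v\<close>, again multiplied into an outer product that equals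
  \<open>low s\<close> - \<open>F\<close>.\<close>

lemma Err_below: "fro W B Err \<le> 60 * \<epsilon> * (2 * fro W B (low s) + 6)"
proof -
  let ?D = "\<lambda>i j. low s' i j - fold (row_vec exact) gs' (low s i) j"
  let ?O = "\<lambda>i j. gu s i * cnj (gv s' j - v0 j)"
  have eq: "Err i j = ?D i j - ?O i j" if "i \<in> W" "j \<in> B" for i j
  proof -
    have ij: "i \<in> {1..n}" "j \<in> {1..n}" "i \<notin> B" "j \<le> i" using that B_sub lob bn by auto
    have "T A i j = fold (row_vec exact) gs' (A i) j" using ij by (simp add: T_below)
    also have "\<dots> = fold (row_vec exact) gs' (low s i) j"
      by (rule row_vec_local[OF blk' _ that(2)]) (use that(1) in \<open>auto simp: entry_def\<close>)
    finally show ?thesis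
      unfolding Err_def T_F[OF ij(1,2)] using ij by (simp add: fgen_low gu'_out u0_out algebra_simps)
  qed
  have "fro W B Err = fro W B (\<lambda>i j. ?D i j - ?O i j)" by (rule fro_cong) (rule eq)
  also have "\<dots> \<le> fro W B ?D + fro W B ?O" by (rule fro_triangle_diff)
  also have "fro W B ?D \<le> 60 * \<epsilon> * fro W B (low s)"
    using low_below e0 by (intro fro_rows_le) auto
  also have "fro W B ?O = vnorm W (gu s) * vnorm B (\<lambda>i. gv s' i - v0 i)"
    by (rule fro_outer)
  also have "\<dots> \<le> vnorm W (gu s) * (60 * \<epsilon> * vnorm B (gv s))"
    using dv by (intro mult_left_mono) auto
  also have "\<dots> = 60 * \<epsilon> * fro W B (\<lambda>i j. gu s i * cnj (gv s j))" by (simp add: fro_outer)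
  also have "fro W B (\<lambda>i j. gu s i * cnj (gv s j)) = fro W B (\<lambda>i j. low s i j - F i j)"
    by (rule fro_cong) (auto simp: fgen_low)
  finally have O: "fro W B Err \<le> 60 * \<epsilon> * fro W B (low s) + 60 * \<epsilon> * fro W B (\<lambda>i j. low s i j - F i j)"
    by simp
  have "fro W B (\<lambda>i j. low s i j - F i j) \<le> fro W B (low s) + 6"
    using fro_triangle_diff[of W B "low s" F] fro_F_below by simp
  then have "60 * \<epsilon> * fro W B (\<lambda>i j. low s i j - F i j) \<le> 60 * \<epsilon> * (fro W B (low s) + 6)"
    using e0 by (intro mult_left_mono) auto
  with O show ?thesis by (simp add: algebra_simps)
qed

text \<open>Cancellation makes the error relative to the three terms of the symmetry formula, not to
  the entry. Both indices lie in the block, so the products are at most g, and the stored entry,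
  being an entry of F + u v^*, is at most 2 + g \<le> 3 g.\<close>

lemma fl_entry_err:
  assumes "i \<in> B" "j \<in> B"
  shows "cmod (fl_entry ar s i j - A i j) \<le> 20 * \<epsilon> * g"
proof (cases "j \<le> i")
  case True
  then show ?thesis using e0 g1 by (simp add: fl_entry_def entry_def)
next
  case False
  define x where "x = cnj (low s j i)"
  define y where "y = cnj (gu s j) * gv s i"
  define z where "z = gu s i * cnj (gv s j)"
  have sm: "std_op \<epsilon> (+) (fadd ar)" "std_op \<epsilon> (-) (fsub ar)" "std_op \<epsilon> (*) (fmul ar)"
    using model by (auto simp: standard_model_def)
  obtain d1 where d1: "cmod d1 \<le> \<epsilon>" "fmul ar (cnj (gu s j)) (gv s i) = y * (1 + d1)"
    unfolding y_def using std_opE[OF sm(3)] .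
  obtain d2 where d2: "cmod d2 \<le> \<epsilon>" "fsub ar x (y * (1 + d1)) = (x - y * (1 + d1)) * (1 + d2)"
    using std_opE[OF sm(2)] .
  obtain d3 where d3: "cmod d3 \<le> \<epsilon>" "fmul ar (gu s i) (cnj (gv s j)) = z * (1 + d3)"
    unfolding z_def using std_opE[OF sm(3)] .
  obtain d4 where d4: "cmod d4 \<le> \<epsilon>" "fadd ar ((x - y * (1 + d1)) * (1 + d2)) (z * (1 + d3))
      = ((x - y * (1 + d1)) * (1 + d2) + z * (1 + d3)) * (1 + d4)"
    using std_opE[OF sm(1)] .
  have A: "A i j = x - y + z" and fl: "fl_entry ar s i j = ((x - y * (1 + d1)) * (1 + d2) + z * (1 + d3)) * (1 + d4)"
    using False d1 d2 d3 d4 by (simp_all add: entry_def fl_entry_def x_def y_def z_def)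
  have pr: "cmod ((1 + d) * (1 + d') - 1) \<le> 2.01 * \<epsilon> \<and> cmod ((1 + d) * (1 + d') * (1 + d'') - 1) \<le> 3.1 * \<epsilon>"
    if "cmod d \<le> \<epsilon>" "cmod d' \<le> \<epsilon>" "cmod d'' \<le> \<epsilon>" for d d' d''
  proof
    have "(1 + d) * (1 + d') - 1 = d + d' + d * d'" by (simp add: algebra_simps)
    then have "cmod ((1 + d) * (1 + d') - 1) \<le> cmod d + cmod d' + cmod d * cmod d'"
      by (metis norm_mult norm_triangle_mono norm_triangle_ineq order_refl)
    also have "\<dots> \<le> \<epsilon> + \<epsilon> + \<epsilon> * (1/1000)" using that e0 e1 by (intro add_mono mult_mono) auto
    finally show 1: "cmod ((1 + d) * (1 + d') - 1) \<le> 2.01 * \<epsilon>" using e0 by simp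
    define q where "q = (1 + d) * (1 + d') - 1"
    have "(1 + d) * (1 + d') * (1 + d'') - 1 = q + d'' + q * d''" by (simp add: q_def algebra_simps)
    then have "cmod ((1 + d) * (1 + d') * (1 + d'') - 1) \<le> cmod q + cmod d'' + cmod q * cmod d''"
      by (metis norm_mult norm_triangle_mono norm_triangle_ineq order_refl)
    also have "\<dots> \<le> 2.01 * \<epsilon> + \<epsilon> + (2.01 * \<epsilon>) * (1/1000)"
      using 1 that e0 e1 unfolding q_def by (intro add_mono mult_mono) auto
    finally show "cmod ((1 + d) * (1 + d') * (1 + d'') - 1) \<le> 3.1 * \<epsilon>" using e0 by simp
  qed
  have ij: "i \<in> {1..n}" "j \<in> {1..n}" using assms B_sub by auto
  have uv: "cmod (gu s k) * cmod (gv s l) \<le> g" if "k \<in> B" "l \<in> B" for k l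
    using mult_mono[OF cmod_le_vnorm[of B k "gu s"] cmod_le_vnorm[of B l "gv s"]] that win by simp
  have ny: "cmod y \<le> g" and nz: "cmod z \<le> g"
    using uv[OF assms(2,1)] uv[OF assms] by (simp_all add: y_def z_def norm_mult)
  have "low s j i = F j i + gu s j * cnj (gv s i)" using False by (simp add: fgen_low)
  then have "cmod x \<le> cmod (F j i) + cmod (gu s j) * cmod (gv s i)"
    unfolding x_def complex_mod_cnj by (metis norm_triangle_ineq norm_mult complex_mod_cnj)
  also have "\<dots> \<le> 2 + g" using op_le_entry[OF F2 _ ij(2,1)] uv[OF assms(2,1)] by simp
  finally have nx: "cmod x \<le> 3 * g" using g1 by simp
  let ?a = "(1 + d2) * (1 + d4) - 1" and ?b = "(1 + d1) * (1 + d2) * (1 + d4) - 1"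
    and ?c = "(1 + d3) * (1 + d4) - 1"
  have eq: "fl_entry ar s i j - A i j = x * ?a - y * ?b + z * ?c"
    unfolding A fl by (simp add: algebra_simps)
  have "cmod (fl_entry ar s i j - A i j) \<le> cmod x * cmod ?a + cmod y * cmod ?b + cmod z * cmod ?c"
    using norm_triangle_ineq[of "x * ?a - y * ?b" "z * ?c"] norm_triangle_ineq4[of "x * ?a" "y * ?b"]
    unfolding eq norm_mult by linarith
  also have "\<dots> \<le> (3 * g) * (2.01 * \<epsilon>) + g * (3.1 * \<epsilon>) + g * (2.01 * \<epsilon>)"
    using nx ny nz pr[OF d2(1) d4(1) d4(1)] pr[OF d1(1) d2(1) d4(1)] pr[OF d3(1) d4(1) d4(1)] g1
    by (intro add_mono mult_mono) auto
  also have "\<dots> \<le> 20 * \<epsilon> * g" using e0 g1 by (simp add: algebra_simps)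
  finally show ?thesis .
qed

lemma fro_A_block: "fro B B A \<le> 7 * g"
proof -
  have "fro B B A = fro B B (\<lambda>i j. F i j + gu s i * cnj (gv s j))" by (simp add: fgen_def)
  also have "\<dots> \<le> fro B B F + fro B B (\<lambda>i j. gu s i * cnj (gv s j))" by (rule fro_triangle)
  also have "\<dots> \<le> 6 + g" using fro_F_block win by (simp add: fro_outer)
  finally show ?thesis using g1 by simp
qed

text \<open>Errors add up along recovered entries, left rotation, right rotation: nine entries at 20
  make 180, the left rotation of a matrix of norm about 7 g adds 60 times 8, the right one 60 times
  7.66, in all less than 1130.\<close>

lemma fro_block: "fro B B (\<lambda>i j. X i j - T A i j) \<le> 1130 * \<epsilon> * g" "fro B B X \<le> 9 * g"
proof -
  let ?H = "fl_entry ar s"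
  let ?Y = "fold (rot_left ar) gs ?H" and ?YE = "fold (rot_left exact) gs' A"
  have eg: "0 \<le> \<epsilon> * g" "\<epsilon> * g \<le> g / 1000"
    using e0 e1 g1 mult_right_mono[of \<epsilon> "1/1000" g] by auto
  \<comment> \<open>Second-order terms are absorbed here: a multiple of \<epsilon> g inside
    \<open>y\<close> contributes, after another factor \<epsilon>, only a thousandth of
    itself.\<close>
  have em: "\<epsilon> * y \<le> 7 * (\<epsilon> * g) + a * (\<epsilon> * g) / 1000" if "y \<le> 7 * g + a * (\<epsilon> * g)" "0 \<le> a" for y a
  proof -
    have "a * (\<epsilon> * g) \<le> a * (g / 1000)" using that(2) eg(2) by (intro mult_left_mono) auto
    then have "\<epsilon> * y \<le> \<epsilon> * (7 * g + a * (g / 1000))" using that(1) e0 by (intro mult_left_mono) auto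
    then show ?thesis by (simp add: algebra_simps)
  qed
  have "fro B B (\<lambda>i j. ?H i j - A i j) \<le> real (card B) * real (card B) * (20 * \<epsilon> * g)"
    using fl_entry_err by (intro fro_le_card) auto
  also have "\<dots> \<le> 3 * 3 * (20 * \<epsilon> * g)"
    using card_B e0 eg g1 by (intro mult_mono) auto
  finally have HA: "fro B B (\<lambda>i j. ?H i j - A i j) \<le> 180 * (\<epsilon> * g)" by simp
  have "fro B B ?H \<le> fro B B (\<lambda>i j. ?H i j - A i j) + fro B B A"
    using fro_triangle[of B B "\<lambda>i j. ?H i j - A i j" A] by simp
  then have H: "fro B B ?H \<le> 7 * g + 180 * (\<epsilon> * g)" using HA fro_A_block by linarith
  have eH: "\<epsilon> * fro B B ?H \<le> 8 * (\<epsilon> * g)"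
    using em[OF H, OF zero_le_numeral] eg(1) by linarith
  have Ycol: "(\<lambda>i. ?Y i j) = fold (rot_vec ar) gs (\<lambda>i. ?H i j)"
    "(\<lambda>i. ?YE i j) = fold (rot_vec exact) gs' (\<lambda>i. A i j)" for j
    by (rule fold_rot_left)+
  \<comment> \<open>The exact left rotation of the computed entries separates the rounding of the
    rotation (\<open>YZ\<close>) from the propagated error of the entries (\<open>ZY\<close>).
    \<open>V\<close> below does the same on the right.\<close>
  define Z where "Z = fold (rot_left exact) gs' ?H"
  have Zcol: "(\<lambda>i. Z i j) = fold (rot_vec exact) gs' (\<lambda>i. ?H i j)" for j
    unfolding Z_def by (rule fold_rot_left)
  have YZ: "fro B B (\<lambda>i j. ?Y i j - Z i j) \<le> 60 * \<epsilon> * fro B B ?H"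
  proof (rule fro_cols_le)
    fix j
    show "vnorm B (\<lambda>i. ?Y i j - Z i j) \<le> 60 * \<epsilon> * vnorm B (\<lambda>i. ?H i j)"
      using iso_col fun_cong[OF Ycol(1)[of j]] fun_cong[OF Zcol[of j]] unfolding near_iso_def by simp
  qed (use e0 in auto)
  have ZY: "fro B B (\<lambda>i j. Z i j - ?YE i j) \<le> 1 * fro B B (\<lambda>i j. ?H i j - A i j)"
  proof (rule fro_cols_le)
    fix j
    have "fold (rot_vec exact) gs' (\<lambda>i. ?H i j - A i j) = (\<lambda>i. Z i j - ?YE i j)"
      using iso_col fun_cong[OF Ycol(2)[of j]] fun_cong[OF Zcol[of j]] unfolding near_iso_def by simp
    then show "vnorm B (\<lambda>i. Z i j - ?YE i j) \<le> 1 * vnorm B (\<lambda>i. ?H i j - A i j)"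
      using iso_col unfolding near_iso_def by (metis mult_1 order_refl)
  qed simp
  have "fro B B (\<lambda>i j. ?Y i j - ?YE i j) \<le> fro B B (\<lambda>i j. ?Y i j - Z i j) + fro B B (\<lambda>i j. Z i j - ?YE i j)"
    using fro_triangle[of B B "\<lambda>i j. ?Y i j - Z i j" "\<lambda>i j. Z i j - ?YE i j"] by simp
  then have YY: "fro B B (\<lambda>i j. ?Y i j - ?YE i j) \<le> 660 * (\<epsilon> * g)" using YZ ZY HA eH by simp
  have Y0: "fro B B ?YE \<le> 1 * fro B B A"
  proof (rule fro_cols_le)
    fix j
    show "vnorm B (\<lambda>i. ?YE i j) \<le> 1 * vnorm B (\<lambda>i. A i j)"
      using iso_col unfolding near_iso_def Ycol(2) by simp
  qed simp
  have "fro B B ?Y \<le> fro B B (\<lambda>i j. ?Y i j - ?YE i j) + fro B B ?YE"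
    using fro_triangle[of B B "\<lambda>i j. ?Y i j - ?YE i j" ?YE] by simp
  then have Y: "fro B B ?Y \<le> 7 * g + 660 * (\<epsilon> * g)" using YY Y0 fro_A_block by linarith
  then have eY: "\<epsilon> * fro B B ?Y \<le> (766 / 100) * (\<epsilon> * g)"
    using em[OF Y, OF zero_le_numeral] by linarith
  define V where "V = fold (rot_right exact) gs' ?Y"
  have XV: "fro B B (\<lambda>i j. X i j - V i j) \<le> 60 * \<epsilon> * fro B B ?Y"
    using iso_row e0 unfolding X_def V_def fold_rot_right near_iso_def by (intro fro_rows_le) auto
  have VT: "fro B B (\<lambda>i j. V i j - T A i j) \<le> 1 * fro B B (\<lambda>i j. ?Y i j - ?YE i j)"
  proof (rule fro_rows_le)
    fix i
    have "fold (row_vec exact) gs' (\<lambda>j. ?Y i j - ?YE i j) = (\<lambda>j. V i j - T A i j)"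
      using iso_row unfolding near_iso_def V_def T_def fold_rot_right by simp
    then show "vnorm B (\<lambda>j. V i j - T A i j) \<le> 1 * vnorm B (\<lambda>j. ?Y i j - ?YE i j)"
      using iso_row unfolding near_iso_def by (metis mult_1 order_refl)
  qed simp
  have "fro B B (\<lambda>i j. X i j - T A i j) \<le> fro B B (\<lambda>i j. X i j - V i j) + fro B B (\<lambda>i j. V i j - T A i j)"
    using fro_triangle[of B B "\<lambda>i j. X i j - V i j" "\<lambda>i j. V i j - T A i j"] by simp
  also have "\<dots> \<le> 60 * (766 / 100) * (\<epsilon> * g) + 660 * (\<epsilon> * g)" using XV VT YY eY by simp
  also have "\<dots> \<le> 1130 * (\<epsilon> * g)" using eg by simp
  finally have XT: "fro B B (\<lambda>i j. X i j - T A i j) \<le> 1130 * (\<epsilon> * g)" .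
  then show "fro B B (\<lambda>i j. X i j - T A i j) \<le> 1130 * \<epsilon> * g" by simp
  have TA: "fro B B (T A) \<le> 1 * fro B B ?YE"
  proof (rule fro_rows_le)
    fix i
    show "vnorm B (T A i) \<le> 1 * vnorm B (?YE i)"
      using iso_row unfolding near_iso_def T_def fold_rot_right by simp
  qed simp
  have "fro B B X \<le> fro B B (\<lambda>i j. X i j - T A i j) + fro B B (T A)"
    using fro_triangle[of B B "\<lambda>i j. X i j - T A i j" "T A"] by simp
  then show "fro B B X \<le> 9 * g" using XT TA Y0 fro_A_block eg by linarith
qed

text \<open>The change of the outer product is split into (u' - u0) v'^* and u0 (v' - v0)^*; each is
  a product of norms over the block, hence a multiple of \<epsilon> g. The constants 1130, 63.6 and
  60 stay below 1300.\<close>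

lemma fro_Eh: "fro B B Eh \<le> 1300 * \<epsilon> * g"
proof -
  let ?P = "\<lambda>i j. (gu s' i - u0 i) * cnj (gv s' j)" and ?Q = "\<lambda>i j. u0 i * cnj (gv s' j - v0 j)"
  have eg: "0 \<le> \<epsilon> * g" using e0 g1 by simp
  have v': "vnorm B (gv s') \<le> 1.06 * vnorm B (gv s)"
  proof -
    have "vnorm B (gv s') \<le> vnorm B (\<lambda>i. gv s' i - v0 i) + vnorm B v0"
      using vnorm_triangle[of B "\<lambda>i. gv s' i - v0 i" v0] by simp
    also have "\<dots> \<le> 60 * \<epsilon> * vnorm B (gv s) + vnorm B (gv s)" using dv by simp
    also have "60 * \<epsilon> * vnorm B (gv s) \<le> 0.06 * vnorm B (gv s)"
      using e1 by (intro mult_right_mono) auto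
    finally show ?thesis by simp
  qed
  have "fro B B ?P = vnorm B (\<lambda>i. gu s' i - u0 i) * vnorm B (gv s')" by (rule fro_outer)
  also have "\<dots> \<le> (60 * \<epsilon> * vnorm B (gu s)) * (1.06 * vnorm B (gv s))"
    using du v' e0 by (intro mult_mono) auto
  also have "\<dots> = 63.6 * (\<epsilon> * (vnorm B (gu s) * vnorm B (gv s)))" by simp
  also have "\<dots> \<le> 63.6 * (\<epsilon> * g)" using win e0 by (intro mult_left_mono) auto
  finally have P: "fro B B ?P \<le> 63.6 * (\<epsilon> * g)" .
  have "fro B B ?Q = vnorm B u0 * vnorm B (\<lambda>i. gv s' i - v0 i)" by (rule fro_outer)
  also have "\<dots> \<le> vnorm B (gu s) * (60 * \<epsilon> * vnorm B (gv s))"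
    unfolding du(2) using dv by (intro mult_left_mono) auto
  also have "\<dots> = 60 * (\<epsilon> * (vnorm B (gu s) * vnorm B (gv s)))" by simp
  also have "\<dots> \<le> 60 * (\<epsilon> * g)" using win e0 by (intro mult_left_mono) auto
  finally have Q: "fro B B ?Q \<le> 60 * (\<epsilon> * g)" .
  have "Eh = (\<lambda>i j. (X i j - T A i j) - (?P i j + ?Q i j))"
    by (simp add: Eh_def fun_eq_iff algebra_simps)
  then have "fro B B Eh \<le> fro B B (\<lambda>i j. X i j - T A i j) + (fro B B ?P + fro B B ?Q)"
    using fro_triangle_diff[of B B "\<lambda>i j. X i j - T A i j" "\<lambda>i j. ?P i j + ?Q i j"]
      fro_triangle[of B B ?P ?Q] by simp
  then show ?thesis using P Q fro_block(1) eg by simp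
qed

lemma Err_block_lower:
  assumes "i \<in> B" "j \<in> B" "j \<le> i"
  shows "Err i j = Eh i j"
proof -
  have ij: "i \<in> {1..n}" "j \<in> {1..n}" using assms B_sub by auto
  show ?thesis
    unfolding Err_def T_F[OF ij] Eh_def
    using low_block[OF assms] assms(3) by (simp add: fgen_low X_def)
qed

lemma dmax_nonneg: "0 \<le> dmax"
  using dmax[of lo] lo lob bn by force

text \<open>An entry above the diagonal is recovered from its mirror image, so it inherits that
  error plus the defect of \<open>Err_mirror\<close>. Hence twice 1300, and 2 dmax for each of at
  most nine entries.\<close>

lemma Err_block: "fro B B Err \<le> 2600 * \<epsilon> * g + 18 * dmax"
proof -
  have le: "cmod (Err i j) \<le> cmod (Eh i j) + cmod (Eh j i) + 2 * dmax" if ij: "i \<in> B" "j \<in> B" for i j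
  proof (cases "j \<le> i")
    case True
    then show ?thesis using Err_block_lower[OF ij] dmax_nonneg by simp
  next
    case False
    have n: "i \<in> {1..n}" "j \<in> {1..n}" using ij B_sub by auto
    have "cnj (Err i j) = Eh j i + 2 * \<i> * T Dm j i"
      using Err_mirror[OF n(2,1)] Err_block_lower[OF ij(2,1)] False by simp
    then have "cmod (Err i j) = cmod (Eh j i + 2 * \<i> * T Dm j i)" by (metis complex_mod_cnj)
    also have "\<dots> \<le> cmod (Eh j i) + 2 * cmod (T Dm j i)"
      using norm_triangle_ineq[of "Eh j i" "2 * \<i> * T Dm j i"] by (simp add: norm_mult)
    also have "\<dots> \<le> cmod (Eh j i) + 2 * dmax" using T_Dm_le[OF n(2,1)] by simp
    also have "\<dots> \<le> cmod (Eh i j) + cmod (Eh j i) + 2 * dmax" by simp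
    finally show ?thesis .
  qed
  \<comment> \<open>Real bounds dressed as complex matrices, so that the lemmas on
    \<open>fro\<close> apply.\<close>
  let ?a = "\<lambda>i j. complex_of_real (cmod (Eh i j))" and ?b = "\<lambda>i j. complex_of_real (cmod (Eh j i))"
    and ?c = "\<lambda>i j::nat. complex_of_real (2 * dmax)"
  have "fro B B Err \<le> fro B B (\<lambda>i j. (?a i j + ?b i j) + ?c i j)"
  proof (rule fro_mono)
    fix i j assume "i \<in> B" "j \<in> B"
    have "(?a i j + ?b i j) + ?c i j = complex_of_real (cmod (Eh i j) + cmod (Eh j i) + 2 * dmax)" by simp
    then have "cmod ((?a i j + ?b i j) + ?c i j) = cmod (Eh i j) + cmod (Eh j i) + 2 * dmax"
      using dmax_nonneg by (simp only: norm_of_real) simp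
    then show "cmod (Err i j) \<le> cmod ((?a i j + ?b i j) + ?c i j)" using le \<open>i \<in> B\<close> \<open>j \<in> B\<close> by simp
  qed
  also have "\<dots> \<le> fro B B ?a + fro B B ?b + fro B B ?c"
    using fro_triangle[of B B "\<lambda>i j. ?a i j + ?b i j" ?c] fro_triangle[of B B ?a ?b] by simp
  also have "fro B B ?a = fro B B Eh" by (simp add: fro_def)
  also have "fro B B ?b = fro B B Eh" by (subst fro_transpose) (simp add: fro_def)
  also have "fro B B ?c \<le> real (card B) * real (card B) * (2 * dmax)"
    using dmax_nonneg by (intro fro_le_card) (auto simp: norm_mult)
  finally have "fro B B Err \<le> fro B B Eh + fro B B Eh + real (card B) * real (card B) * (2 * dmax)" by simp
  moreover have "real (card B) * real (card B) * (2 * dmax) \<le> 3 * 3 * (2 * dmax)"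
    using card_B dmax_nonneg by (intro mult_mono) auto
  ultimately show ?thesis using fro_Eh by linarith
qed

lemma fro_Err_mirror:
  assumes "I \<subseteq> {1..n}" "J \<subseteq> {1..n}" "\<And>i j. i \<in> I \<Longrightarrow> j \<in> J \<Longrightarrow> i \<in> B \<and> j \<notin> B \<or> i \<notin> B \<and> j \<in> B"
  shows "fro J I Err = fro I J Err"
proof -
  have "cmod (Err j i) = cmod (Err i j)" if "i \<in> I" "j \<in> J" for i j
  proof -
    have "i \<noteq> j" using assms(3)[OF that] by auto
    moreover have "i \<in> {1..n}" "j \<in> {1..n}" using that assms(1,2) by blast+
    ultimately have "cnj (Err j i) = Err i j"
      using Err_mirror[of i j] T_Dm_off[OF assms(3)[OF that]] by simp
    then show ?thesis by (metis complex_mod_cnj)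
  qed
  then have "fro I J (\<lambda>i j. Err j i) = fro I J Err"
    unfolding fro_def by (intro L2_set_cong) auto
  then show ?thesis using fro_transpose[of J I Err] by simp
qed

text \<open>Five rectangles: the block, and the strips to its left and below with their mirror
  images of equal norm; this doubles 60 to 120.\<close>

lemma op_le_Err:
  "op_le n Err (120 * \<epsilon> * (2 * fro B L (low s) + 6) + 120 * \<epsilon> * (2 * fro W B (low s) + 6)
     + (2600 * \<epsilon> * g + 18 * dmax))"
proof -
  define p where "p I J = (\<lambda>i j. if i \<in> I \<and> j \<in> J then Err i j else 0)" for I J :: "nat set"
  have p: "op_le n (p I J) (fro I J Err)" if "I \<subseteq> {1..n}" "J \<subseteq> {1..n}" for I J
  proof -
    have "fro I J (p I J) = fro I J Err" by (rule fro_cong) (simp add: p_def)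
    moreover have "op_le n (p I J) (fro I J (p I J))"
      by (rule op_le_rect[OF that]) (auto simp: p_def)
    ultimately show ?thesis by simp
  qed
  have sub: "L \<subseteq> {1..n}" "W \<subseteq> {1..n}" using lob bn by auto
  note BL = p[OF B_sub sub(1)] and LB = p[OF sub(1) B_sub] and WB = p[OF sub(2) B_sub]
    and BW = p[OF B_sub sub(2)] and BB = p[OF B_sub B_sub]
  have "op_le n Err (fro B L Err + fro L B Err + (fro W B Err + fro B W Err) + fro B B Err)"
  proof (rule op_le_cong)
    show "op_le n (\<lambda>i j. ((p B L i j + p L B i j) + (p W B i j + p B W i j)) + p B B i j)
        (fro B L Err + fro L B Err + (fro W B Err + fro B W Err) + fro B B Err)"
      by (intro op_le_add BL LB WB BW BB)
    fix i j assume ij: "i \<in> {1..n}" "j \<in> {1..n}"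
    show "((p B L i j + p L B i j) + (p W B i j + p B W i j)) + p B B i j = Err i j"
      using ij Err_else[OF ij] by (auto simp: p_def)
  qed
  moreover have "fro L B Err = fro B L Err" by (rule fro_Err_mirror) (use B_sub sub in auto)
  moreover have "fro B W Err = fro W B Err" by (rule fro_Err_mirror) (use B_sub sub in auto)
  ultimately show ?thesis
    using Err_left Err_below Err_block by (elim op_le_mono) simp
qed

text \<open>The exact rotation preserves the bound, so the drift grows additively, by the error of
  one diagonal entry.\<close>

lemma diag_step:
  assumes "i \<in> {1..n}"
  shows "\<bar>Im (fgen s' i i)\<bar> \<le> dmax + 1300 * \<epsilon> * g"
proof -
  have eq: "fgen s' i i = T F i i + Err i i" by (simp add: Err_def)
  have "cmod (Err i i) \<le> 1300 * \<epsilon> * g"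
  proof (cases "i \<in> B")
    case True
    have "cmod (Eh i i) \<le> fro B B Eh"
      unfolding fro_def using member_le_L2_set[of "B \<times> B" "(i, i)" "\<lambda>(i, j). cmod (Eh i j)"] True by simp
    then show ?thesis using Err_block_lower[OF True True] fro_Eh by simp
  next
    case False
    then show ?thesis using Err_else[OF assms assms] e0 g1 by simp
  qed
  then show ?thesis
    using Im_T_F[OF assms] abs_Im_le_cmod[of "Err i i"] unfolding eq by simp
qed

lemma conj_step:
  assumes "i \<in> {1..n}" "j \<in> {1..n}"
  shows "fgen s' i j = mmul n (ctrans U) (mmul n F U) i j + Err i j"
  using T_conj[OF assms, of F] by (simp add: Err_def)

lemma vec_step:
  "vnorm {1..n} (\<lambda>i. gu s' i - mvec n (ctrans U) (gu s) i) \<le> 60 * \<epsilon> * vnorm {1..n} (gu s)"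
  "vnorm {1..n} (\<lambda>i. gv s' i - mvec n (ctrans U) (gv s) i) \<le> 60 * \<epsilon> * vnorm {1..n} (gv s)"
proof -
  have "in_block {1..n} gs" using in_block_mono[OF blk B_sub] .
  then have iso: "near_iso {1..n} (60 * \<epsilon>) (fold (rot_vec ar) gs) (fold (rot_vec exact) gs')"
    using near_iso_rotations(1)[OF model e0 e1 near len] by (auto simp: in_block_def)
  have "vnorm {1..n} (\<lambda>i. fold (rot_vec ar) gs x i - mvec n (ctrans U) x i) \<le> 60 * \<epsilon> * vnorm {1..n} x" for x
  proof -
    have "vnorm {1..n} (\<lambda>i. fold (rot_vec ar) gs x i - mvec n (ctrans U) x i)
        = vnorm {1..n} (\<lambda>i. fold (rot_vec ar) gs x i - fold (rot_vec exact) gs' x i)"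
      using fold_rot_vec_eq[OF blk_n] by (intro vnorm_cong) simp
    then show ?thesis using iso by (simp add: near_iso_def)
  qed
  then show "vnorm {1..n} (\<lambda>i. gu s' i - mvec n (ctrans U) (gu s) i) \<le> 60 * \<epsilon> * vnorm {1..n} (gu s)"
    "vnorm {1..n} (\<lambda>i. gv s' i - mvec n (ctrans U) (gv s) i) \<le> 60 * \<epsilon> * vnorm {1..n} (gv s)"
    unfolding gu' gv' by blast+
qed

lemma fro_low_left: "fro B L (low s') \<le> (1 + 60 * \<epsilon>) * fro B L (low s)"
proof (rule fro_cols_le)
  fix j assume "j \<in> L"
  then have j: "1 \<le> j" "j < lo" by auto
  let ?f = "fold (rot_vec exact) gs' (\<lambda>i. low s i j)"
  have "vnorm B (\<lambda>i. low s' i j) \<le> vnorm B (\<lambda>i. low s' i j - ?f i) + vnorm B ?f"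
    using vnorm_triangle[of B "\<lambda>i. low s' i j - ?f i" ?f] by simp
  moreover have "vnorm B ?f = vnorm B (\<lambda>i. low s i j)" using iso_col by (simp add: near_iso_def)
  ultimately show "vnorm B (\<lambda>i. low s' i j) \<le> (1 + 60 * \<epsilon>) * vnorm B (\<lambda>i. low s i j)"
    using low_left[OF j] by (simp add: algebra_simps)
qed (use e0 in auto)

lemma fro_low_below: "fro W B (low s') \<le> (1 + 60 * \<epsilon>) * fro W B (low s)"
proof (rule fro_rows_le)
  fix i assume "i \<in> W"
  then have i: "b < i" "i \<le> n" by auto
  let ?f = "fold (row_vec exact) gs' (low s i)"
  have "vnorm B (low s' i) \<le> vnorm B (\<lambda>j. low s' i j - ?f j) + vnorm B ?f"
    using vnorm_triangle[of B "\<lambda>j. low s' i j - ?f j" ?f] by simp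
  moreover have "vnorm B ?f = vnorm B (low s i)" using iso_row by (simp add: near_iso_def)
  ultimately show "vnorm B (low s' i) \<le> (1 + 60 * \<epsilon>) * vnorm B (low s i)"
    using low_below[OF i] by (simp add: algebra_simps)
qed (use e0 in auto)

section \<open>Growth of the stored entries below the subdiagonal\<close>

abbreviation "P \<equiv> {(r, c). 1 \<le> c \<and> c + 1 < r \<and> r \<le> n}"
abbreviation "P0 \<equiv> {(r, c). 1 \<le> c \<and> c + 1 < r \<and> r \<le> n \<and> r \<notin> B \<and> c \<notin> B}"
abbreviation "sq Y \<equiv> \<lambda>(r, c). (cmod (Y r c))\<^sup>2"

lemma fin: "finite P" "finite P0" "finite (B \<times> L)" "finite (W \<times> B)" "finite (B \<times> B)"
proof -
  have "P \<subseteq> {1..n} \<times> {1..n}" by auto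
  then show "finite P" by (rule finite_subset) simp
  then show "finite P0" by (rule rev_finite_subset) auto
qed auto

text \<open>\<open>mass\<close> measures the stored entries below the subdiagonal. Left of and below the block a rotation
  acts isometrically, so the mass can only grow by entries that come from the subdiagonal or from
  the block itself; no knowledge of the shape of bulges and spikes is needed.\<close>

lemma mass_pieces: "sum (sq (low s)) P0 + (fro B L (low s))\<^sup>2 + (fro W B (low s))\<^sup>2 \<le> mass n s + 18 * g\<^sup>2"
proof -
  let ?Z = "P0 \<union> B \<times> L \<union> W \<times> B"
  let ?S = "{(lo, lo - 1), (b + 1, b)}"
  have "sum (sq (low s)) ?Z = sum (sq (low s)) P0 + sum (sq (low s)) (B \<times> L) + sum (sq (low s)) (W \<times> B)"
    using fin by (subst sum.union_disjoint, simp, simp, force, subst sum.union_disjoint) auto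
  then have eq: "sum (sq (low s)) P0 + (fro B L (low s))\<^sup>2 + (fro W B (low s))\<^sup>2 = sum (sq (low s)) ?Z"
    by (simp add: fro_sq)
  \<comment> \<open>The strips leave the region \<open>P\<close> only in the two subdiagonal entries
    adjacent to the block; each contributes at most (3 g)^2, whence 18 g^2.\<close>
  have sub: "r = lo \<and> c = lo - 1 \<and> 2 \<le> lo \<or> r = b + 1 \<and> c = b \<and> b < n"
    if "(r, c) \<in> ?Z - P" for r c
  proof -
    have "\<not> (1 \<le> c \<and> c + 1 < r \<and> r \<le> n)" using that by simp
    moreover have "(lo \<le> r \<and> r \<le> b \<and> 1 \<le> c \<and> c < lo) \<or> (b < r \<and> r \<le> n \<and> lo \<le> c \<and> c \<le> b)"
      using that by auto
    ultimately show ?thesis using lo lob bn by linarith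
  qed
  have "sum (sq (low s)) ?Z \<le> sum (sq (low s)) (P \<union> (?Z - P))"
    using fin by (intro sum_mono2) auto
  also have "\<dots> = sum (sq (low s)) P + sum (sq (low s)) (?Z - P)"
    using fin by (intro sum.union_disjoint) auto
  also have "sum (sq (low s)) (?Z - P) \<le> real (card (?Z - P)) * (9 * g\<^sup>2)"
  proof (rule sum_bounded_above)
    fix x assume "x \<in> ?Z - P"
    moreover obtain r c where rc: "x = (r, c)" by (cases x)
    ultimately have "(r, c) \<in> ?Z - P" by simp
    from sub[OF this] have x: "x = (r, c)" "cmod (low s r c) \<le> 3 * g"
      using rc sub_left sub_below by auto
    have "(cmod (low s r c))\<^sup>2 \<le> (3 * g)\<^sup>2" using x by (intro power_mono) auto
    then show "sq (low s) x \<le> 9 * g\<^sup>2" by (simp add: x power_mult_distrib)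
  qed
  also have "\<dots> \<le> 2 * (9 * g\<^sup>2)"
  proof (intro mult_right_mono)
    have "?Z - P \<subseteq> ?S"
    proof
      fix x assume "x \<in> ?Z - P"
      moreover obtain r c where rc: "x = (r, c)" by (cases x)
      ultimately have "(r, c) \<in> ?Z - P" by simp
      from sub[OF this] show "x \<in> ?S" using rc by auto
    qed
    then have "card (?Z - P) \<le> card ?S" by (intro card_mono) auto
    also have "\<dots> \<le> 2" by (simp add: card_insert_if)
    finally show "real (card (?Z - P)) \<le> 2" by simp
  qed auto
  finally show ?thesis unfolding eq mass_def by simp
qed

text \<open>81 g^2 is the square of the bound 9 g for the computed block: whatever lies below the
  subdiagonal inside the block is estimated anew in every step.\<close>

lemma mass_step: "mass n s' \<le> (1 + 60 * \<epsilon>)\<^sup>2 * (mass n s + 18 * g\<^sup>2) + 81 * g\<^sup>2"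
proof -
  have sub: "P \<subseteq> P0 \<union> (B \<times> L \<union> (W \<times> B \<union> {(r, c) \<in> B \<times> B. c \<le> r}))" (is "_ \<subseteq> P0 \<union> (_ \<union> (_ \<union> ?K))")
    by auto
  have fK: "finite ?K" by (rule finite_subset[OF _ fin(5)]) auto
  have un: "sum (sq (low s')) (I \<union> J) \<le> sum (sq (low s')) I + sum (sq (low s')) J"
    if "finite I" "finite J" for I J
    using sum_Un[OF that, of "sq (low s')"] sum_nonneg[of "I \<inter> J" "sq (low s')"] by auto
  have "mass n s' \<le> sum (sq (low s')) (P0 \<union> (B \<times> L \<union> (W \<times> B \<union> ?K)))"
    unfolding mass_def using sub fin fK by (intro sum_mono2) auto
  also have "\<dots> \<le> sum (sq (low s')) P0 + (sum (sq (low s')) (B \<times> L) + (sum (sq (low s')) (W \<times> B) + sum (sq (low s')) ?K))"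
    by (rule order_trans[OF un add_left_mono[OF order_trans[OF un add_left_mono[OF un]]]]) (use fin fK in auto)
  finally have 1: "mass n s' \<le> sum (sq (low s')) P0 + (fro B L (low s'))\<^sup>2 + (fro W B (low s'))\<^sup>2 + sum (sq (low s')) ?K"
    by (simp add: fro_sq)
  have K: "sum (sq (low s')) ?K \<le> 81 * g\<^sup>2"
  proof -
    have "sum (sq (low s')) ?K = sum (sq X) ?K"
      by (rule sum.cong) (auto simp: low_block X_def)
    also have "\<dots> \<le> sum (sq X) (B \<times> B)" using fin by (intro sum_mono2) auto
    also have "\<dots> = (fro B B X)\<^sup>2" by (simp add: fro_sq)
    also have "\<dots> \<le> (9 * g)\<^sup>2" using fro_block(2) by (intro power_mono) auto
    finally show ?thesis by (simp add: power_mult_distrib)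
  qed
  have "sum (sq (low s')) P0 = sum (sq (low s)) P0"
    using low_else by (intro sum.cong) auto
  also have "\<dots> \<le> (1 + 60 * \<epsilon>)\<^sup>2 * sum (sq (low s)) P0"
  proof -
    have "1 \<le> (1 + 60 * \<epsilon>)\<^sup>2" using e0 by (simp add: one_le_power)
    moreover have "0 \<le> sum (sq (low s)) P0" by (intro sum_nonneg) auto
    ultimately show ?thesis using mult_right_mono[of 1 "(1 + 60 * \<epsilon>)\<^sup>2"] by simp
  qed
  finally have P0: "sum (sq (low s')) P0 \<le> (1 + 60 * \<epsilon>)\<^sup>2 * sum (sq (low s)) P0" .
  have BL: "(fro B L (low s'))\<^sup>2 \<le> (1 + 60 * \<epsilon>)\<^sup>2 * (fro B L (low s))\<^sup>2"
    unfolding power_mult_distrib[symmetric] by (intro power_mono fro_low_left) simp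
  have WB: "(fro W B (low s'))\<^sup>2 \<le> (1 + 60 * \<epsilon>)\<^sup>2 * (fro W B (low s))\<^sup>2"
    unfolding power_mult_distrib[symmetric] by (intro power_mono fro_low_below) simp
  have "mass n s' \<le> (1 + 60 * \<epsilon>)\<^sup>2 * (sum (sq (low s)) P0 + (fro B L (low s))\<^sup>2 + (fro W B (low s))\<^sup>2) + 81 * g\<^sup>2"
    using 1 K P0 BL WB by (simp add: distrib_left)
  also have "\<dots> \<le> (1 + 60 * \<epsilon>)\<^sup>2 * (mass n s + 18 * g\<^sup>2) + 81 * g\<^sup>2"
    using mass_pieces by (intro add_right_mono mult_left_mono) auto
  finally show ?thesis .
qed

lemma fro_low_le: "fro B L (low s) \<le> sqrt (mass n s + 18 * g\<^sup>2)" "fro W B (low s) \<le> sqrt (mass n s + 18 * g\<^sup>2)"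
proof -
  have "0 \<le> sum (sq (low s)) P0" by (intro sum_nonneg) auto
  then show "fro B L (low s) \<le> sqrt (mass n s + 18 * g\<^sup>2)" "fro W B (low s) \<le> sqrt (mass n s + 18 * g\<^sup>2)"
    using mass_pieces zero_le_power2[of "fro B L (low s)"] zero_le_power2[of "fro W B (low s)"]
    by (intro real_le_rsqrt; linarith)+
qed

end

section \<open>Steps of the iteration\<close>

lemma log_fold [simp]:
  "gu (fold (log_rotation ar) gs s) = fold (rot_vec ar) gs (gu s)"
  "gv (fold (log_rotation ar) gs s) = fold (rot_vec ar) gs (gv s)"
  "low (fold (log_rotation ar) gs s) = low s"
  "phase (fold (log_rotation ar) gs s) = phase s"
  "pend (fold (log_rotation ar) gs s) = pend s"
  "length (rlog (fold (log_rotation ar) gs s)) = length (rlog s) + length gs"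
  by (induction gs arbitrary: s) (simp_all add: log_rotation_def Let_def)

lemma rlog_fold_subset: "set (rlog s) \<subseteq> set (rlog (fold (log_rotation ar) gs s))"
proof (induction gs arbitrary: s)
  case (Cons g gs)
  have "set (rlog s) \<subseteq> set (rlog (log_rotation ar g s))" by (auto simp: log_rotation_def Let_def)
  then show ?case using Cons[of "log_rotation ar g s"] by simp
qed simp

lemma rlog_fold_current:
  "(gu s, gv s) \<in> set (rlog s) \<Longrightarrow>
     (gu (fold (log_rotation ar) gs s), gv (fold (log_rotation ar) gs s)) \<in> set (rlog (fold (log_rotation ar) gs s))"
proof (induction gs arbitrary: s)
  case (Cons g gs)
  have "(gu (log_rotation ar g s), gv (log_rotation ar g s)) \<in> set (rlog (log_rotation ar g s))"
    by (simp add: log_rotation_def Let_def)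
  then show ?case using Cons.IH[of "log_rotation ar g s"] by (simp del: log_fold)
qed simp

text \<open>An a priori bound on all logged vectors, the exponent being the number of rotations so
  far. It serves to bound the growth constant in terms of \<open>p\<close> alone.\<close>

definition rlog_bounded :: "nat \<Rightarrow> real \<Rightarrow> real \<Rightarrow> real \<Rightarrow> qr_state \<Rightarrow> bool" where
  "rlog_bounded n q a b s \<longleftrightarrow> (gu s, gv s) \<in> set (rlog s) \<and> (\<forall>(u, v)\<in>set (rlog s).
     vnorm {1..n} u \<le> q ^ (length (rlog s) - 1) * a \<and> vnorm {1..n} v \<le> q ^ (length (rlog s) - 1) * b)"

lemma rlog_bounded_fold:
  assumes m: "standard_model \<epsilon> ar" and e: "0 \<le> \<epsilon>" "\<epsilon> \<le> 1 / 1000"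
    and gs: "list_all2 (near \<epsilon>) gs gs'" "in_block {1..n} gs"
    and s: "rlog_bounded n (1 + 26 * \<epsilon>) a b s" and ab: "0 \<le> a" "0 \<le> b"
  shows "rlog_bounded n (1 + 26 * \<epsilon>) a b (fold (log_rotation ar) gs s)"
  using gs s
proof (induction gs gs' arbitrary: s rule: list_all2_induct)
  case (Cons g gs g' gs')
  let ?q = "1 + 26 * \<epsilon>"
  let ?s = "log_rotation ar g s"
  have iso: "near_iso {1..n} (26 * \<epsilon>) (rot_vec ar g) (rot_vec exact g')"
    using rot_vec_near_iso(1)[OF m e Cons(1), of "{1..n}"] Cons.prems by simp
  have grow: "vnorm {1..n} (rot_vec ar g x) \<le> ?q * vnorm {1..n} x" for x
  proof -
    have "vnorm {1..n} (rot_vec ar g x)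
        \<le> vnorm {1..n} (\<lambda>i. rot_vec ar g x i - rot_vec exact g' x i) + vnorm {1..n} (rot_vec exact g' x)"
      using vnorm_triangle[of "{1..n}" "\<lambda>i. rot_vec ar g x i - rot_vec exact g' x i" "rot_vec exact g' x"] by simp
    also have "\<dots> \<le> 26 * \<epsilon> * vnorm {1..n} x + vnorm {1..n} x"
      using iso unfolding near_iso_def by (intro add_mono) auto
    finally show ?thesis by (simp add: algebra_simps)
  qed
  define l where "l = length (rlog s) - 1"
  have cur: "(gu s, gv s) \<in> set (rlog s)" using Cons.prems by (simp add: rlog_bounded_def)
  then have l: "length (rlog s) = Suc l" by (cases "rlog s") (auto simp: l_def)
  have old: "vnorm {1..n} u \<le> ?q ^ l * a \<and> vnorm {1..n} v \<le> ?q ^ l * b" if "(u, v) \<in> set (rlog s)" for u v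
    using Cons.prems that unfolding rlog_bounded_def l_def by blast
  have q1: "1 \<le> ?q" using e by simp
  have mono: "?q ^ l * c \<le> ?q ^ Suc l * c" if "0 \<le> c" for c
    using that q1 by (intro mult_right_mono power_increasing) auto
  have "vnorm {1..n} (rot_vec ar g (gu s)) \<le> ?q ^ Suc l * a"
    using order_trans[OF grow[of "gu s"] mult_left_mono[of "vnorm {1..n} (gu s)" "?q ^ l * a" ?q]]
      old[OF cur] q1 by (simp add: mult.assoc)
  moreover have "vnorm {1..n} (rot_vec ar g (gv s)) \<le> ?q ^ Suc l * b"
    using order_trans[OF grow[of "gv s"] mult_left_mono[of "vnorm {1..n} (gv s)" "?q ^ l * b" ?q]]
      old[OF cur] q1 by (simp add: mult.assoc)
  moreover have "vnorm {1..n} u \<le> ?q ^ Suc l * a \<and> vnorm {1..n} v \<le> ?q ^ Suc l * b"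
    if "(u, v) \<in> set (rlog s)" for u v
    using old[OF that] mono[OF ab(1)] mono[OF ab(2)] by linarith
  ultimately have "rlog_bounded n ?q a b ?s"
    unfolding rlog_bounded_def log_rotation_def Let_def using l by auto
  then show ?case using Cons.IH[of ?s] Cons.prems by simp
qed simp

lemma similarity_simps [simp]:
  "gu (similarity ar gs s) = fold (rot_vec ar) gs (gu s)"
  "gv (similarity ar gs s) = fold (rot_vec ar) gs (gv s)"
  "phase (similarity ar gs s) = phase s" "pend (similarity ar gs s) = pend s"
  "rlog (similarity ar gs s) = rlog (fold (log_rotation ar) gs s)"
  by (simp_all add: similarity_def Let_def)

lemma low_similarity:
  "j \<le> i \<Longrightarrow> low (similarity ar gs s) i j = fold (rot_right ar) gs (fold (rot_left ar) gs (fl_entry ar s)) i j"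
  by (simp add: similarity_def Let_def)

lemma low_similarity_left:
  assumes "in_block {lo..b} gs" "j < lo" "i \<in> {lo..b}"
  shows "low (similarity ar gs s) i j = fold (rot_vec ar) gs (\<lambda>i. low s i j) i"
proof -
  have j: "j \<notin> {lo..b}" "j \<le> i" using assms by auto
  have "low (similarity ar gs s) i j = fold (rot_vec ar) gs (\<lambda>i. fl_entry ar s i j) i"
    unfolding low_similarity[OF j(2)] fold_rot_right row_vec_outside[OF assms(1) j(1)]
    using fun_cong[OF fold_rot_left[of ar gs "fl_entry ar s" j], of i] by simp
  also have "\<dots> = fold (rot_vec ar) gs (\<lambda>i. low s i j) i"
    by (rule rot_vec_local[OF assms(1) _ assms(3)]) (use assms(2) in \<open>auto simp: fl_entry_def\<close>)
  finally show ?thesis .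
qed

lemma fold_rot_left_outside:
  assumes "in_block B gs" "i \<notin> B"
  shows "fold (rot_left ar) gs Y i = Y i"
proof
  fix j
  show "fold (rot_left ar) gs Y i j = Y i j"
    using fun_cong[OF fold_rot_left[of ar gs Y j], of i] rot_vec_outside[OF assms] by simp
qed

lemma low_similarity_below:
  assumes "in_block {lo..b} gs" "b < i" "j \<in> {lo..b}"
  shows "low (similarity ar gs s) i j = fold (row_vec ar) gs (low s i) j"
proof -
  have i: "i \<notin> {lo..b}" "j \<le> i" using assms by auto
  have "low (similarity ar gs s) i j = fold (row_vec ar) gs (fl_entry ar s i) j"
    unfolding low_similarity[OF i(2)] fold_rot_right fold_rot_left_outside[OF assms(1) i(1)] ..
  also have "\<dots> = fold (row_vec ar) gs (low s i) j"
    by (rule row_vec_local[OF assms(1) _ assms(3)]) (use assms(2) in \<open>auto simp: fl_entry_def\<close>)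
  finally show ?thesis .
qed

lemma low_similarity_else:
  assumes "in_block B gs" "i \<notin> B" "j \<notin> B" "j \<le> i"
  shows "low (similarity ar gs s) i j = low s i j"
  unfolding low_similarity[OF assms(4)] fold_rot_right fold_rot_left_outside[OF assms(1,2)]
    row_vec_outside[OF assms(1,3)] using assms(4) by (simp add: fl_entry_def)

text \<open>A similarity by rotations in the rows \<open>lo..lo + k\<close>, up to errors as in \<open>block_step\<close>: for a
  column that is annihilated, replacing the computed entries by the computed norm and zeros
  introduces an error of the same kind.\<close>

definition rotation_step :: "nat \<Rightarrow> nat \<Rightarrow> real \<Rightarrow> fparith \<Rightarrow> qr_state \<Rightarrow> qr_state \<Rightarrow> bool" where
  "rotation_step n j \<epsilon> ar s s' \<longleftrightarrow> (\<exists>gs gs' lo k.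
     list_all2 (near \<epsilon>) gs gs' \<and> length gs = k \<and> 1 \<le> k \<and> k \<le> j \<and> k \<le> 2 \<and>
     1 \<le> lo \<and> lo + k \<le> n \<and> in_block {lo..lo + k} gs \<and>
     gu s' = fold (rot_vec ar) gs (gu s) \<and> gv s' = fold (rot_vec ar) gs (gv s) \<and>
     rlog s' = rlog (fold (log_rotation ar) gs s) \<and>
     (\<forall>i\<in>{lo..lo + k}. \<forall>j\<in>{lo..lo + k}. j \<le> i \<longrightarrow>
        low s' i j = fold (rot_right ar) gs (fold (rot_left ar) gs (fl_entry ar s)) i j) \<and>
     (\<forall>j. 1 \<le> j \<and> j < lo \<longrightarrow>
        vnorm {lo..lo + k} (\<lambda>i. low s' i j - fold (rot_vec exact) gs' (\<lambda>i. low s i j) i)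
          \<le> 60 * \<epsilon> * vnorm {lo..lo + k} (\<lambda>i. low s i j)) \<and>
     (\<forall>i. lo + k < i \<and> i \<le> n \<longrightarrow>
        vnorm {lo..lo + k} (\<lambda>j. low s' i j - fold (row_vec exact) gs' (low s i) j)
          \<le> 60 * \<epsilon> * vnorm {lo..lo + k} (low s i)) \<and>
     (\<forall>i j. 1 \<le> j \<and> j \<le> i \<and> i \<le> n \<and> i \<notin> {lo..lo + k} \<and> j \<notin> {lo..lo + k} \<longrightarrow>
        low s' i j = low s i j))"

lemma rotation_stepI:
  assumes "list_all2 (near \<epsilon>) gs gs'" "length gs = k" "k = 1 \<or> k = 2" "k \<le> j" "1 \<le> lo" "lo + k \<le> n"
    "in_block {lo..lo + k} gs"
    "gu s' = fold (rot_vec ar) gs (gu s)" "gv s' = fold (rot_vec ar) gs (gv s)"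
    "rlog s' = rlog (fold (log_rotation ar) gs s)"
    "\<And>i j. i \<in> {lo..lo + k} \<Longrightarrow> j \<in> {lo..lo + k} \<Longrightarrow> j \<le> i \<Longrightarrow>
        low s' i j = fold (rot_right ar) gs (fold (rot_left ar) gs (fl_entry ar s)) i j"
    "\<And>j. j < lo \<Longrightarrow>
        vnorm {lo..lo + k} (\<lambda>i. low s' i j - fold (rot_vec exact) gs' (\<lambda>i. low s i j) i)
          \<le> 60 * \<epsilon> * vnorm {lo..lo + k} (\<lambda>i. low s i j)"
    "\<And>i. lo + k < i \<Longrightarrow>
        vnorm {lo..lo + k} (\<lambda>j. low s' i j - fold (row_vec exact) gs' (low s i) j)
          \<le> 60 * \<epsilon> * vnorm {lo..lo + k} (low s i)"
    "\<And>i j. j \<le> i \<Longrightarrow> i \<notin> {lo..lo + k} \<Longrightarrow> j \<notin> {lo..lo + k} \<Longrightarrow> low s' i j = low s i j"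
  shows "rotation_step n j \<epsilon> ar s s'"
proof -
  have "1 \<le> k" "k \<le> 2" using assms(3) by auto
  show ?thesis
    unfolding rotation_step_def
  proof (rule exI[of _ gs], rule exI[of _ gs'], rule exI[of _ lo], rule exI[of _ k], intro conjI)
    show "\<forall>i\<in>{lo..lo + k}. \<forall>j\<in>{lo..lo + k}. j \<le> i \<longrightarrow>
        low s' i j = fold (rot_right ar) gs (fold (rot_left ar) gs (fl_entry ar s)) i j"
      by (intro ballI impI assms(11))
    show "\<forall>j. 1 \<le> j \<and> j < lo \<longrightarrow>
        vnorm {lo..lo + k} (\<lambda>i. low s' i j - fold (rot_vec exact) gs' (\<lambda>i. low s i j) i)
          \<le> 60 * \<epsilon> * vnorm {lo..lo + k} (\<lambda>i. low s i j)"
      by (intro allI impI, elim conjE) (rule assms(12))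
    show "\<forall>i. lo + k < i \<and> i \<le> n \<longrightarrow>
        vnorm {lo..lo + k} (\<lambda>j. low s' i j - fold (row_vec exact) gs' (low s i) j)
          \<le> 60 * \<epsilon> * vnorm {lo..lo + k} (low s i)"
      by (intro allI impI, elim conjE) (rule assms(13))
    show "\<forall>i j. 1 \<le> j \<and> j \<le> i \<and> i \<le> n \<and> i \<notin> {lo..lo + k} \<and> j \<notin> {lo..lo + k} \<longrightarrow>
        low s' i j = low s i j"
      by (intro allI impI, elim conjE) (rule assms(14))
  qed fact+
qed

lemma rotation_step_update [simp]:
  "rotation_step n j \<epsilon> ar s (s'\<lparr>pend := p\<rparr>) = rotation_step n j \<epsilon> ar s s'"
  "rotation_step n j \<epsilon> ar s (s'\<lparr>phase := q\<rparr>) = rotation_step n j \<epsilon> ar s s'"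
  by (simp_all add: rotation_step_def)

lemma similarity_rotation_step:
  assumes m: "standard_model \<epsilon> ar" and e: "0 \<le> \<epsilon>" "\<epsilon> \<le> 1 / 1000"
    and k: "k = 1 \<or> k = 2" "k \<le> j" "1 \<le> lo" "lo + k \<le> n"
  shows "rotation_step n j \<epsilon> ar s (similarity ar (fst (rotations_for ar k lo x)) s)"
proof -
  obtain gs r where gr: "rotations_for ar k lo x = (gs, r)" by (cases "rotations_for ar k lo x")
  obtain gs' where gs: "list_all2 (near \<epsilon>) gs gs'" "length gs = k"
    and ix: "\<And>g. g \<in> set gs \<Longrightarrow> lo \<le> fst g \<and> fst g < lo + k"
    and "vnorm {lo..lo + k} (\<lambda>l. (if l = lo then r else 0) - fold (rot_vec exact) gs' x l)
       \<le> 60 * \<epsilon> * vnorm {lo..lo + k} x"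
    by (rule rotations_for_near[OF m e k(1) gr]) (rule that; blast)
  have blk: "in_block {lo..lo + k} gs" using ix by (fastforce simp: in_block_def)
  let ?B = "{lo..lo + k}"
  let ?s = "similarity ar gs s"
  have "length gs \<le> 2" using gs k by auto
  then have iso: "near_iso ?B (60 * \<epsilon>) (fold (rot_vec ar) gs) (fold (rot_vec exact) gs')"
      "near_iso ?B (60 * \<epsilon>) (fold (row_vec ar) gs) (fold (row_vec exact) gs')"
    using near_iso_rotations[OF m e gs(1), of ?B] blk by (auto simp: in_block_def)
  have l: "vnorm ?B (\<lambda>i. low ?s i j - fold (rot_vec exact) gs' (\<lambda>i. low s i j) i)
      \<le> 60 * \<epsilon> * vnorm ?B (\<lambda>i. low s i j)" if "j < lo" for j
  proof -
    have "vnorm ?B (\<lambda>i. low ?s i j - fold (rot_vec exact) gs' (\<lambda>i. low s i j) i)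
        = vnorm ?B (\<lambda>i. fold (rot_vec ar) gs (\<lambda>i. low s i j) i - fold (rot_vec exact) gs' (\<lambda>i. low s i j) i)"
      by (intro vnorm_cong) (simp add: low_similarity_left[OF blk that])
    then show ?thesis using iso(1) by (simp add: near_iso_def)
  qed
  have w: "vnorm ?B (\<lambda>j. low ?s i j - fold (row_vec exact) gs' (low s i) j) \<le> 60 * \<epsilon> * vnorm ?B (low s i)"
    if "lo + k < i" for i
  proof -
    have "vnorm ?B (\<lambda>j. low ?s i j - fold (row_vec exact) gs' (low s i) j)
        = vnorm ?B (\<lambda>j. fold (row_vec ar) gs (low s i) j - fold (row_vec exact) gs' (low s i) j)"
      by (intro vnorm_cong) (simp add: low_similarity_below[OF blk that])
    then show ?thesis using iso(2) by (simp add: near_iso_def)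
  qed
  show ?thesis
    unfolding gr fst_conv
    by (rule rotation_stepI[OF gs k blk similarity_simps(1,2,5) low_similarity l w low_similarity_else[OF blk]])
qed

lemma eliminate_simps [simp]:
  "phase (eliminate ar m i c s) = phase s" "pend (eliminate ar m i c s) = pend s"
  by (simp_all add: eliminate_def Let_def case_prod_beta)

lemma eliminate_rotation_step:
  assumes m: "standard_model \<epsilon> ar" and e: "0 \<le> \<epsilon>" "\<epsilon> \<le> 1 / 1000"
    and k: "k = 1 \<or> k = 2" "k \<le> j" "1 \<le> lo" "lo + k \<le> n" and c: "c < lo"
  shows "rotation_step n j \<epsilon> ar s (eliminate ar k lo c s)"
proof -
  obtain gs r where gr: "rotations_for ar k lo (\<lambda>i. low s i c) = (gs, r)"
    by (cases "rotations_for ar k lo (\<lambda>i. low s i c)")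
  obtain gs' where gs: "list_all2 (near \<epsilon>) gs gs'" "length gs = k"
    and ix: "\<And>g. g \<in> set gs \<Longrightarrow> lo \<le> fst g \<and> fst g < lo + k"
    and col: "vnorm {lo..lo + k} (\<lambda>l. (if l = lo then r else 0) - fold (rot_vec exact) gs' (\<lambda>i. low s i c) l)
       \<le> 60 * \<epsilon> * vnorm {lo..lo + k} (\<lambda>i. low s i c)"
    by (rule rotations_for_near[OF m e k(1) gr]) (rule that; blast)
  have blk: "in_block {lo..lo + k} gs" using ix by (fastforce simp: in_block_def)
  let ?B = "{lo..lo + k}"
  let ?t = "similarity ar gs s"
  let ?s = "eliminate ar k lo c s"
  have ls: "low ?s = (\<lambda>a b. if b = c \<and> a = lo then r else if b = c \<and> lo < a \<and> a \<le> lo + k then 0 else low ?t a b)"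
    and us: "gu ?s = gu ?t" "gv ?s = gv ?t" "rlog ?s = rlog ?t"
    by (simp_all add: eliminate_def gr Let_def)
  have ls_c: "low ?s i c = (if i = lo then r else 0)" if "i \<in> ?B" for i using that by (auto simp: ls)
  have ls_o: "low ?s i j = low ?t i j" if "j \<noteq> c \<or> i \<notin> ?B" for i j using that by (auto simp: ls)
  have "length gs \<le> 2" using gs k by auto
  then have iso: "near_iso ?B (60 * \<epsilon>) (fold (rot_vec ar) gs) (fold (rot_vec exact) gs')"
      "near_iso ?B (60 * \<epsilon>) (fold (row_vec ar) gs) (fold (row_vec exact) gs')"
    using near_iso_rotations[OF m e gs(1), of ?B] blk by (auto simp: in_block_def)
  have l: "vnorm ?B (\<lambda>i. low ?s i j - fold (rot_vec exact) gs' (\<lambda>i. low s i j) i)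
      \<le> 60 * \<epsilon> * vnorm ?B (\<lambda>i. low s i j)" if "j < lo" for j
  proof (cases "j = c")
    case True
    have "vnorm ?B (\<lambda>i. low ?s i j - fold (rot_vec exact) gs' (\<lambda>i. low s i j) i)
        = vnorm ?B (\<lambda>l. (if l = lo then r else 0) - fold (rot_vec exact) gs' (\<lambda>i. low s i c) l)"
      using True by (intro vnorm_cong) (simp add: ls_c)
    then show ?thesis using col True by simp
  next
    case False
    have "vnorm ?B (\<lambda>i. low ?s i j - fold (rot_vec exact) gs' (\<lambda>i. low s i j) i)
        = vnorm ?B (\<lambda>i. fold (rot_vec ar) gs (\<lambda>i. low s i j) i - fold (rot_vec exact) gs' (\<lambda>i. low s i j) i)"
      using False by (intro vnorm_cong) (simp add: ls_o low_similarity_left[OF blk that])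
    then show ?thesis using iso(1) by (simp add: near_iso_def)
  qed
  have w: "vnorm ?B (\<lambda>j. low ?s i j - fold (row_vec exact) gs' (low s i) j) \<le> 60 * \<epsilon> * vnorm ?B (low s i)"
    if "lo + k < i" for i
  proof -
    have "vnorm ?B (\<lambda>j. low ?s i j - fold (row_vec exact) gs' (low s i) j)
        = vnorm ?B (\<lambda>j. fold (row_vec ar) gs (low s i) j - fold (row_vec exact) gs' (low s i) j)"
      using that by (intro vnorm_cong) (simp add: ls_o low_similarity_below[OF blk that])
    then show ?thesis using iso(2) by (simp add: near_iso_def)
  qed
  have b: "low ?s i j = fold (rot_right ar) gs (fold (rot_left ar) gs (fl_entry ar s)) i j"
    if "i \<in> ?B" "j \<in> ?B" "j \<le> i" for i j
  proof -
    have "j \<noteq> c" using that c by auto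
    then show ?thesis using that by (simp add: ls_o low_similarity)
  qed
  have o: "low ?s i j = low s i j" if "j \<le> i" "i \<notin> ?B" "j \<notin> ?B" for i j
    using that ls_o[of j i] low_similarity_else[OF blk that(2,3,1)] by simp
  show ?thesis
    by (rule rotation_stepI[OF gs k blk _ _ _ b l w o]) (simp_all add: us)
qed

text \<open>Covers single deflations, the deflation of a whole piece of the spike and, with empty
  \<open>Z\<close>, mere changes of phase.\<close>

definition zero_step :: "nat \<Rightarrow> real \<Rightarrow> qr_state \<Rightarrow> qr_state \<Rightarrow> bool" where
  "zero_step n \<epsilon> s s' \<longleftrightarrow> gu s' = gu s \<and> gv s' = gv s \<and> rlog s' = rlog s \<and>
     (\<exists>Z. (\<forall>(r, c)\<in>Z. 1 \<le> c \<and> c < r \<and> r \<le> n \<and>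
             cmod (low s r c) \<le> \<epsilon> * (cmod (low s r r) + cmod (low s c c))) \<and>
          low s' = (\<lambda>r c. if (r, c) \<in> Z then 0 else low s r c))"

lemma zero_step_same: "zero_step n \<epsilon> s (s\<lparr>phase := q\<rparr>)"
  unfolding zero_step_def by (auto intro!: exI[of _ "{}"])

text \<open>Keeps every rotation inside the rows 1..n, with the annihilated column strictly to the
  left of them and at least 1.\<close>

definition indices_ok :: "nat \<Rightarrow> qr_state \<Rightarrow> bool" where
  "indices_ok n s \<longleftrightarrow>
     (case phase s of Main \<Rightarrow> True | Window w h \<beta> \<Rightarrow> 2 \<le> w \<and> h \<le> n
        | Reduce w e m \<Rightarrow> 2 \<le> w \<and> e \<le> n \<and> m \<le> e) \<and>
     (\<forall>(i, hi)\<in>pend s. 2 \<le> i \<and> i < hi \<and> hi \<le> n)"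

text \<open>Reduces all rules to two kinds, rotations of at most three consecutive rows and
  replacing negligible entries by zero; the error analysis is thereby uniform in shifts, schedule
  and deflation strategy.\<close>

lemma qr_step_cases:
  assumes st: "qr_step n j \<epsilon> ar s s'" and ok: "indices_ok n s" and j: "j = 1 \<or> j = 2"
    and m: "standard_model \<epsilon> ar" and e: "0 \<le> \<epsilon>" "\<epsilon> \<le> 1 / 1000"
  shows "indices_ok n s' \<and> (rotation_step n j \<epsilon> ar s s' \<or> zero_step n \<epsilon> s s')"
  using st
proof cases
  case (sweep lo hi t \<sigma>)
  have hi: "1 \<le> lo" "hi \<le> n"
    using sweep(2,3) ok by (auto simp: split_block_def indices_ok_def)
  then have "rotation_step n j \<epsilon> ar s t"
    unfolding sweep(6) using sweep(4) j by (intro similarity_rotation_step[OF m e]) auto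
  moreover have "indices_ok n s'"
    using ok hi sweep by (auto simp: indices_ok_def bulge_def)
  ultimately show ?thesis using sweep(1) by simp
next
  case (chase i hi t)
  have i: "2 \<le> i" "i < hi" "hi \<le> n" using ok chase(2) by (auto simp: indices_ok_def)
  have "rotation_step n j \<epsilon> ar s t"
    unfolding chase(4) using i j by (intro eliminate_rotation_step[OF m e]) auto
  moreover have "indices_ok n s'"
    using ok i chase by (auto simp: indices_ok_def bulge_def)
  ultimately show ?thesis using chase(1) by simp
next
  case (deflate a b i)
  have i: "1 \<le> i" "i < n" using deflate(2-5) ok by (auto simp: indices_ok_def)
  have "zero_step n \<epsilon> s s'"
    unfolding zero_step_def deflate(1)
    using i deflate(7) by (auto intro!: exI[of _ "{(i + 1, i)}"] simp: fun_eq_iff add.commute)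
  moreover have "indices_ok n s'" using ok by (simp add: deflate(1) indices_ok_def)
  ultimately show ?thesis by simp
next
  case (aed_open w h)
  have "indices_ok n s'" using ok aed_open by (auto simp: indices_ok_def)
  then show ?thesis using aed_open(1) zero_step_same by simp
next
  case (aed_deflate w h \<beta> e)
  have w: "2 \<le> w" "h \<le> n" using ok aed_deflate(2) by (auto simp: indices_ok_def)
  have "zero_step n \<epsilon> s s'"
    unfolding zero_step_def
  proof (intro conjI exI[of _ "{(r, c). c = w - 1 \<and> e < r \<and> r \<le> h}"])
    show "\<forall>(r, c)\<in>{(r, c). c = w - 1 \<and> e < r \<and> r \<le> h}. 1 \<le> c \<and> c < r \<and> r \<le> n \<and>
        cmod (low s r c) \<le> \<epsilon> * (cmod (low s r r) + cmod (low s c c))"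
    proof clarify
      fix r assume r: "e < r" "r \<le> h"
      have "cmod (low s r (w - 1)) \<le> \<epsilon> * min (cmod \<beta>) (cmod (low s r r))" using aed_deflate r by blast
      \<comment> \<open>The minimum is at most the diagonal entry of row \<open>r\<close>, so the
        spike criterion implies the ordinary deflation criterion.\<close>
      also have "\<dots> \<le> \<epsilon> * (cmod (low s r r) + cmod (low s (w - 1) (w - 1)))"
        using \<open>0 \<le> \<epsilon>\<close> by (intro mult_left_mono) (auto simp: min_le_iff_disj)
      finally show "1 \<le> w - 1 \<and> w - 1 < r \<and> r \<le> n \<and>
          cmod (low s r (w - 1)) \<le> \<epsilon> * (cmod (low s r r) + cmod (low s (w - 1) (w - 1)))"
        using w r aed_deflate(5) by auto
    qed
  qed (simp_all add: aed_deflate(1) fun_eq_iff)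
  moreover have "indices_ok n s'" using ok w aed_deflate by (auto simp: indices_ok_def)
  ultimately show ?thesis by simp
next
  case (aed_spike w e' m' t)
  have w: "2 \<le> w" "e' \<le> n" "m' \<le> e'" using ok aed_spike(2) by (auto simp: indices_ok_def)
  have "rotation_step n j \<epsilon> ar s t"
    unfolding aed_spike(6) using w aed_spike(4) j by (intro eliminate_rotation_step[OF m e]) auto
  moreover have "indices_ok n s'"
    using ok w aed_spike by (auto simp: indices_ok_def bulge_def)
  ultimately show ?thesis using aed_spike(1) by simp
next
  case (aed_spike_pair w e' m' t)
  have w: "2 \<le> w" "e' \<le> n" "m' \<le> e'" using ok aed_spike_pair(2) by (auto simp: indices_ok_def)
  have "rotation_step n j \<epsilon> ar s t"
    unfolding aed_spike_pair(7) using w aed_spike_pair(4,5) by (intro eliminate_rotation_step[OF m e]) auto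
  moreover have "indices_ok n s'"
    using ok w aed_spike_pair by (auto simp: indices_ok_def bulge_def)
  ultimately show ?thesis using aed_spike_pair(1) by simp
next
  case (aed_close w e' m')
  have "indices_ok n s'" using ok aed_close by (auto simp: indices_ok_def)
  then show ?thesis using aed_close(1) zero_step_same by simp
qed

section \<open>The invariant of a run and its preservation\<close>

definition window_le :: "nat \<Rightarrow> nat \<Rightarrow> real \<Rightarrow> qr_state \<Rightarrow> bool" where
  "window_le n j g s \<longleftrightarrow> (\<forall>(u, v)\<in>set (rlog s). \<forall>k m. 1 \<le> k \<longrightarrow> m \<le> j \<longrightarrow> k + m \<le> n \<longrightarrow>
     vnorm {k..k + m} u * vnorm {k..k + m} v \<le> g)"

definition nnz :: "nat \<Rightarrow> qr_state \<Rightarrow> nat" where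
  "nnz n s = card {(r, c). 1 \<le> c \<and> c < r \<and> r \<le> n \<and> low s r c \<noteq> 0}"

text \<open>Errors are kept in the coordinates of the initial matrix; in use \<open>Q\<close> is the
  product of all exact rotations. Those of u and v stay separate from \<open>E\<close> and relative:
  merged into \<open>E\<close> they would bring in the product of the full norms.\<close>

definition backward ::
  "nat \<Rightarrow> (nat \<Rightarrow> nat \<Rightarrow> complex) \<Rightarrow> (nat \<Rightarrow> complex) \<Rightarrow> (nat \<Rightarrow> complex) \<Rightarrow> qr_state \<Rightarrow> real \<Rightarrow> real \<Rightarrow> bool"
  where
  "backward n F u v s \<eta> \<mu> \<longleftrightarrow> (\<exists>Q E u' v'. unitary n Q \<and>
     (\<forall>i\<in>{1..n}. \<forall>j\<in>{1..n}. fgen s i j = mmul n (ctrans Q) (mmul n (\<lambda>i j. F i j + E i j) Q) i j) \<and>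
     (\<forall>i\<in>{1..n}. gu s i = mvec n (ctrans Q) u' i \<and> gv s i = mvec n (ctrans Q) v' i) \<and>
     op_le n E \<eta> \<and>
     vnorm {1..n} (\<lambda>i. u' i - u i) \<le> \<mu> * vnorm {1..n} u \<and>
     vnorm {1..n} (\<lambda>i. v' i - v i) \<le> \<mu> * vnorm {1..n} v)"

text \<open>The new error \<open>D\<close> is transported back by \<open>mmul n Q U\<close> and
  added to \<open>E\<close>. For the vectors, \<mu> \<le> 1 gives \<parallel>x\<parallel> \<le> 2
  \<parallel>u\<parallel>, so a relative error \<tau> of the current vector costs 2 \<tau> relative
  to the initial one.\<close>

lemma backward_step:
  assumes s: "backward n F u v s \<eta> \<mu>" and U: "unitary n U"
    and F': "\<And>i j. i \<in> {1..n} \<Longrightarrow> j \<in> {1..n} \<Longrightarrow>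
      fgen s' i j = mmul n (ctrans U) (mmul n (fgen s) U) i j + D i j"
    and D: "op_le n D \<delta>"
    and u': "vnorm {1..n} (\<lambda>i. gu s' i - mvec n (ctrans U) (gu s) i) \<le> \<tau> * vnorm {1..n} (gu s)"
    and v': "vnorm {1..n} (\<lambda>i. gv s' i - mvec n (ctrans U) (gv s) i) \<le> \<tau> * vnorm {1..n} (gv s)"
    and UQ: "\<And>Q. unitary n Q \<Longrightarrow> unitary n (mmul n Q U)"
    and \<mu>: "\<mu> \<le> 1" and \<tau>: "0 \<le> \<tau>"
  shows "backward n F u v s' (\<eta> + \<delta>) (\<mu> + 2 * \<tau>)"
proof -
  obtain Q E x y where Q: "unitary n Q"
    and F: "\<And>i j. i \<in> {1..n} \<Longrightarrow> j \<in> {1..n} \<Longrightarrow>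
      fgen s i j = mmul n (ctrans Q) (mmul n (\<lambda>i j. F i j + E i j) Q) i j"
    and xy: "\<And>i. i \<in> {1..n} \<Longrightarrow> gu s i = mvec n (ctrans Q) x i"
      "\<And>i. i \<in> {1..n} \<Longrightarrow> gv s i = mvec n (ctrans Q) y i"
    and E: "op_le n E \<eta>"
    and x: "vnorm {1..n} (\<lambda>i. x i - u i) \<le> \<mu> * vnorm {1..n} u"
    and y: "vnorm {1..n} (\<lambda>i. y i - v i) \<le> \<mu> * vnorm {1..n} v"
    using s unfolding backward_def by blast
  let ?Q = "mmul n Q U"
  have Q': "unitary n ?Q" by (rule UQ[OF Q])
  define D' where "D' = mmul n ?Q (mmul n D (ctrans ?Q))"
  have D'_le: "op_le n D' \<delta>"
    using op_le_conj[OF D unitary_ctrans[OF Q']] by (simp add: D'_def)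
  have F'_eq: "fgen s' i j = mmul n (ctrans ?Q) (mmul n (\<lambda>i j. F i j + (E i j + D' i j)) ?Q) i j"
    if ij: "i \<in> {1..n}" "j \<in> {1..n}" for i j
  proof -
    let ?G = "\<lambda>i j. F i j + E i j"
    have "mmul n (ctrans U) (mmul n (fgen s) U) i j
        = mmul n (ctrans U) (mmul n (mmul n (ctrans Q) (mmul n ?G Q)) U) i j"
      by (intro mmul_cong) (auto simp: F)
    also have "\<dots> = mmul n (ctrans ?Q) (mmul n ?G ?Q) i j" by (simp add: mmul_assoc ctrans_mmul)
    finally have 1: "mmul n (ctrans U) (mmul n (fgen s) U) i j = mmul n (ctrans ?Q) (mmul n ?G ?Q) i j" .
    have 2: "D i j = mmul n (ctrans ?Q) (mmul n D' ?Q) i j"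
      using unitary_cancel[OF Q' ij, of D] by (simp add: D'_def)
    have "fgen s' i j = mmul n (ctrans ?Q) (mmul n (\<lambda>i j. ?G i j + D' i j) ?Q) i j"
      unfolding F'[OF ij] 1 2 mmul_add_left mmul_add_right ..
    then show ?thesis by (simp add: add.assoc)
  qed
  have vec: "\<exists>x'. (\<forall>i\<in>{1..n}. w' i = mvec n (ctrans ?Q) x' i) \<and> vnorm {1..n} (\<lambda>i. x' i - u i) \<le> (\<mu> + 2 * \<tau>) * vnorm {1..n} u"
    if w: "\<And>i. i \<in> {1..n} \<Longrightarrow> w i = mvec n (ctrans Q) x i"
      and x: "vnorm {1..n} (\<lambda>i. x i - u i) \<le> \<mu> * vnorm {1..n} u"
      and w': "vnorm {1..n} (\<lambda>i. w' i - mvec n (ctrans U) w i) \<le> \<tau> * vnorm {1..n} w" for w w' x u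
  proof -
    define d where "d i = w' i - mvec n (ctrans U) w i" for i
    define x' where "x' i = x i + mvec n ?Q d i" for i
    have "w' i = mvec n (ctrans ?Q) x' i" if i: "i \<in> {1..n}" for i
    proof -
      have "mvec n (ctrans ?Q) x' i = mvec n (ctrans ?Q) x i + mvec n (ctrans ?Q) (mvec n ?Q d) i"
        by (simp add: x'_def mvec_def distrib_left sum.distrib)
      also have "mvec n (ctrans ?Q) (mvec n ?Q d) i = d i" by (rule unitary_cancel_vec[OF Q' i])
      also have "mvec n (ctrans ?Q) x i = mvec n (ctrans U) (mvec n (ctrans Q) x) i"
        by (simp add: ctrans_mmul mvec_mmul)
      also have "\<dots> = mvec n (ctrans U) w i" by (rule mvec_cong_vec) (simp add: w)
      finally show ?thesis by (simp add: d_def)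
    qed
    moreover have "vnorm {1..n} (\<lambda>i. x' i - u i) \<le> (\<mu> + 2 * \<tau>) * vnorm {1..n} u"
    proof -
      have "vnorm {1..n} w = vnorm {1..n} (mvec n (ctrans Q) x)" by (rule vnorm_cong) (simp add: w)
      then have nw: "vnorm {1..n} w = vnorm {1..n} x" using vnorm_unitary[OF unitary_ctrans[OF Q]] by simp
      have "vnorm {1..n} x \<le> vnorm {1..n} (\<lambda>i. x i - u i) + vnorm {1..n} u"
        using vnorm_triangle[of "{1..n}" "\<lambda>i. x i - u i" u] by simp
      also have "\<dots> \<le> 2 * vnorm {1..n} u"
        using x \<mu> mult_right_mono[of \<mu> 1 "vnorm {1..n} u"] by simp
      finally have nx: "vnorm {1..n} x \<le> 2 * vnorm {1..n} u" .
      have "vnorm {1..n} (\<lambda>i. x' i - u i) \<le> vnorm {1..n} (\<lambda>i. x i - u i) + vnorm {1..n} (mvec n ?Q d)"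
        using vnorm_triangle[of "{1..n}" "\<lambda>i. x i - u i" "mvec n ?Q d"] by (simp add: x'_def algebra_simps)
      also have "vnorm {1..n} (mvec n ?Q d) = vnorm {1..n} d" by (rule vnorm_unitary[OF Q'])
      also have "\<dots> \<le> \<tau> * vnorm {1..n} x" using w' nw by (simp add: d_def[abs_def])
      also have "\<dots> \<le> \<tau> * (2 * vnorm {1..n} u)" using nx \<tau> by (intro mult_left_mono)
      finally show ?thesis using x by (simp add: algebra_simps)
    qed
    ultimately show ?thesis by blast
  qed
  obtain x' where x': "\<forall>i\<in>{1..n}. gu s' i = mvec n (ctrans ?Q) x' i"
    "vnorm {1..n} (\<lambda>i. x' i - u i) \<le> (\<mu> + 2 * \<tau>) * vnorm {1..n} u"
    using vec[OF xy(1) x u'] by blast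
  obtain y' where y': "\<forall>i\<in>{1..n}. gv s' i = mvec n (ctrans ?Q) y' i"
    "vnorm {1..n} (\<lambda>i. y' i - v i) \<le> (\<mu> + 2 * \<tau>) * vnorm {1..n} v"
    using vec[OF xy(2) y v'] by blast
  show ?thesis
    unfolding backward_def
  proof (rule exI[of _ ?Q], rule exI[of _ "\<lambda>i j. E i j + D' i j"], rule exI[of _ x'], rule exI[of _ y'], intro conjI)
    show "\<forall>i\<in>{1..n}. \<forall>j\<in>{1..n}. fgen s' i j
        = mmul n (ctrans ?Q) (mmul n (\<lambda>i j. F i j + (E i j + D' i j)) ?Q) i j"
      using F'_eq by blast
    show "op_le n (\<lambda>i j. E i j + D' i j) (\<eta> + \<delta>)" by (rule op_le_add[OF E D'_le])
  qed (use Q' x' y' in auto)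
qed

text \<open>Closes the loop between steps: while the accumulated error is at most 1, the norm bound
  needed by the next step holds.\<close>

lemma backward_op_le:
  assumes "backward n F u v s \<eta> \<mu>" "op_le n F 1" "\<eta> \<le> 1"
  shows "op_le n (fgen s) 2"
proof -
  obtain Q E where Q: "unitary n Q" "op_le n E \<eta>"
    and F: "\<And>i j. i \<in> {1..n} \<Longrightarrow> j \<in> {1..n} \<Longrightarrow>
      fgen s i j = mmul n (ctrans Q) (mmul n (\<lambda>i j. F i j + E i j) Q) i j"
    using assms(1) unfolding backward_def by blast
  have "op_le n (\<lambda>i j. F i j + E i j) 2"
    using op_le_mono[OF op_le_add[OF assms(2) Q(2)]] assms(3) by simp
  from op_le_conj[OF this Q(1)] show ?thesis using F by (intro op_le_cong[of n _ "fgen s" 2]) auto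
qed

lemma low_le:
  assumes F2: "op_le n (fgen s) 2" and w: "window_le n j g s" and cur: "(gu s, gv s) \<in> set (rlog s)"
    and g: "1 \<le> g" and j: "1 \<le> j" and n: "2 \<le> n" and rc: "1 \<le> c" "c \<le> r" "r \<le> c + 1" "r \<le> n"
  shows "cmod (low s r c) \<le> 3 * g"
proof -
  \<comment> \<open>A window of two indices containing \<open>c\<close> and \<open>r\<close>; at c =
    n it is moved back by one to remain inside 1..n.\<close>
  define k where "k = (if c < n then c else c - 1)"
  have k: "1 \<le> k" "k + 1 \<le> n" "c \<in> {k..k + 1}" "r \<in> {k..k + 1}" using rc n by (auto simp: k_def)
  have "vnorm {k..k + 1} (gu s) * vnorm {k..k + 1} (gv s) \<le> g"
    using w cur k j unfolding window_le_def by blast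
  moreover have "cmod (gu s r) * cmod (gv s c) \<le> vnorm {k..k + 1} (gu s) * vnorm {k..k + 1} (gv s)"
    by (rule mult_mono[OF cmod_le_vnorm cmod_le_vnorm]) (use k in auto)
  moreover have "cmod (fgen s r c) \<le> 2" using op_le_entry[OF F2] rc by simp
  moreover have "low s r c = fgen s r c + gu s r * cnj (gv s c)" using rc by (simp add: fgen_low)
  then have "cmod (low s r c) \<le> cmod (fgen s r c) + cmod (gu s r) * cmod (gv s c)"
    by (metis norm_triangle_ineq norm_mult complex_mod_cnj)
  ultimately show ?thesis using g by linarith
qed

lemma nnz_le: "nnz n s \<le> n\<^sup>2"
proof -
  have "{(r, c). 1 \<le> c \<and> c < r \<and> r \<le> n \<and> low s r c \<noteq> 0} \<subseteq> {1..n} \<times> {1..n}" by auto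
  from card_mono[OF _ this] show ?thesis by (simp add: nnz_def power2_eq_square)
qed

text \<open>Since deflations are not counted as rotations, their contribution to the backward error is
  charged to the entries below the diagonal that are still nonzero.\<close>

definition eta_bound :: "nat \<Rightarrow> real \<Rightarrow> real \<Rightarrow> real \<Rightarrow> qr_state \<Rightarrow> real" where
  "eta_bound n N \<epsilon> g s = real (num_rotations s) * (40000 * (\<epsilon> * g * (N + 1)) + 12 * (\<epsilon> * g * real (n\<^sup>2)))
     + 12 * (\<epsilon> * g * (real (n\<^sup>2) - real (nnz n s)))"

text \<open>Three quantities grow together: the backward error, the imaginary drift of the diagonal
  and the mass below the subdiagonal. The last two have bounds linear in the number of rotations and
  enter the error of each single rotation, which is why \<open>eta_bound\<close> carries the factor
  N + 1.\<close>

definition invar ::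
  "nat \<Rightarrow> real \<Rightarrow> real \<Rightarrow> real \<Rightarrow> (nat \<Rightarrow> nat \<Rightarrow> complex) \<Rightarrow> (nat \<Rightarrow> complex) \<Rightarrow> (nat \<Rightarrow> complex) \<Rightarrow> qr_state \<Rightarrow> bool"
  where
  "invar n N \<epsilon> g F u v s \<longleftrightarrow> (gu s, gv s) \<in> set (rlog s) \<and>
     backward n F u v s (eta_bound n N \<epsilon> g s) (120 * \<epsilon> * real (num_rotations s)) \<and>
     (\<forall>i\<in>{1..n}. \<bar>Im (fgen s i i)\<bar> \<le> 1300 * \<epsilon> * g * real (num_rotations s)) \<and>
     mass n s \<le> 400 * g\<^sup>2 * real (num_rotations s)"

lemma eta_bound_le:
  assumes "0 \<le> \<epsilon>" "1 \<le> g" "real (num_rotations s) \<le> N"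
  shows "eta_bound n N \<epsilon> g s \<le> \<epsilon> * g * (40000 * (N + 1)\<^sup>2 + 12 * real (n\<^sup>2) * (N + 1))"
proof -
  have eg: "0 \<le> \<epsilon> * g" using assms by simp
  have N: "0 \<le> N" using assms(3) by linarith
  have "eta_bound n N \<epsilon> g s \<le> N * (40000 * (\<epsilon> * g * (N + 1)) + 12 * (\<epsilon> * g * real (n\<^sup>2))) + 12 * (\<epsilon> * g * real (n\<^sup>2))"
    unfolding eta_bound_def using assms eg N
    by (intro add_mono mult_right_mono mult_left_mono) auto
  also have "\<dots> = \<epsilon> * g * (40000 * (N * (N + 1)) + 12 * real (n\<^sup>2) * (N + 1))" by (simp add: algebra_simps)
  also have "\<dots> \<le> \<epsilon> * g * (40000 * (N + 1)\<^sup>2 + 12 * real (n\<^sup>2) * (N + 1))"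
    using N eg by (intro mult_left_mono add_right_mono) (auto simp: power2_eq_square mult_right_mono)
  finally show ?thesis .
qed

lemma rotation_step_invar:
  assumes st: "rotation_step n j \<epsilon> ar s s'" and inv: "invar n N \<epsilon> g F u v s"
    and win: "window_le n j g s" and R: "real (num_rotations s') \<le> N"
    and m: "standard_model \<epsilon> ar" and e: "0 \<le> \<epsilon>" "1000 * \<epsilon> * (N + 1) \<le> 1" and g: "1 \<le> g" and n: "2 \<le> n"
    and small: "\<epsilon> * g * (40000 * (N + 1)\<^sup>2 + 12 * real (n\<^sup>2) * (N + 1)) \<le> 1"
    and F1: "op_le n F 1"
  shows "invar n N \<epsilon> g F u v s'"
proof -
  obtain gs gs' lo k where k: "list_all2 (near \<epsilon>) gs gs'" "length gs = k" "1 \<le> k" "k \<le> j" "k \<le> 2"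
      "1 \<le> lo" "lo + k \<le> n" "in_block {lo..lo + k} gs"
      "gu s' = fold (rot_vec ar) gs (gu s)" "gv s' = fold (rot_vec ar) gs (gv s)"
      "rlog s' = rlog (fold (log_rotation ar) gs s)"
      "\<forall>i\<in>{lo..lo + k}. \<forall>j\<in>{lo..lo + k}. j \<le> i \<longrightarrow>
         low s' i j = fold (rot_right ar) gs (fold (rot_left ar) gs (fl_entry ar s)) i j"
      "\<forall>j. 1 \<le> j \<and> j < lo \<longrightarrow>
         vnorm {lo..lo + k} (\<lambda>i. low s' i j - fold (rot_vec exact) gs' (\<lambda>i. low s i j) i)
           \<le> 60 * \<epsilon> * vnorm {lo..lo + k} (\<lambda>i. low s i j)"
      "\<forall>i. lo + k < i \<and> i \<le> n \<longrightarrow>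
         vnorm {lo..lo + k} (\<lambda>j. low s' i j - fold (row_vec exact) gs' (low s i) j)
           \<le> 60 * \<epsilon> * vnorm {lo..lo + k} (low s i)"
      "\<forall>i j. 1 \<le> j \<and> j \<le> i \<and> i \<le> n \<and> i \<notin> {lo..lo + k} \<and> j \<notin> {lo..lo + k} \<longrightarrow> low s' i j = low s i j"
    using st unfolding rotation_step_def by (elim exE conjE) (rule that)
  define r where "r = real (num_rotations s)"
  have cur: "(gu s, gv s) \<in> set (rlog s)"
    and bw: "backward n F u v s (eta_bound n N \<epsilon> g s) (120 * \<epsilon> * r)"
    and dg: "\<And>i. i \<in> {1..n} \<Longrightarrow> \<bar>Im (fgen s i i)\<bar> \<le> 1300 * \<epsilon> * g * r"
    and ms: "mass n s \<le> 400 * g\<^sup>2 * r"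
    using inv by (auto simp: invar_def r_def)
  have len: "num_rotations s' = num_rotations s + k"
  proof -
    have "rlog s \<noteq> []" using cur by auto
    then have "1 \<le> length (rlog s)" by (cases "rlog s") auto
    then show ?thesis using k(2) by (simp add: num_rotations_def k(11))
  qed
  have r: "0 \<le> r" "r + 1 \<le> N" "real (num_rotations s') = r + real k" "1 \<le> real k"
    using R k(3) by (auto simp: r_def len)
  have N: "0 \<le> N" using r by linarith
  have e1: "\<epsilon> \<le> 1 / 1000"
    using e N mult_left_mono[of 1 "N + 1" "1000 * \<epsilon>"] by simp
  have er: "\<epsilon> * r \<le> 1 / 1000"
    using e r mult_left_mono[of r "N + 1" "1000 * \<epsilon>"] by simp
  have eg: "0 \<le> \<epsilon> * g" using e g by simp
  have "real (num_rotations s) \<le> N" using r by (simp add: r_def)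
  from eta_bound_le[OF e(1) g this, of n] small have eta1: "eta_bound n N \<epsilon> g s \<le> 1" by linarith
  have F2: "op_le n (fgen s) 2" by (rule backward_op_le[OF bw F1 eta1])
  have j: "1 \<le> j" using k by linarith
  note ll = low_le[OF F2 win cur g j n]
  interpret block_step n \<epsilon> ar gs gs' lo "lo + k" s s' g "1300 * \<epsilon> * g * r"
  proof
    show "vnorm {lo..lo + k} (gu s) * vnorm {lo..lo + k} (gv s) \<le> g"
      using win cur k(4,6,7) unfolding window_le_def by blast
    show "cmod (low s lo (lo - 1)) \<le> 3 * g" if "2 \<le> lo"
      using that k by (intro ll) auto
    show "cmod (low s (lo + k + 1) (lo + k)) \<le> 3 * g" if "lo + k < n"
      using that k by (intro ll) auto
  qed (use m e e1 k g F2 dg in auto)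
  define f where "f = sqrt (mass n s + 18 * g\<^sup>2)"
  have gr: "0 \<le> g * r" using g r by simp
  \<comment> \<open>The root of a quantity linear in the number of rotations is bounded linearly;
    nothing is lost, since the drift of the diagonal is linear anyway.\<close>
  have f: "f \<le> 20 * (g * (N + 1))"
    unfolding f_def
  proof (rule real_le_lsqrt)
    have "mass n s + 18 * g\<^sup>2 \<le> 400 * g\<^sup>2 * (r + 1)" 
      using ms zero_le_power2[of g] unfolding distrib_left by linarith
    also have "\<dots> \<le> 400 * g\<^sup>2 * (N + 1)\<^sup>2"
    proof (rule mult_left_mono)
      have "(N + 1) * 1 \<le> (N + 1) * (N + 1)" using N by (intro mult_left_mono) auto
      then show "r + 1 \<le> (N + 1)\<^sup>2" using r unfolding power2_eq_square mult_1_right by linarith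
    qed simp
    also have "\<dots> = (20 * (g * (N + 1)))\<^sup>2" by (simp add: power_mult_distrib)
    finally show "mass n s + 18 * g\<^sup>2 \<le> (20 * (g * (N + 1)))\<^sup>2" .
  qed (use g N in auto)
  define q where "q = \<epsilon> * g * (N + 1)"
  have q: "\<epsilon> * g \<le> q" "\<epsilon> \<le> q" "\<epsilon> * g * r \<le> q"
  proof -
    show 1: "\<epsilon> * g \<le> q" unfolding q_def using mult_left_mono[of 1 "N + 1" "\<epsilon> * g"] eg N by simp
    show "\<epsilon> \<le> q" using 1 mult_left_mono[of 1 g \<epsilon>] e g by simp
    show "\<epsilon> * g * r \<le> q" unfolding q_def using eg r by (intro mult_left_mono) auto
  qed
  have piece: "120 * \<epsilon> * (2 * x + 6) \<le> 5520 * q" if "x \<le> f" for x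
  proof -
    have "\<epsilon> * x \<le> \<epsilon> * (20 * (g * (N + 1)))"
      using that f e by (intro mult_left_mono) auto
    also have "\<dots> = 20 * q" by (simp add: q_def)
    finally show ?thesis using q by (simp add: algebra_simps)
  qed
  \<comment> \<open>Two strip terms at 5520, the block at 2600 and the drift at 18 times 1300 make
    37040.\<close>
  have "op_le n Err (40000 * q)"
    by (rule op_le_mono[OF op_le_Err])
      (use piece[OF fro_low_le(1)[folded f_def]] piece[OF fro_low_le(2)[folded f_def]] q e(1) in \<open>simp add: mult.assoc\<close>)
  from backward_step[OF bw unitary_U conj_step this vec_step unitary_mmul[OF _ unitary_U]] er e
  have bw': "backward n F u v s' (eta_bound n N \<epsilon> g s + 40000 * q) (120 * \<epsilon> * r + 2 * (60 * \<epsilon>))"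
    by (simp add: mult.assoc)
  \<comment> \<open>The term with n^2 paid by each rotation refills the deflation budget: after a
    rotation all entries below the diagonal may be nonzero again.\<close>
  have eta_le: "eta_bound n N \<epsilon> g s + 40000 * q \<le> eta_bound n N \<epsilon> g s'"
  proof -
    have c: "0 \<le> 40000 * q + 12 * (\<epsilon> * g * real (n\<^sup>2))" using q eg by simp
    have "(r + 1) * (40000 * q + 12 * (\<epsilon> * g * real (n\<^sup>2))) \<le> (r + real k) * (40000 * q + 12 * (\<epsilon> * g * real (n\<^sup>2)))"
      using r c by (intro mult_right_mono) auto
    moreover have "real (nnz n s') \<le> real (n\<^sup>2)" using nnz_le[of n s'] by (simp only: of_nat_le_iff)
    then have "0 \<le> \<epsilon> * g * (real (n\<^sup>2) - real (nnz n s'))" using eg by simp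
    moreover have "\<epsilon> * g * (real (n\<^sup>2) - real (nnz n s)) \<le> \<epsilon> * g * real (n\<^sup>2)"
      using eg by (intro mult_left_mono) auto
    ultimately show ?thesis
      unfolding eta_bound_def r(3) q_def[symmetric] r_def[symmetric] by (simp add: distrib_right)
  qed
  have mu_le: "120 * \<epsilon> * r + 2 * (60 * \<epsilon>) \<le> 120 * \<epsilon> * (r + real k)"
    using mult_left_mono[OF r(4), of "120 * \<epsilon>"] e by (simp add: distrib_left)
  have "backward n F u v s' (eta_bound n N \<epsilon> g s') (120 * \<epsilon> * real (num_rotations s'))"
    using bw' eta_le mu_le unfolding r(3) backward_def
    by (meson op_le_mono order_trans mult_right_mono vnorm_nonneg)
  moreover have "(gu s', gv s') \<in> set (rlog s')"
    using rlog_fold_current[OF cur, of ar gs] k by simp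
  moreover have "\<bar>Im (fgen s' i i)\<bar> \<le> 1300 * \<epsilon> * g * real (num_rotations s')" if "i \<in> {1..n}" for i
  proof -
    have "\<epsilon> * g * 1 \<le> \<epsilon> * g * real k" using r(4) eg by (intro mult_left_mono) auto
    then show ?thesis using diag_step[OF that] unfolding r(3) by (simp add: algebra_simps)
  qed
  moreover have "mass n s' \<le> 400 * g\<^sup>2 * real (num_rotations s')"
  proof -
    have "\<epsilon> * \<epsilon> \<le> \<epsilon> * (1 / 1000)" using e e1 by (intro mult_left_mono) auto
    then have "(1 + 60 * \<epsilon>)\<^sup>2 \<le> 1 + 130 * \<epsilon>"
      using e by (simp add: power2_eq_square algebra_simps)
    then have "(1 + 60 * \<epsilon>)\<^sup>2 * (mass n s + 18 * g\<^sup>2) \<le> (1 + 130 * \<epsilon>) * (400 * g\<^sup>2 * r + 18 * g\<^sup>2)"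
      using ms e r by (intro mult_mono) (auto simp: mass_def intro!: add_nonneg_nonneg sum_nonneg)
    also have "\<dots> = g\<^sup>2 * (400 * r + 18 + 52000 * (\<epsilon> * r) + 2340 * \<epsilon>)" by (simp add: algebra_simps)
    \<comment> \<open>The multiplicative growth is harmless because \<epsilon> r \<le> 1/1000: it
      costs about 52 g^2. Including the 81 g^2 of the block, one rotation adds at most 154 g^2 to
      the bound, within the 400 g^2 allowed.\<close>
    also have "\<dots> \<le> g\<^sup>2 * (400 * r + 18 + 52 + 3)"
      using er e1 by (intro mult_left_mono) auto
    finally have "mass n s' \<le> g\<^sup>2 * (400 * r + 18 + 52 + 3) + 81 * g\<^sup>2" using mass_step by linarith
    also have "\<dots> \<le> g\<^sup>2 * (400 * (r + 1))" by (simp add: algebra_simps)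
    also have "\<dots> \<le> g\<^sup>2 * (400 * (r + real k))" using r(4) by (intro mult_left_mono) auto
    finally show ?thesis unfolding r(3) by (simp add: algebra_simps)
  qed
  ultimately show ?thesis by (simp add: invar_def)
qed

lemma op_le_sparse:
  assumes "Z \<subseteq> {1..n} \<times> {1..n}" "\<And>r c. (r, c) \<notin> Z \<Longrightarrow> X r c = 0" "\<And>r c. (r, c) \<in> Z \<Longrightarrow> cmod (X r c) \<le> a"
  shows "op_le n X (real (card Z) * a)"
proof -
  have fin: "finite Z" using assms(1) by (rule finite_subset) simp
  have "fro {1..n} {1..n} X \<le> (\<Sum>(r, c)\<in>{1..n} \<times> {1..n}. cmod (X r c))"
    unfolding fro_def by (rule L2_set_le_sum) (auto simp: case_prod_beta)
  also have "\<dots> = (\<Sum>(r, c)\<in>Z. cmod (X r c))"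
    using assms(1,2) by (intro sum.mono_neutral_right) auto
  also have "\<dots> \<le> real (card Z) * a"
    using assms(3) by (intro sum_bounded_above) auto
  finally show ?thesis
    using op_le_mono[OF op_le_rect[of "{1..n}" n "{1..n}" X]] by simp
qed

text \<open>Zeroing an entry also changes its mirror image, which is recovered from it; this doubles
  6 \<epsilon> g to 12 \<epsilon> g per entry. Entries already zero are left out of
  \<open>Y\<close>, so that \<open>nnz\<close> drops by exactly \<open>card Y\<close> and pays for
  the error.\<close>

lemma zero_step_invar:
  assumes st: "zero_step n \<epsilon> s s'" and inv: "invar n N \<epsilon> g F u v s"
    and win: "window_le n j g s" and R: "real (num_rotations s) \<le> N"
    and e: "0 \<le> \<epsilon>" "1000 * \<epsilon> * (N + 1) \<le> 1" and g: "1 \<le> g" and n: "2 \<le> n" and j: "1 \<le> j"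
    and small: "\<epsilon> * g * (40000 * (N + 1)\<^sup>2 + 12 * real (n\<^sup>2) * (N + 1)) \<le> 1"
    and F1: "op_le n F 1"
  shows "invar n N \<epsilon> g F u v s'"
proof -
  obtain Z where same: "gu s' = gu s" "gv s' = gv s" "rlog s' = rlog s"
    and Z': "\<forall>(r, c)\<in>Z. 1 \<le> c \<and> c < r \<and> r \<le> n \<and>
             cmod (low s r c) \<le> \<epsilon> * (cmod (low s r r) + cmod (low s c c))"
    and low': "low s' = (\<lambda>r c. if (r, c) \<in> Z then 0 else low s r c)"
    using st unfolding zero_step_def by (elim conjE exE) (rule that)
  have Z: "1 \<le> c \<and> c < r \<and> r \<le> n \<and>
      cmod (low s r c) \<le> \<epsilon> * (cmod (low s r r) + cmod (low s c c))" if "(r, c) \<in> Z" for r c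
    using Z' that by auto
  have nr: "num_rotations s' = num_rotations s" by (simp add: num_rotations_def same)
  define \<rho> where "\<rho> = real (num_rotations s)"
  have cur: "(gu s, gv s) \<in> set (rlog s)"
    and bw: "backward n F u v s (eta_bound n N \<epsilon> g s) (120 * \<epsilon> * \<rho>)"
    and dg: "\<And>i. i \<in> {1..n} \<Longrightarrow> \<bar>Im (fgen s i i)\<bar> \<le> 1300 * \<epsilon> * g * \<rho>"
    and ms: "mass n s \<le> 400 * g\<^sup>2 * \<rho>"
    using inv by (auto simp: invar_def \<rho>_def)
  have eta1: "eta_bound n N \<epsilon> g s \<le> 1" using eta_bound_le[OF e(1) g R, of n] small by linarith
  have F2: "op_le n (fgen s) 2" by (rule backward_op_le[OF bw F1 eta1])
  note ll = low_le[OF F2 win cur g j n]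
  define Y where "Y = {(r, c) \<in> Z. low s r c \<noteq> 0}"
  define X where "X r c = (if (r, c) \<in> Y then - low s r c else 0)" for r c
  have small_entry: "cmod (low s r c) \<le> 6 * (\<epsilon> * g)" if "(r, c) \<in> Z" for r c
  proof -
    have "cmod (low s r c) \<le> \<epsilon> * (cmod (low s r r) + cmod (low s c c))" using Z[OF that] by blast
    also have "\<dots> \<le> \<epsilon> * (3 * g + 3 * g)"
      using Z[OF that] e by (intro mult_left_mono add_mono ll) auto
    finally show ?thesis by simp
  qed
  have "op_le n X (real (card Y) * (6 * (\<epsilon> * g)))"
  proof (rule op_le_sparse)
    show "Y \<subseteq> {1..n} \<times> {1..n}" using Z by (force simp: Y_def)
  qed (use small_entry in \<open>auto simp: X_def Y_def\<close>)
  from op_le_add[OF this op_le_ctrans[OF this]]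
  have X2: "op_le n (\<lambda>i j. X i j + ctrans X i j) (real (card Y) * (12 * (\<epsilon> * g)))" by (simp add: algebra_simps)
  have F': "fgen s' i j = mmul n (ctrans idm) (mmul n (fgen s) idm) i j + (X i j + ctrans X i j)"
    if ij: "i \<in> {1..n}" "j \<in> {1..n}" for i j
  proof -
    have lower: "fgen s' i j = fgen s i j + X i j" if "j \<le> i" for i j
      using that by (auto simp: fgen_low same low' X_def Y_def)
    have up: "X i j = 0" if "i \<le> j" for i j using Z[of i j] that by (auto simp: X_def Y_def)
    have "fgen s' i j = fgen s i j + (X i j + ctrans X i j)"
    proof (cases "j \<le> i")
      case True
      then show ?thesis using lower up by (simp add: ctrans_def)
    next
      case False
      then have ij: "i \<noteq> j" "i \<le> j" by auto
      show ?thesis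
        using lower[OF ij(2)] up[OF ij(2)] fgen_hermitian[OF ij(1), of s] fgen_hermitian[OF ij(1), of s']
        by (simp add: ctrans_def)
    qed
    moreover have "mmul n (ctrans idm) (mmul n (fgen s) idm) i j = fgen s i j"
      using ij by (simp add: mmul_idm_left mmul_idm_right)
    ultimately show ?thesis by simp
  qed
  have v0: "vnorm {1..n} (\<lambda>i. x i - mvec n (ctrans idm) x i) \<le> 0 * vnorm {1..n} x" for x
  proof -
    have "vnorm {1..n} (\<lambda>i. x i - mvec n (ctrans idm) x i) = vnorm {1..n} (\<lambda>i. 0)"
      by (rule vnorm_cong) (simp add: mvec_idm)
    then show ?thesis by (simp add: vnorm_def L2_set_constant)
  qed
  have \<rho>: "0 \<le> \<rho>" "\<rho> \<le> N" using R by (auto simp: \<rho>_def)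
  have "120 * \<epsilon> * \<rho> \<le> 1"
    using e \<rho> mult_left_mono[of \<rho> "N + 1" "\<epsilon>"] by simp
  from backward_step[OF bw unitary_idm F' X2 _ _ unitary_mmul[OF _ unitary_idm] this, of 0] v0
  have bw': "backward n F u v s' (eta_bound n N \<epsilon> g s + real (card Y) * (12 * (\<epsilon> * g))) (120 * \<epsilon> * \<rho>)"
    by (simp add: same)
  let ?NZ = "\<lambda>s. {(r, c). 1 \<le> c \<and> c < r \<and> r \<le> n \<and> low s r c \<noteq> 0}"
  have fin: "finite (?NZ s)" by (rule finite_subset[of _ "{1..n} \<times> {1..n}"]) auto
  have "?NZ s' = ?NZ s - Y" by (auto simp: low' Y_def split: if_splits)
  moreover have "Y \<subseteq> ?NZ s" using Z by (auto simp: Y_def)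
  ultimately have "nnz n s' = nnz n s - card Y" "card Y \<le> nnz n s"
    unfolding nnz_def using fin by (auto intro: card_Diff_subset card_mono finite_subset)
  then have nz: "real (nnz n s) = real (nnz n s') + real (card Y)" by simp
  then have "eta_bound n N \<epsilon> g s + real (card Y) * (12 * (\<epsilon> * g)) = eta_bound n N \<epsilon> g s'"
    by (simp add: eta_bound_def nr nz algebra_simps)
  with bw' have "backward n F u v s' (eta_bound n N \<epsilon> g s') (120 * \<epsilon> * real (num_rotations s'))"
    by (simp add: nr \<rho>_def)
  moreover have "Im (fgen s' i i) = Im (fgen s i i)" if "i \<in> {1..n}" for i
  proof -
    have "(i, i) \<notin> Z" using Z[of i i] by auto
    then show ?thesis by (simp add: fgen_low same low')
  qed
  moreover have "mass n s' \<le> mass n s"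
    unfolding mass_def low' by (intro sum_mono) auto
  ultimately show ?thesis using cur dg ms by (auto simp: invar_def same nr \<rho>_def)
qed

section \<open>The spectral norm of F\<close>

lemma colleague_F_form_le:
  "cmod (dot n z (mvec n (colleague_F n) y)) \<le> ((vnorm {1..n} z)\<^sup>2 + (vnorm {1..n} y)\<^sup>2) / 2"
proof (cases n)
  case 0
  then show ?thesis by (simp add: dot_def)
next
  case (Suc m)
  define a b f q where "a i = cmod (z i)" and "b i = cmod (y i)"
    and "f i = (if i = m then sqrt 2 / 2 else 1 / 2)" and "q i = (a i)\<^sup>2 + (b i)\<^sup>2" for i
  have F: "cmod (colleague_F n i j) = (if j = Suc i then f i else 0) + (if i = Suc j then f j else 0)"
    if "i \<in> {1..n}" "j \<in> {1..n}" for i j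
    using that Suc by (auto simp: colleague_F_def f_def max_def norm_divide)
  have "cmod (dot n z (mvec n (colleague_F n) y))
      \<le> (\<Sum>i = 1..n. \<Sum>j = 1..n. a i * (cmod (colleague_F n i j) * b j))"
    unfolding dot_def mvec_def sum_distrib_left
    by (intro order_trans[OF norm_sum] sum_mono order_trans[OF norm_sum]) (simp add: norm_mult a_def b_def)
  also have "\<dots> = (\<Sum>i = 1..n. \<Sum>j = 1..n.
      (if j = Suc i then a i * f i * b j else 0) + (if i = Suc j then a i * f j * b j else 0))"
    by (intro sum.cong refl) (simp add: F)
  also have "\<dots> = (\<Sum>i = 1..n. \<Sum>j = 1..n. (if j = Suc i then a i * f i * b j else 0))
      + (\<Sum>j = 1..n. \<Sum>i = 1..n. (if i = Suc j then a i * f j * b j else 0))"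
    unfolding sum.distrib by (subst (2) sum.swap) simp
  also have "\<dots> = (\<Sum>i = 1..m. a i * f i * b (Suc i)) + (\<Sum>i = 1..m. a (Suc i) * f i * b i)"
    unfolding Suc by (simp add: sum.delta' if_distrib cong: if_cong)
  also have "\<dots> = (\<Sum>i = 1..m. f i * (a i * b (Suc i)) + f i * (a (Suc i) * b i))"
    by (simp add: sum.distrib mult_ac)
  also have "\<dots> \<le> (\<Sum>i = 1..m. q i / 4 + q (Suc i) / 4 + (if i = m then q (Suc i) / 4 else 0))"
  proof (rule sum_mono)
    fix i
    have half: "x * y / 2 \<le> x\<^sup>2 / 4 + y\<^sup>2 / 4" for x y :: real
      using sum_squares_bound[of x y] by simp
    \<comment> \<open>The large entry sqrt 2 / 2 couples to the last index, which has only one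
      neighbour: it can take weight 1/2 there, leaving the usual 1/4 for that neighbour.\<close>
    have root: "sqrt 2 / 2 * (x * y) \<le> x\<^sup>2 / 4 + y\<^sup>2 / 2" for x y :: real
    proof -
      have "0 \<le> (x / 2 - sqrt 2 / 2 * y)\<^sup>2" by simp
      then show ?thesis by (simp add: power2_eq_square algebra_simps)
    qed
    show "f i * (a i * b (Suc i)) + f i * (a (Suc i) * b i)
        \<le> q i / 4 + q (Suc i) / 4 + (if i = m then q (Suc i) / 4 else 0)"
    proof (cases "i = m")
      case True
      then show ?thesis
        using root[of "a m" "b (Suc m)"] root[of "b m" "a (Suc m)"]
        by (simp add: f_def q_def mult.commute add_divide_distrib)
    next
      case False
      then show ?thesis
        using half[of "a i" "b (Suc i)"] half[of "a (Suc i)" "b i"]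
        by (simp add: f_def q_def add_divide_distrib)
    qed
  qed
  also have "\<dots> = (\<Sum>i = 1..m. q i / 4 + q (Suc i) / 4) + (if m = 0 then 0 else q (Suc m) / 4)"
    unfolding sum.distrib by auto
  also have "\<dots> \<le> (\<Sum>i = 1..m. q i / 4 + q (Suc i) / 4) + q (Suc m) / 4"
    by (simp add: q_def)
  \<comment> \<open>Every index collects a total weight of at most 1/2.\<close>
  also have "\<dots> \<le> (\<Sum>i = 1..Suc m. q i) / 2"
  proof (induction m)
    case 0
    then show ?case by (simp add: q_def)
  qed simp
  also have "(\<Sum>i = 1..Suc m. q i) = (vnorm {1..n} z)\<^sup>2 + (vnorm {1..n} y)\<^sup>2"
    unfolding vnorm_sq Suc q_def a_def b_def sum.distrib ..
  finally show ?thesis .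
qed

text \<open>Scaling both vectors to unit length turns the mean of the squares into the product of
  the norms.\<close>

lemma op_le_colleague_F: "op_le n (colleague_F n) 1"
  unfolding op_le_def
proof (intro allI)
  fix y z
  let ?V = "vnorm {1..n}"
  let ?D = "\<lambda>z y. dot n z (mvec n (colleague_F n) y)"
  show "cmod (?D z y) \<le> 1 * (?V z * ?V y)"
  proof (cases "?V z = 0 \<or> ?V y = 0")
    case True
    have zero: "x i = 0" if "?V x = 0" "i \<in> {1..n}" for x i
      using cmod_le_vnorm[of "{1..n}" i x] that by simp
    have "?D z y = 0" using True
    proof
      assume "?V z = 0"
      then show ?thesis unfolding dot_def using zero[of z] by (intro sum.neutral) auto
    next
      assume "?V y = 0"
      then show ?thesis unfolding dot_def mvec_def using zero[of y] by (intro sum.neutral ballI) (auto intro!: sum.neutral)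
    qed
    then show ?thesis by simp
  next
    case False
    then have p: "0 < ?V z" "0 < ?V y" by (simp_all add: order_less_le)
    define z' y' where "z' i = of_real (1 / ?V z) * z i" and "y' i = of_real (1 / ?V y) * y i" for i
    have n1: "?V z' = 1" "?V y' = 1"
      using p unfolding z'_def[abs_def] y'_def[abs_def] vnorm_scale by (simp_all add: norm_divide)
    have "dot n (\<lambda>i. of_real a * z i) (mvec n (colleague_F n) (\<lambda>i. of_real b * y i))
        = of_real a * of_real b * ?D z y" for a b
      by (simp add: dot_def mvec_def sum_distrib_left algebra_simps)
    then have "?D z' y' = of_real (1 / ?V z) * of_real (1 / ?V y) * ?D z y"
      unfolding z'_def[abs_def] y'_def[abs_def] .
    then have "cmod (?D z' y') = cmod (?D z y) / (?V z * ?V y)"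
      using p by (simp add: norm_mult norm_divide)
    moreover have "cmod (?D z' y') \<le> 1" using colleague_F_form_le[of n z' y'] unfolding n1 by simp
    ultimately have "cmod (?D z y) / (?V z * ?V y) \<le> 1" by (simp only:)
    then show ?thesis using p by (simp add: divide_le_eq)
  qed
qed

section \<open>Growth constants as bounds on windows of the generators\<close>

lemma window_le_gamma_const:
  assumes "1 \<le> k" "m \<le> j" "k + m \<le> n" "j < n"
  shows "vnorm {k..k + m} u * vnorm {k..k + m} v \<le> gamma_const j n u v"
proof -
  let ?t = "\<lambda>i. L2_set (\<lambda>k. cmod (u k)) {i..min (i + j + 1) n} * L2_set (\<lambda>k. cmod (v k)) {max 1 (i - 1)..i + j}"
  \<comment> \<open>The indices of \<open>gamma_const\<close> end at n - j; a window starting later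
    lies inside the windows that belong to n - j.\<close>
  define i where "i = min k (n - j)"
  have i: "i \<in> {1..n - j}" using assms by (auto simp: i_def)
  have "vnorm {k..k + m} u * vnorm {k..k + m} v \<le> vnorm {i..min (i + j + 1) n} u * vnorm {max 1 (i - 1)..i + j} v"
    using assms by (intro mult_mono vnorm_sub) (auto simp: i_def)
  also have "\<dots> = ?t i" by (simp add: vnorm_def)
  also have "\<dots> \<le> gamma_const j n u v"
    unfolding gamma_const_def by (rule cSUP_upper[OF i]) simp
  finally show ?thesis .
qed

lemma window_le_gamma_hat:
  assumes "j < n"
  shows "window_le n j (max 1 (gamma_hat j n s)) s"
  unfolding window_le_def
proof (clarify)
  fix u v k m
  assume uv: "(u, v) \<in> set (rlog s)" and k: "1 \<le> k" "m \<le> j" "k + m \<le> n"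
  have "gamma_const j n u v \<le> gamma_hat j n s"
    unfolding gamma_hat_def
    using cSUP_upper[OF uv, of "\<lambda>(u, v). gamma_const j n u v"] by simp
  then show "vnorm {k..k + m} u * vnorm {k..k + m} v \<le> max 1 (gamma_hat j n s)"
    using window_le_gamma_const[OF k assms, of u v] by linarith
qed

lemma gamma_hat_le:
  assumes j: "j < n" and ne: "rlog s \<noteq> []"
    and b: "\<And>u v. (u, v) \<in> set (rlog s) \<Longrightarrow> vnorm {1..n} u \<le> a \<and> vnorm {1..n} v \<le> b"
  shows "gamma_hat j n s \<le> a * b"
  unfolding gamma_hat_def
proof (rule cSUP_least)
  fix x assume x: "x \<in> set (rlog s)"
  obtain u v where uv: "x = (u, v)" by (cases x)
  have "gamma_const j n u v \<le> a * b"
    unfolding gamma_const_def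
  proof (rule cSUP_least)
    fix i assume i: "i \<in> {1..n - j}"
    have "vnorm {i..min (i + j + 1) n} u * vnorm {max 1 (i - 1)..i + j} v \<le> vnorm {1..n} u * vnorm {1..n} v"
      using i by (intro mult_mono vnorm_sub) auto
    also have "\<dots> \<le> a * b"
      using b[OF x[unfolded uv]] by (intro mult_mono) (auto intro: order_trans[OF vnorm_nonneg])
    finally show "L2_set (\<lambda>k. cmod (u k)) {i..min (i + j + 1) n} * L2_set (\<lambda>k. cmod (v k)) {max 1 (i - 1)..i + j} \<le> a * b"
      by (simp add: vnorm_def)
  qed (use j in auto)
  then show "(case x of (u, v) \<Rightarrow> gamma_const j n u v) \<le> a * b" by (simp add: uv)
qed (use ne in auto)

section \<open>Runs of the iteration\<close>

lemma fgen_init_state: "fgen (init_state n p) i j = colleague_F n i j"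
  unfolding fgen_def entry_init_state by (simp add: colleague_def init_state_def)

lemma invar_init:
  assumes "0 \<le> \<epsilon>" "1 \<le> g"
  shows "invar n N \<epsilon> g (colleague_F n) colleague_u (colleague_v n p) (init_state n p)"
proof -
  let ?s = "init_state n p"
  have R: "num_rotations ?s = 0" by (simp add: num_rotations_def init_state_def)
  have "real (nnz n ?s) \<le> real (n\<^sup>2)" using nnz_le[of n ?s] by (simp only: of_nat_le_iff)
  then have eta: "0 \<le> eta_bound n N \<epsilon> g ?s" using assms by (simp add: eta_bound_def R)
  have z: "vnorm B (\<lambda>i. 0) = 0" for B by (simp add: vnorm_def L2_set_constant)
  have "backward n (colleague_F n) colleague_u (colleague_v n p) ?s (eta_bound n N \<epsilon> g ?s) 0"
    unfolding backward_def
  proof (rule exI[of _ idm], rule exI[of _ "\<lambda>i j. 0"], rule exI[of _ colleague_u],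
      rule exI[of _ "colleague_v n p"], intro conjI ballI)
    show "op_le n (\<lambda>i j. 0) (eta_bound n N \<epsilon> g ?s)"
      using eta by (simp add: op_le_def mvec_def dot_def)
  qed (auto simp: fgen_init_state mmul_idm_left mmul_idm_right mvec_idm unitary_idm z, auto simp: init_state_def)
  moreover have "mass n ?s = 0"
    unfolding mass_def
    by (intro sum.neutral) (auto simp: init_state_def colleague_def colleague_F_def colleague_u_def)
  moreover have "Im (fgen ?s i i) = 0" for i by (simp add: fgen_init_state colleague_F_def)
  ultimately show ?thesis by (simp add: invar_def R) (simp add: init_state_def)
qed

lemma indices_ok_init: "indices_ok n (init_state n p)"
  by (simp add: indices_ok_def init_state_def)

text \<open>Log and count only grow, so bounds assumed for the final state hold at every earlier
  one; this makes the growth constant of the whole run available inside the induction.\<close>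

lemma rotation_step_rlog:
  assumes "rotation_step n j \<epsilon> ar s s' \<or> zero_step n \<epsilon> s s'"
  shows "set (rlog s) \<subseteq> set (rlog s') \<and> num_rotations s \<le> num_rotations s'"
  using assms
proof
  assume "rotation_step n j \<epsilon> ar s s'"
  then obtain gs where "rlog s' = rlog (fold (log_rotation ar) gs s)" unfolding rotation_step_def by blast
  then show ?thesis using rlog_fold_subset[of s ar gs] by (simp add: num_rotations_def)
next
  assume "zero_step n \<epsilon> s s'"
  then show ?thesis by (simp add: zero_step_def num_rotations_def)
qed

lemma run_indices_ok:
  assumes "(qr_step n j \<epsilon> ar)\<^sup>*\<^sup>* (init_state n p) s" "j = 1 \<or> j = 2"
    "standard_model \<epsilon> ar" "0 \<le> \<epsilon>" "\<epsilon> \<le> 1 / 1000"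
  shows "indices_ok n s"
  using assms(1)
proof (induction rule: rtranclp_induct)
  case (step s s')
  then show ?case using qr_step_cases[OF step(2) _ assms(2-5)] by blast
qed (rule indices_ok_init)

lemma run_invar:
  assumes "(qr_step n j \<epsilon> ar)\<^sup>*\<^sup>* (init_state n p) s"
    and j: "j = 1 \<or> j = 2" and n: "2 \<le> n"
    and m: "standard_model \<epsilon> ar" and e: "0 \<le> \<epsilon>" "1000 * \<epsilon> * (N + 1) \<le> 1" and g: "1 \<le> g"
    and small: "\<epsilon> * g * (40000 * (N + 1)\<^sup>2 + 12 * real (n\<^sup>2) * (N + 1)) \<le> 1"
    and "window_le n j g s" "real (num_rotations s) \<le> N" "0 \<le> N"
  shows "invar n N \<epsilon> g (colleague_F n) colleague_u (colleague_v n p) s"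
  using assms(1) assms(9-)
proof (induction rule: rtranclp_induct)
  case base
  then show ?case using e g by (intro invar_init)
next
  case (step s s')
  have e1: "\<epsilon> \<le> 1 / 1000"
    using e step.prems mult_left_mono[of 1 "N + 1" "1000 * \<epsilon>"] by simp
  have st: "rotation_step n j \<epsilon> ar s s' \<or> zero_step n \<epsilon> s s'"
    using qr_step_cases[OF step(2) run_indices_ok[OF step(1) j m e(1) e1] j m e(1) e1] by blast
  note mono = rotation_step_rlog[OF st]
  have win: "window_le n j g s" using step.prems(1) mono unfolding window_le_def by blast
  have R: "real (num_rotations s) \<le> N" using step.prems(2) mono by linarith
  have inv: "invar n N \<epsilon> g (colleague_F n) colleague_u (colleague_v n p) s"
    using step.IH win R step.prems by blast
  have j1: "1 \<le> j" using j by auto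
  show ?case using st
  proof
    assume "rotation_step n j \<epsilon> ar s s'"
    from rotation_step_invar[OF this inv win step.prems(2) m e g n small op_le_colleague_F] show ?thesis .
  next
    assume "zero_step n \<epsilon> s s'"
    from zero_step_invar[OF this inv win R e g n j1 small op_le_colleague_F] show ?thesis .
  qed
qed

lemma run_rlog_bounded:
  assumes "(qr_step n j \<epsilon> ar)\<^sup>*\<^sup>* (init_state n p) s"
    and j: "j = 1 \<or> j = 2" and m: "standard_model \<epsilon> ar" and e: "0 \<le> \<epsilon>" "\<epsilon> \<le> 1 / 1000"
  shows "rlog_bounded n (1 + 26 * \<epsilon>) (vnorm {1..n} colleague_u) (vnorm {1..n} (colleague_v n p)) s"
  using assms(1)
proof (induction rule: rtranclp_induct)
  case base
  then show ?case by (simp add: rlog_bounded_def init_state_def)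
next
  case (step s s')
  have st: "rotation_step n j \<epsilon> ar s s' \<or> zero_step n \<epsilon> s s'"
    using qr_step_cases[OF step(2) run_indices_ok[OF step(1) j m e] j m e] by blast
  then show ?case
  proof
    assume "rotation_step n j \<epsilon> ar s s'"
    then obtain gs gs' lo k where k: "list_all2 (near \<epsilon>) gs gs'" "1 \<le> lo" "lo + k \<le> n" "in_block {lo..lo + k} gs"
      "gu s' = fold (rot_vec ar) gs (gu s)" "gv s' = fold (rot_vec ar) gs (gv s)"
      "rlog s' = rlog (fold (log_rotation ar) gs s)" unfolding rotation_step_def by blast
    have "in_block {1..n} gs" using in_block_mono[OF k(4)] k by auto
    from rlog_bounded_fold[OF m e k(1) this step.IH] k(5-7)
    show ?thesis by (simp add: rlog_bounded_def)
  next
    assume "zero_step n \<epsilon> s s'"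
    then show ?thesis using step.IH by (simp add: zero_step_def rlog_bounded_def)
  qed
qed

section \<open>The characteristic polynomial of the colleague matrix\<close>

text \<open>The passage to library matrices, whose indices start at 0.\<close>

definition mt :: "nat \<Rightarrow> (nat \<Rightarrow> nat \<Rightarrow> complex) \<Rightarrow> complex mat" where
  "mt n X = mat n n (\<lambda>(i, j). X (Suc i) (Suc j))"

lemma mt_carrier [simp]: "mt n X \<in> carrier_mat n n"
  and mt_dim [simp]: "dim_row (mt n X) = n" "dim_col (mt n X) = n"
  by (simp_all add: mt_def)

lemma mt_index [simp]: "i < n \<Longrightarrow> j < n \<Longrightarrow> mt n X $$ (i, j) = X (Suc i) (Suc j)"
  by (simp add: mt_def)

lemma mt_cong: "(\<And>i j. i \<in> {1..n} \<Longrightarrow> j \<in> {1..n} \<Longrightarrow> X i j = Y i j) \<Longrightarrow> mt n X = mt n Y"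
  by (intro eq_matI) auto

lemma sum_shift: "(\<Sum>k = Suc 0..n. f k) = (\<Sum>k = 0..<n. f (Suc k))"
  using sum.atLeast_Suc_atMost_Suc_shift[of f 0] by (cases n) (simp_all add: atLeast0AtMost lessThan_atLeast0[symmetric] lessThan_Suc_atMost)

lemma mt_mmul: "mt n (mmul n X Y) = mt n X * mt n Y"
  by (intro eq_matI) (simp_all add: mmul_def scalar_prod_def sum_shift)

lemma mt_idm: "mt n idm = 1\<^sub>m n"
  by (intro eq_matI) (auto simp: idm_def)

lemma mt_mult_vec: "mt n X *\<^sub>v vec n (\<lambda>i. y (Suc i)) = vec n (\<lambda>i. mvec n X y (Suc i))"
  by (intro eq_vecI) (simp_all add: mvec_def scalar_prod_def sum_shift)

section \<open>Inverses and rank-one updates of determinants\<close>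

lemma det_mt_nonzero:
  assumes "\<And>y. vnorm {1..n} y \<le> \<kappa> * vnorm {1..n} (mvec n X y)"
  shows "det (mt n X) \<noteq> 0"
proof
  assume "det (mt n X) = 0"
  then obtain v where v: "v \<in> carrier_vec n" "v \<noteq> 0\<^sub>v n" "mt n X *\<^sub>v v = 0\<^sub>v n"
    using det_0_iff_vec_prod_zero[OF mt_carrier] by blast
  define y where "y i = v $ (i - 1)" for i
  have vy: "v = vec n (\<lambda>i. y (Suc i))" using v(1) by (intro eq_vecI) (auto simp: y_def)
  have "vec n (\<lambda>i. mvec n X y (Suc i)) = 0\<^sub>v n" using v(3) unfolding vy mt_mult_vec .
  then have "mvec n X y (Suc i) = 0" if "i < n" for i using that by (metis index_vec index_zero_vec(1))
  then have "mvec n X y i = 0" if "i \<in> {1..n}" for i using that by (cases i) auto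
  then have "vnorm {1..n} (mvec n X y) = vnorm {1..n} (\<lambda>i. 0)" by (intro vnorm_cong) auto
  also have "\<dots> = 0" by (simp add: vnorm_def L2_set_constant)
  finally have "vnorm {1..n} y \<le> 0" using assms[of y] by simp
  then have "cmod (y i) \<le> 0" if "i \<in> {1..n}" for i using cmod_le_vnorm[OF finite_atLeastAtMost that, of y] by linarith
  then have "y i = 0" if "i \<in> {1..n}" for i using that by simp
  then have "v = 0\<^sub>v n" unfolding vy by (intro eq_vecI) auto
  with v(2) show False ..
qed

lemma mt_inverse:
  assumes "det (mt n X) \<noteq> 0"
  obtains Z where "\<And>i j. i \<in> {1..n} \<Longrightarrow> j \<in> {1..n} \<Longrightarrow> mmul n X Z i j = idm i j"
proof -
  define Z where "Z i j = adj_mat (mt n X) $$ (i - 1, j - 1) / det (mt n X)" for i j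
  have "mt n X * mt n Z = 1\<^sub>m n"
  proof -
    have "mt n Z = (1 / det (mt n X)) \<cdot>\<^sub>m adj_mat (mt n X)"
      using adj_mat(1)[OF mt_carrier[of n X]] by (intro eq_matI) (auto simp: Z_def)
    then have "mt n X * mt n Z = (1 / det (mt n X)) \<cdot>\<^sub>m (mt n X * adj_mat (mt n X))"
      using adj_mat(1)[OF mt_carrier[of n X]] by (simp add: mult_smult_distrib[of _ n n _ n])
    also have "\<dots> = 1\<^sub>m n"
      unfolding adj_mat(2)[OF mt_carrier] using assms by (intro eq_matI) auto
    finally show ?thesis .
  qed
  then have "mt n (mmul n X Z) = mt n idm" by (simp add: mt_mmul mt_idm)
  then have "mmul n X Z (Suc i) (Suc j) = idm (Suc i) (Suc j)" if "i < n" "j < n" for i j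
    using that by (metis mt_index)
  then have "mmul n X Z i j = idm i j" if "i \<in> {1..n}" "j \<in> {1..n}" for i j
    using that by (cases i; cases j) auto
  then show thesis by (rule that)
qed

lemma mt_solve:
  assumes "\<And>i j. i \<in> {1..n} \<Longrightarrow> j \<in> {1..n} \<Longrightarrow> mmul n X Z i j = idm i j" "i \<in> {1..n}"
  shows "mvec n X (mvec n Z b) i = b i"
proof -
  have "mvec n X (mvec n Z b) i = mvec n (mmul n X Z) b i" by (simp add: mvec_mmul)
  also have "\<dots> = mvec n idm b i" using assms by (intro mvec_cong) auto
  finally show ?thesis using assms(2) by (simp add: mvec_idm)
qed

text \<open>With X = I - Y V, both [I 0; V 1] [I Y; 0 c] and [X Y; 0 1] [I 0; V 1] equal [I Y; V 1].
  Comparing determinants of these block triangular factors gives det X = c.\<close>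

lemma det_one_minus_rank_one:
  fixes y w :: "nat \<Rightarrow> complex"
  shows "det (mt n (\<lambda>i j. idm i j - y i * w j)) = 1 - (\<Sum>i = 1..n. w i * y i)"
proof -
  let ?I = "1\<^sub>m n :: complex mat" and ?O = "1\<^sub>m 1 :: complex mat"
  define Y where "Y = mat n 1 (\<lambda>(i, j). y (Suc i))"
  define V where "V = mat 1 n (\<lambda>(i, j). w (Suc j))"
  define c where "c = 1 - (\<Sum>i = 1..n. w i * y i)"
  define C where "C = mat 1 1 (\<lambda>(i::nat, j::nat). c)"
  define X where "X = mt n (\<lambda>i j. idm i j - y i * w j)"
  have cr: "Y \<in> carrier_mat n 1" "V \<in> carrier_mat 1 n" "C \<in> carrier_mat 1 1" "X \<in> carrier_mat n n"
    by (simp_all add: Y_def V_def C_def X_def)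
  have z: "0\<^sub>m n 1 \<in> carrier_mat n 1" "0\<^sub>m 1 n \<in> carrier_mat 1 n" "?I \<in> carrier_mat n n" "?O \<in> carrier_mat 1 1"
    by simp_all
  have VY: "V * Y + C = ?O"
    by (intro eq_matI) (simp_all add: V_def Y_def C_def c_def scalar_prod_def sum_shift)
  have XY: "X + Y * V = ?I"
    by (intro eq_matI) (auto simp: X_def Y_def V_def scalar_prod_def idm_def)
  have "four_block_mat ?I (0\<^sub>m n 1) V ?O * four_block_mat ?I Y (0\<^sub>m 1 n) C = four_block_mat ?I Y V ?O"
    unfolding mult_four_block_mat[OF z(3,1) cr(2) z(4) z(3) cr(1) z(2) cr(3)]
    using cr by (simp add: VY)
  moreover have "four_block_mat X Y (0\<^sub>m 1 n) ?O * four_block_mat ?I (0\<^sub>m n 1) V ?O = four_block_mat ?I Y V ?O"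
    unfolding mult_four_block_mat[OF cr(4,1) z(2,4) z(3,1) cr(2) z(4)]
    using cr by (simp add: XY)
  ultimately have eq: "four_block_mat ?I (0\<^sub>m n 1) V ?O * four_block_mat ?I Y (0\<^sub>m 1 n) C
      = four_block_mat X Y (0\<^sub>m 1 n) ?O * four_block_mat ?I (0\<^sub>m n 1) V ?O" by simp
  have dl: "det (four_block_mat ?I (0\<^sub>m n 1) V ?O) = 1"
    using det_four_block_mat_upper_right_zero[OF z(3) refl cr(2) z(4)] by simp
  have du: "det (four_block_mat ?I Y (0\<^sub>m 1 n) C) = det C" "det (four_block_mat X Y (0\<^sub>m 1 n) ?O) = det X"
    using det_four_block_mat_lower_left_zero[OF z(3) cr(1) refl cr(3)]
      det_four_block_mat_lower_left_zero[OF cr(4,1) refl z(4)] by simp_all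
  have dC: "det C = c" using det_single[of C] cr by (simp add: C_def)
  have "det (four_block_mat ?I (0\<^sub>m n 1) V ?O) * det (four_block_mat ?I Y (0\<^sub>m 1 n) C)
      = det (four_block_mat X Y (0\<^sub>m 1 n) ?O) * det (four_block_mat ?I (0\<^sub>m n 1) V ?O)"
    using arg_cong[OF eq, of det]
      det_mult[OF four_block_carrier_mat[OF z(3,4)] four_block_carrier_mat[OF z(3) cr(3)]]
      det_mult[OF four_block_carrier_mat[OF cr(4) z(4)] four_block_carrier_mat[OF z(3,4)]] by metis
  then show ?thesis unfolding dl du dC by (simp add: X_def c_def)
qed

text \<open>X - u w = X (I - y w) whenever X y = u, so a solution \<open>y\<close> takes the place
  of the inverse of \<open>X\<close>.\<close>

lemma det_minus_rank_one:
  assumes "\<And>i. i \<in> {1..n} \<Longrightarrow> mvec n X y i = u i"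
  shows "det (mt n (\<lambda>i j. X i j - u i * w j)) = det (mt n X) * (1 - (\<Sum>i = 1..n. w i * y i))"
proof -
  have "mt n (\<lambda>i j. X i j - u i * w j) = mt n (mmul n X (\<lambda>i j. idm i j - y i * w j))"
  proof (rule mt_cong)
    fix i j assume ij: "i \<in> {1..n}" "j \<in> {1..n}"
    have "mmul n X (\<lambda>i j. idm i j - y i * w j) i j = mmul n X idm i j - mmul n X (\<lambda>i j. y i * w j) i j"
      by (simp add: mmul_def algebra_simps sum_subtractf)
    then show "X i j - u i * w j = mmul n X (\<lambda>i j. idm i j - y i * w j) i j"
      using ij assms by (simp add: mmul_idm_right mmul_outer_left)
  qed
  then show ?thesis by (simp add: mt_mmul det_mult[OF mt_carrier mt_carrier] det_one_minus_rank_one)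
qed

lemma norm_prod_minus_one_le:
  fixes z :: "nat \<Rightarrow> complex"
  assumes "finite S" "\<And>i. i \<in> S \<Longrightarrow> cmod (z i) \<le> b" "0 \<le> b"
  shows "cmod ((\<Prod>i\<in>S. 1 - z i) - 1) \<le> (1 + b) ^ card S - 1"
  using assms(1,2)
proof (induction S rule: finite_induct)
  case (insert i S)
  let ?P = "\<Prod>i\<in>S. 1 - z i"
  have "cmod ((1 - z i) * ?P - 1) = cmod ((1 - z i) * (?P - 1) + - z i)" by (simp add: algebra_simps)
  also have "\<dots> \<le> cmod (1 - z i) * cmod (?P - 1) + cmod (z i)"
    by (metis norm_minus_cancel norm_mult norm_triangle_ineq)
  also have "\<dots> \<le> (1 + b) * ((1 + b) ^ card S - 1) + b"
    using insert norm_triangle_ineq4[of 1 "z i"] assms(3)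
    by (intro add_mono mult_mono) (auto intro: order_trans)
  finally show ?case using insert by (simp add: algebra_simps)
qed simp

text \<open>In the Leibniz formula every permutation but the identity picks at least two entries off the
  diagonal, so it only contributes to second order.\<close>

lemma det_near_identity:
  assumes b: "\<And>i j. i \<in> {1..n} \<Longrightarrow> j \<in> {1..n} \<Longrightarrow> cmod (X i j) \<le> b" "0 \<le> b"
    and small: "real n * b \<le> 1" "fact n * 2 ^ n * b \<le> 1" and n: "1 \<le> n"
  shows "cmod (det (mt n (\<lambda>i j. idm i j - X i j)) - 1) \<le> 3 * real n * b"
proof -
  let ?A = "mt n (\<lambda>i j. idm i j - X i j)"
  let ?S = "{p. p permutes {0..<n}}"
  define t where "t p = (signof p :: complex) * (\<Prod>i = 0..<n. ?A $$ (i, p i))" for p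
  have b1: "b \<le> 1" using small(1) n b(2) mult_right_mono[of 1 "real n" b] by simp
  have fin: "finite ?S" by (rule finite_permutations) simp
  have id: "id \<in> ?S" by (simp add: permutes_id)
  have "det ?A = sum t ?S" unfolding t_def by (rule det_def'[OF mt_carrier])
  also have "\<dots> = t id + sum t (?S - {id})" by (rule sum.remove[OF fin id])
  finally have d: "det ?A - 1 = (t id - 1) + sum t (?S - {id})" by simp
  have "t id = (\<Prod>i = 0..<n. 1 - X (Suc i) (Suc i))"
    unfolding t_def by (simp add: idm_def)
  then have "cmod (t id - 1) \<le> (1 + b) ^ card {0..<n} - 1"
    using b by (simp only:) (rule norm_prod_minus_one_le, auto)
  also have "\<dots> \<le> 2 * (real n * b)"
  proof -
    have "(1 + b) ^ n \<le> exp b ^ n" using b(2) by (intro power_mono exp_ge_add_one_self) auto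
    also have "\<dots> = exp (real n * b)" by (simp add: exp_of_nat_mult)
    also have "\<dots> \<le> 1 + real n * b + (real n * b)\<^sup>2" using b small by (intro exp_bound) auto
    also have "(real n * b)\<^sup>2 \<le> real n * b * 1"
      unfolding power2_eq_square using b small by (intro mult_left_mono) auto
    finally show ?thesis by (simp add: mult.commute)
  qed
  finally have 1: "cmod (t id - 1) \<le> 2 * (real n * b)" .
  have entry: "cmod (?A $$ (i, j)) \<le> (if i = j then 2 else b)" "cmod (?A $$ (i, j)) \<le> 2"
    if "i < n" "j < n" for i j
  proof -
    have x: "cmod (X (Suc i) (Suc j)) \<le> b" using that by (intro b) auto
    show "cmod (?A $$ (i, j)) \<le> (if i = j then 2 else b)"
      using that x norm_triangle_ineq4[of 1 "X (Suc i) (Suc j)"] b1 by (auto simp: idm_def)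
    then show "cmod (?A $$ (i, j)) \<le> 2" using b1 by (auto split: if_splits)
  qed
  have off: "cmod (t p) \<le> 2 ^ n * b\<^sup>2" if p: "p \<in> ?S - {id}" for p
  proof -
    have perm: "p permutes {0..<n}" using p by simp
    obtain i where i: "p i \<noteq> i" using p by (auto simp: fun_eq_iff)
    then have i_n: "i < n" using perm unfolding permutes_def by (metis atLeast0LessThan lessThan_iff)
    define l where "l = p i"
    have l: "l < n" using permutes_in_image[OF perm, of i] i_n by (simp add: l_def)
    \<comment> \<open>A second displaced index: the image \<open>l\<close> of a displaced
      \<open>i\<close> cannot be fixed, by injectivity. Hence two factors of size
      \<open>b\<close>.\<close>
    have pl: "p l \<noteq> l" using i permutes_inj[OF perm] unfolding l_def by (metis injD)
    have pn: "p k < n" if "k < n" for k using permutes_in_image[OF perm, of k] that by simp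
    have il: "i \<noteq> l" using i by (simp add: l_def)
    have "cmod (t p) = (\<Prod>k\<in>{0..<n}. cmod (?A $$ (k, p k)))"
      unfolding t_def by (simp add: norm_mult prod_norm sign_def)
    also have "\<dots> \<le> (\<Prod>k\<in>{0..<n}. if k = i \<or> k = l then b else 2)"
    proof (rule prod_mono)
      fix k assume "k \<in> {0..<n}"
      then show "0 \<le> cmod (?A $$ (k, p k)) \<and> cmod (?A $$ (k, p k)) \<le> (if k = i \<or> k = l then b else 2)"
        using entry[of k "p k"] pn[of k] i pl by auto
    qed
    also have "\<dots> = b * b * (\<Prod>k\<in>{0..<n} - {i, l}. 2)"
    proof -
      have "(\<Prod>k\<in>{0..<n}. if k = i \<or> k = l then b else 2)
          = (\<Prod>k\<in>{0..<n} - {i, l}. if k = i \<or> k = l then b else 2) * (\<Prod>k\<in>{i, l}. if k = i \<or> k = l then b else 2)"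
        using i_n l by (intro prod.subset_diff) auto
      also have "(\<Prod>k\<in>{i, l}. if k = i \<or> k = l then b else 2) = b * b" using il by simp
      also have "(\<Prod>k\<in>{0..<n} - {i, l}. if k = i \<or> k = l then b else 2) = (\<Prod>k\<in>{0..<n} - {i, l}. 2)"
        by (intro prod.cong) auto
      finally show ?thesis by simp
    qed
    also have "\<dots> \<le> b * b * 2 ^ n"
    proof (rule mult_left_mono)
      have "card ({0..<n} - {i, l}) \<le> n" using card_mono[of "{0..<n}" "{0..<n} - {i, l}"] by simp
      then show "(\<Prod>k\<in>{0..<n} - {i, l}. 2) \<le> (2::real) ^ n" by (simp add: power_increasing)
    qed (use b in auto)
    finally show ?thesis by (simp add: power2_eq_square mult_ac)
  qed
  have "cmod (sum t (?S - {id})) \<le> real (card (?S - {id})) * (2 ^ n * b\<^sup>2)"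
    by (rule order_trans[OF norm_sum sum_bounded_above]) (rule off)
  also have "\<dots> \<le> fact n * (2 ^ n * b\<^sup>2)"
  proof (rule mult_right_mono)
    have "card (?S - {id}) \<le> card ?S" using fin by (intro card_mono) auto
    also have "\<dots> = fact n" using card_permutations[of "{0..<n}" n] by simp
    finally show "real (card (?S - {id})) \<le> fact n" by (metis of_nat_fact of_nat_le_iff)
  qed (use b in auto)
  \<comment> \<open>One factor \<open>b\<close> is spent against n! 2^n; the smallness hypothesis is
    made for this.\<close>
  also have "\<dots> = (fact n * 2 ^ n * b) * b" by (simp add: power2_eq_square)
  also have "\<dots> \<le> 1 * b" using small b by (intro mult_right_mono) auto
  also have "\<dots> \<le> real n * b" using n b by (intro mult_right_mono) auto
  finally have 2: "cmod (sum t (?S - {id})) \<le> real n * b" .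
  show ?thesis unfolding d using norm_triangle_ineq[of "t id - 1" "sum t (?S - {id})"] 1 2 by simp
qed

lemma poly_cheb_poly: "poly (cheb_poly n p) x = (\<Sum>i\<le>n. p i * poly (cheb i) x)"
  by (simp add: cheb_poly_def poly_sum)

text \<open>The vector \<open>t = (T\<^bsub>n-1\<^esub>, \<dots>, T\<^sub>1, T\<^sub>0 / \<surd>2)\<close> at \<open>x\<close> satisfies \<open>(xI - C) t = p(x) / 2 e\<^sub>1\<close>; the determinant is
  read off by Cramer's rule for its last component.\<close>

lemma colleague_det:
  assumes n: "2 \<le> n" and p: "p n = 1"
  shows "2 ^ (n - 1) * det (mt n (\<lambda>i j. x * idm i j - colleague n p i j)) = poly (cheb_poly n p) x"
proof -
  let ?M = "\<lambda>i j. x * idm i j - colleague n p i j"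
  let ?P = "poly (cheb_poly n p) x"
  define T where "T k = poly (cheb k) x" for k
  define t where "t i = (if i = n then of_real (1 / sqrt 2) else T (n - i))" for i
  have T: "T 0 = 1" "T (Suc 0) = x" "T (Suc (Suc k)) = 2 * x * T (Suc k) - T k" for k
    by (simp_all add: T_def)
  have s2: "1 / sqrt 2 = sqrt 2 / (2 :: real)" by (simp add: field_simps)
  have r2: "complex_of_real (sqrt 2) * complex_of_real (sqrt 2) = 2"
    by (metis of_real_mult of_real_numeral real_sqrt_mult_self abs_numeral)
  have F_row: "mvec n (colleague_F n) t i =
      (if 1 < i then colleague_F n i (i - 1) * t (i - 1) else 0) + (if i < n then colleague_F n i (Suc i) * t (Suc i) else 0)"
    if i: "i \<in> {1..n}" for i
  proof -
    have "mvec n (colleague_F n) t i = (\<Sum>j = 1..n. (if 1 < i \<and> j = i - 1 then colleague_F n i (i - 1) * t (i - 1) else 0)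
        + (if j = Suc i then colleague_F n i (Suc i) * t (Suc i) else 0))"
      unfolding mvec_def using i by (intro sum.cong) (auto simp: colleague_F_def)
    also have "\<dots> = (\<Sum>j = 1..n. if 1 < i \<and> j = i - 1 then colleague_F n i (i - 1) * t (i - 1) else 0)
        + (\<Sum>j = 1..n. if j = Suc i then colleague_F n i (Suc i) * t (Suc i) else 0)"
      by (rule sum.distrib)
    also have "(\<Sum>j = 1..n. if 1 < i \<and> j = i - 1 then colleague_F n i (i - 1) * t (i - 1) else 0)
        = (if 1 < i then colleague_F n i (i - 1) * t (i - 1) else 0)"
      using i by (cases "1 < i") auto
    also have "(\<Sum>j = 1..n. if j = Suc i then colleague_F n i (Suc i) * t (Suc i) else 0)
        = (if i < n then colleague_F n i (Suc i) * t (Suc i) else 0)"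
      using i by auto
    finally show ?thesis .
  qed
  have Ft: "x * t i - mvec n (colleague_F n) t i = (if i = 1 then T n / 2 else 0)" if i: "i \<in> {1..n}" for i
  proof -
    \<comment> \<open>The last two rows involve the scaled last component and the entry sqrt 2 / 2;
      in the others the three-term recurrence appears directly. Row 1 has no left neighbour, which
      leaves T_n / 2.\<close>
    have "i = n \<or> Suc i = n \<or> n = i + Suc (Suc (n - i - 2))" using i by auto
    then consider "i = n" | "Suc i = n" | k where "n = i + Suc (Suc k)" by blast
    then show ?thesis
    proof cases
      case 1
      have "n - 1 \<noteq> n" "n - (n - 1) = Suc 0" using n by auto
      then have "t (n - 1) = x" using T(2) unfolding t_def by (simp only: if_False)
      moreover have "colleague_F n n (n - 1) = of_real (sqrt 2 / 2)" using n by (auto simp: colleague_F_def)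
      ultimately have "mvec n (colleague_F n) t n = of_real (sqrt 2 / 2) * x"
        using F_row[OF i] n 1 by simp
      moreover have "t n = of_real (sqrt 2 / 2)"
        unfolding t_def s2 by simp
      ultimately have "x * t n = mvec n (colleague_F n) t n" by (simp only: mult.commute)
      then show ?thesis using 1 n by simp
    next
      case 2
      have a: "n - i = Suc 0" "i \<noteq> n" "1 < i \<Longrightarrow> n - (i - 1) = Suc (Suc 0)" "i - 1 \<noteq> n"
        using 2 i by auto
      have T2: "T (Suc (Suc 0)) = 2 * x * x - 1" using T by simp
      have ti: "t i = x" using a T(2) by (simp add: t_def)
      have "colleague_F n i (Suc i) * t (Suc i) = of_real (sqrt 2 / 2) * of_real (sqrt 2 / 2)"
        using 2 i unfolding t_def s2 by (simp add: colleague_F_def)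
      also have "\<dots> = 1 / 2" using r2 by simp
      finally have tn: "colleague_F n i (Suc i) * t (Suc i) = 1 / 2" .
      have tm: "colleague_F n i (i - 1) * t (i - 1) = (2 * x * x - 1) / 2" if "1 < i"
        using a(3)[OF that] a(2,4) that 2 T2 unfolding t_def by (auto simp: colleague_F_def max_def)
      show ?thesis
      proof (cases "i = 1")
        case True
        then have "T n = 2 * x * x - 1" using 2 T2 by (metis One_nat_def)
        then show ?thesis using F_row[OF i] True tn ti 2 by (simp add: diff_divide_distrib)
      next
        case False
        then have "1 < i" using i by auto
        then show ?thesis using F_row[OF i] tm tn ti 2 False by (simp add: diff_divide_distrib)
      qed
    next
      case 3
      have a: "n - i = Suc (Suc k)" "n - Suc i = Suc k" "1 < i \<Longrightarrow> n - (i - Suc 0) = Suc (Suc (Suc k))"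
        "i = 1 \<Longrightarrow> n = Suc (Suc (Suc k))"
        using 3 i by auto
      have b: "i \<noteq> n" "Suc i \<noteq> n" "i - Suc 0 \<noteq> n" using 3 by auto
      show ?thesis
        using F_row[OF i] T(3)[of "Suc k"] i a b 3
        by (cases "i = 1") (auto simp: colleague_F_def t_def max_def numeral_3_eq_3 diff_divide_distrib)
    qed
  qed
  have vt: "(\<Sum>j = 1..n. colleague_vstar n p j * t j) = - (\<Sum>i<n. p i * T i) / 2"
  proof -
    have "colleague_vstar n p j * t j = - (p (n - j) * T (n - j)) / 2" if "j \<in> {1..n}" for j
      using that p r2 T(1) by (auto simp: colleague_vstar_def t_def field_simps)
    then have "(\<Sum>j = 1..n. colleague_vstar n p j * t j) = (\<Sum>j = 1..n. - (p (n - j) * T (n - j)) / 2)"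
      by (intro sum.cong) auto
    also have "\<dots> = (\<Sum>i<n. - (p i * T i) / 2)"
      by (rule sum.reindex_bij_witness[of _ "\<lambda>i. n - i" "\<lambda>i. n - i"]) auto
    finally show ?thesis by (simp add: sum_negf sum_divide_distrib)
  qed
  have Mt: "mvec n ?M t i = (if i = 1 then ?P / 2 else 0)" if i: "i \<in> {1..n}" for i
  proof -
    have "mvec n ?M t i = x * mvec n idm t i - (mvec n (colleague_F n) t i
        + colleague_u i * (\<Sum>j = 1..n. colleague_vstar n p j * t j))"
      by (simp add: mvec_def colleague_def colleague_v_def sum_distrib_left algebra_simps sum.distrib sum_subtractf)
    also have "\<dots> = (if i = 1 then T n / 2 else 0) - colleague_u i * (- (\<Sum>i<n. p i * T i) / 2)"
      unfolding vt mvec_idm[OF i] diff_diff_eq[symmetric] Ft[OF i] ..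
    also have "\<dots> = (if i = 1 then ((\<Sum>i<n. p i * T i) + T n) / 2 else 0)"
      by (simp add: colleague_u_def add_divide_distrib)
    also have "(\<Sum>i<n. p i * T i) + T n = ?P"
      using p unfolding poly_cheb_poly T_def by (simp add: lessThan_Suc_atMost[symmetric])
    finally show ?thesis .
  qed
  let ?A = "mt n ?M"
  let ?t = "vec n (\<lambda>i. t (Suc i))"
  define R where "R = replace_col ?A (?A *\<^sub>v ?t) (n - 1)"
  have nn: "n - 1 < n" "0 < n" using n by auto
  have R: "R \<in> carrier_mat n n" by (simp add: R_def replace_col_def)
  have cram: "det R = t n * det ?A"
    unfolding R_def using cramer_lemma_mat[of ?A n ?t "n - 1"] nn by simp
  have Rcol: "R $$ (i, n - 1) = (if i = 0 then ?P / 2 else 0)" if "i < n" for i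
    using that nn Mt[of "Suc i"] by (simp add: R_def replace_col_def mt_mult_vec)
  have Rrest: "R $$ (i, j) = ?M (Suc i) (Suc j)" if "i < n" "j < n - 1" for i j
    using that by (simp add: R_def replace_col_def)
  have "det R = (\<Sum>i<n. R $$ (i, n - 1) * cofactor R i (n - 1))"
    by (rule laplace_expansion_column[OF R nn(1)])
  also have "\<dots> = (\<Sum>i<n. if i = 0 then ?P / 2 * cofactor R 0 (n - 1) else 0)"
  proof (rule sum.cong[OF refl])
    fix i assume "i \<in> {..<n}"
    then have "i < n" by simp
    then show "R $$ (i, n - 1) * cofactor R i (n - 1) = (if i = 0 then ?P / 2 * cofactor R 0 (n - 1) else 0)"
      unfolding Rcol[OF \<open>i < n\<close>] by simp
  qed
  also have "\<dots> = ?P / 2 * cofactor R 0 (n - 1)" using nn by simp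
  finally have det1: "det R = ?P / 2 * cofactor R 0 (n - 1)" .
  \<comment> \<open>Without the first row and the last column, the subdiagonal of xI - C becomes the
    diagonal of an upper triangular matrix: -1/2 throughout and -sqrt 2 / 2 at the end.\<close>
  let ?D = "mat_delete R 0 (n - 1)"
  have Dc: "?D \<in> carrier_mat (n - 1) (n - 1)" using R by (simp add: mat_delete_def)
  have Dij: "?D $$ (i, j) = ?M (Suc (Suc i)) (Suc j)" if "i < n - 1" "j < n - 1" for i j
    using that R Rrest[of "Suc i" j] by (simp add: mat_delete_def)
  have "upper_triangular ?D"
    unfolding upper_triangular_def
  proof (intro allI impI)
    fix i j assume i: "i < dim_row ?D" and j: "j < i"
    have "i < n - 1" using i unfolding carrier_matD(1)[OF Dc] .
    then show "?D $$ (i, j) = 0"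
      using j Dij[of i j] by (simp add: idm_def colleague_def colleague_F_def colleague_u_def)
  qed
  then have "det ?D = prod_list (diag_mat ?D)" using Dc by (rule det_upper_triangular)
  also have "\<dots> = (\<Prod>i = 0..<n - 1. ?D $$ (i, i))" 
    unfolding prod_list_diag_prod carrier_matD(1)[OF Dc] ..
  also have "\<dots> = (\<Prod>i = 0..<n - 1. (- 1) * (if i = n - 2 then of_real (sqrt 2 / 2) else 1 / 2))"
  proof (rule prod.cong[OF refl])
    fix i assume "i \<in> {0..<n - 1}"
    then show "?D $$ (i, i) = (- 1) * (if i = n - 2 then of_real (sqrt 2 / 2) else 1 / 2)"
      using Dij[of i i] n by (auto simp: idm_def colleague_def colleague_F_def colleague_u_def max_def)
  qed
  also have "\<dots> = (- 1) ^ (n - 1) * (\<Prod>i = 0..<n - 1. if i = n - 2 then of_real (sqrt 2 / 2) else 1 / 2)"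
    unfolding prod.distrib by simp
  also have "(\<Prod>i = 0..<n - 1. if i = n - 2 then complex_of_real (sqrt 2 / 2) else 1 / 2)
      = (1 / 2) ^ (n - 2) * of_real (sqrt 2 / 2)"
  proof -
    have "n - 1 = Suc (n - 2)" using n by simp
    then have "(\<Prod>i = 0..<n - 1. if i = n - 2 then complex_of_real (sqrt 2 / 2) else 1 / 2)
        = (\<Prod>i = 0..<n - 2. if i = n - 2 then complex_of_real (sqrt 2 / 2) else 1 / 2) * of_real (sqrt 2 / 2)"
      by simp
    also have "(\<Prod>i = 0..<n - 2. if i = n - 2 then complex_of_real (sqrt 2 / 2) else 1 / 2)
        = (\<Prod>i = 0..<n - 2. 1 / 2)" by (intro prod.cong) auto
    finally show ?thesis by simp
  qed
  finally have detD: "det ?D = (- 1) ^ (n - 1) * ((1 / 2) ^ (n - 2) * of_real (sqrt 2 / 2))" .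
  have "(- 1 :: complex) ^ (n - 1) * (- 1) ^ (n - 1) = 1"
    by (simp add: power_mult_distrib[symmetric])
  then have cof: "cofactor R 0 (n - 1) = (1 / 2) ^ (n - 2) * of_real (sqrt 2 / 2)"
    unfolding cofactor_def detD by (simp add: mult.assoc[symmetric])
  let ?h = "complex_of_real (sqrt 2 / 2)"
  have tn: "t n = ?h" unfolding t_def s2 by simp
  have "?h * det ?A = ?P / 2 * ((1 / 2) ^ (n - 2) * ?h)"
    using cram unfolding det1 cof tn by (rule sym)
  also have "\<dots> = ?h * (?P / 2 * (1 / 2) ^ (n - 2))" by (simp only: mult_ac)
  finally have eq: "?h * det ?A = ?h * (?P / 2 * (1 / 2) ^ (n - 2))" .
  have "?h \<noteq> 0" by simp
  then have "det ?A = ?P / 2 * (1 / 2) ^ (n - 2)" by (rule mult_left_cancel[THEN iffD1, OF _ eq])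
  moreover have "(2::complex) ^ (n - 1) = 2 * 2 ^ (n - 2)"
    using n by (metis Suc_diff_le diff_Suc_Suc numeral_2_eq_2 One_nat_def power_Suc)
  ultimately show ?thesis by (simp add: power_divide)
qed

lemma poly_char_poly_mt: "poly (char_poly (mt n X)) x = det (mt n (\<lambda>i j. x * idm i j - X i j))"
proof -
  have "- char_matrix (mt n X) x = mt n (\<lambda>i j. x * idm i j - X i j)"
    by (intro eq_matI) (auto simp: char_matrix_def idm_def)
  then show ?thesis unfolding char_poly_matrix[OF mt_carrier] by simp
qed

lemma char_poly_colleague:
  assumes "2 \<le> n" "p n = 1"
  shows "Polynomial.smult (2 ^ (n - 1)) (char_poly (mt n (colleague n p))) = cheb_poly n p"
proof -
  have "poly (Polynomial.smult (2 ^ (n - 1)) (char_poly (mt n (colleague n p)))) x = poly (cheb_poly n p) x" for x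
    using colleague_det[of n p x, OF assms] by (simp add: poly_char_poly_mt)
  then show ?thesis by (simp add: poly_eq_poly_eq_iff[symmetric] fun_eq_iff)
qed

section \<open>Chebyshev coefficients\<close>

lemma poly_cheb_joukowski:
  assumes "z \<noteq> 0"
  shows "poly (cheb k) ((z + inverse z) / 2) = (z ^ k + inverse z ^ k) / 2"
proof (induction k rule: cheb.induct)
  case (3 k)
  have zi: "z * inverse z = 1" using assms by simp
  have "z ^ Suc (Suc k) + inverse z ^ Suc (Suc k)
      = (z + inverse z) * (z ^ Suc k + inverse z ^ Suc k) - (z * inverse z) * (z ^ k + inverse z ^ k)"
    by (simp add: algebra_simps)
  moreover have "poly (cheb (Suc (Suc k))) ((z + inverse z) / 2)
      = (z + inverse z) * poly (cheb (Suc k)) ((z + inverse z) / 2) - poly (cheb k) ((z + inverse z) / 2)"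
    by simp
  ultimately show ?case unfolding 3 zi by (simp add: diff_divide_distrib)
qed (use assms in simp_all)

lemma degree_cheb: "degree (cheb k) \<le> k \<and> coeff (cheb k) k = (if k = 0 then 1 else 2 ^ (k - 1))"
proof (induction k rule: cheb.induct)
  case (3 k)
  have "degree ([:0, 2:] * cheb (Suc k)) \<le> Suc (Suc k)"
    using 3 degree_mult_le[of "[:0, 2:] :: complex poly" "cheb (Suc k)"] by simp
  then have "degree (cheb (Suc (Suc k))) \<le> Suc (Suc k)"
    using 3 by (simp only: cheb.simps) (intro degree_diff_le, auto)
  moreover have "coeff (cheb k) (Suc (Suc k)) = 0" using 3 by (intro coeff_eq_0) auto
  ultimately show ?case using 3 by (simp add: coeff_pCons)
qed simp_all

text \<open>\<open>cheb (Suc m)\<close> has leading coefficient 2^m; subtracting a suitable multiple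
  of it lowers the degree.\<close>

lemma cheb_poly_exists:
  assumes "degree r \<le> m"
  shows "\<exists>a. r = cheb_poly m a"
  using assms
proof (induction m arbitrary: r)
  case 0
  then obtain c where "r = [:c:]" by (metis degree_eq_zeroE le_zero_eq)
  then have "r = cheb_poly 0 (\<lambda>_. c)" by (simp add: cheb_poly_def)
  then show ?case by blast
next
  case (Suc m)
  define c where "c = coeff r (Suc m) / 2 ^ m"
  define r' where "r' = r - Polynomial.smult c (cheb (Suc m))"
  have "degree r' \<le> m"
  proof (rule degree_le, intro allI impI)
    fix i assume "m < i"
    then consider "i = Suc m" | "Suc m < i" by linarith
    then show "coeff r' i = 0"
    proof cases
      case 1
      then show ?thesis using degree_cheb[of "Suc m"] by (simp add: r'_def c_def del: cheb.simps)
    next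
      case 2
      then show ?thesis
        using Suc.prems degree_cheb[of "Suc m"] by (simp add: r'_def coeff_eq_0 del: cheb.simps)
    qed
  qed
  then obtain a where a: "r' = cheb_poly m a" using Suc.IH by blast
  have "r = cheb_poly (Suc m) (a(Suc m := c))"
  proof -
    have "(\<Sum>i\<le>m. Polynomial.smult ((a(Suc m := c)) i) (cheb i)) = cheb_poly m a"
      unfolding cheb_poly_def by (intro sum.cong) auto
    then show ?thesis using a by (simp add: cheb_poly_def r'_def del: cheb.simps) (simp add: algebra_simps)
  qed
  then show ?case by blast
qed

lemma sum_roots_of_unity:
  assumes "\<not> N dvd e" "0 < N"
  shows "(\<Sum>m<N. (cis (2 * pi / real N) ^ m) ^ e) = 0"
proof -
  let ?w = "cis (2 * pi / real N)"
  have N: "?w ^ N = 1" using assms(2) by (simp add: Complex.DeMoivre)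
  have ne: "?w ^ e \<noteq> 1"
  proof
    assume "?w ^ e = 1"
    then have "cis (real e * (2 * pi / real N)) = 1" by (simp add: Complex.DeMoivre)
    then have "cos (real e * (2 * pi / real N)) = 1" by (metis cis.sel(1) one_complex.sel(1))
    then obtain k :: int where "real e * (2 * pi / real N) = real_of_int k * 2 * pi"
      using cos_one_2pi_int by blast
    then have "real e = real_of_int k * real N" using assms(2) by (simp add: field_simps)
    then have "int e = k * int N" by (metis of_int_eq_iff of_int_mult of_int_of_nat_eq)
    then have "int N dvd int e" by simp
    then show False using assms(1) by (simp add: int_dvd_int_iff)
  qed
  have "(\<Sum>m<N. (?w ^ m) ^ e) = (\<Sum>m<N. (?w ^ e) ^ m)"
    by (simp add: power_mult[symmetric] mult.commute)
  also have "\<dots> = ((?w ^ e) ^ N - 1) / (?w ^ e - 1)" using ne by (rule geometric_sum)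
  also have "(?w ^ e) ^ N = 1" using N by (metis power_mult mult.commute power_one)
  finally show ?thesis by simp
qed

text \<open>On the circle \<open>\<bar>z\<bar> = \<rho>\<close> the polynomial is a Laurent polynomial in \<open>z\<close>; its coefficients are recovered by
  a discrete Fourier transform with more than \<open>2n\<close> nodes, which excludes aliasing.\<close>

lemma cheb_coeff_le:
  assumes M: "\<And>z. cmod z = \<rho> \<Longrightarrow> cmod (poly (cheb_poly n a) ((z + inverse z) / 2)) \<le> M"
    and \<rho>: "1 \<le> \<rho>" and k: "k \<le> n"
  shows "cmod (a k) \<le> 2 * M"
proof -
  define N where "N = 2 * n + 1"
  define w where "w = cis (2 * pi / real N)"
  define z where "z m = of_real \<rho> * w ^ m" for m
  let ?r = "complex_of_real \<rho>"
  have N: "0 < N" by (simp add: N_def)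
  have wN: "w ^ N = 1" using N by (simp add: w_def Complex.DeMoivre)
  have w0: "w \<noteq> 0" by (simp add: w_def)
  have cw: "cmod w = 1" by (simp add: w_def)
  have r0: "?r \<noteq> 0" using \<rho> by auto
  have z0: "z m \<noteq> 0" for m using w0 r0 by (simp add: z_def)
  have cz: "cmod (z m) = \<rho>" for m using \<rho> cw by (simp add: z_def norm_mult norm_power)
  \<comment> \<open>Negative powers are written with the exponent N - i, so that all exponents are
    natural numbers and one orthogonality relation serves both halves of the Laurent
    polynomial.\<close>
  have iw: "inverse (w ^ m) ^ i = (w ^ m) ^ (N - i)" if "i \<le> N" for m i
  proof -
    have "(w ^ m) ^ (N - i) * (w ^ m) ^ i = (w ^ m) ^ N"
      using that by (simp flip: power_add)
    also have "\<dots> = (w ^ N) ^ m" by (metis power_mult mult.commute)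
    also have "\<dots> = 1" by (simp add: wN)
    finally show ?thesis using w0 by (simp add: power_inverse field_simps)
  qed
  have tm: "(w ^ m) ^ (N - k) * poly (cheb i) ((z m + inverse (z m)) / 2)
      = (?r ^ i * (w ^ m) ^ (N - k + i) + inverse ?r ^ i * (w ^ m) ^ (N - k + (N - i))) / 2"
    if i: "i \<le> n" for i m
  proof -
    have iN: "i \<le> N" using i by (simp add: N_def)
    have "poly (cheb i) ((z m + inverse (z m)) / 2) = (?r ^ i * (w ^ m) ^ i + inverse ?r ^ i * (w ^ m) ^ (N - i)) / 2"
      unfolding poly_cheb_joukowski[OF z0] unfolding z_def
      using iw[OF iN, of m] by (simp add: power_mult_distrib inverse_mult_distrib)
    then show ?thesis by (simp add: power_add algebra_simps add_divide_distrib)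
  qed
  have S: "(\<Sum>m<N. (w ^ m) ^ e) = (if N dvd e then of_nat N else 0)" for e
  proof (cases "N dvd e")
    case True
    then obtain q where "e = N * q" by blast
    then have "(w ^ m) ^ e = 1" for m
      using wN by (metis mult.commute power_mult power_one)
    then show ?thesis using True by simp
  next
    case False
    then show ?thesis using sum_roots_of_unity[OF False N] by (simp add: w_def)
  qed
  have d1: "N dvd N - k + i \<longleftrightarrow> i = k" if "i \<le> n" for i
  proof
    assume "N dvd N - k + i"
    then obtain q where q: "N - k + i = N * q" by blast
    have "N - k + i < N * 2" "0 < N - k + i" using that k by (auto simp: N_def)
    then have "N * q < N * 2" "0 < N * q" unfolding q by simp_all
    then have "q < 2" "0 < q" by simp_all
    then have "q = 1" by simp
    then show "i = k" using q k that by (simp add: N_def)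
  qed (use k in \<open>simp add: N_def\<close>)
  \<comment> \<open>Since i, k \<le> n and N = 2 n + 1, the exponent lies above N and is at most 2
    N; so the half with negative powers contributes only through its constant term.\<close>
  have d2: "N dvd N - k + (N - i) \<longleftrightarrow> i = 0 \<and> k = 0" if "i \<le> n" for i
  proof
    assume "N dvd N - k + (N - i)"
    then obtain q where q: "N - k + (N - i) = N * q" by blast
    have "N * 1 < N - k + (N - i)" using that k by (auto simp: N_def)
    then have "N * 1 < N * q" unfolding q .
    then have "1 < q" by simp
    then have "N * 2 \<le> N - k + (N - i)" unfolding q by (intro mult_le_mono2) simp
    then show "i = 0 \<and> k = 0" using that k by (auto simp: N_def)
  qed (auto intro: dvd_add)
  have "(\<Sum>m<N. (w ^ m) ^ (N - k) * poly (cheb_poly n a) ((z m + inverse (z m)) / 2))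
      = (\<Sum>m<N. \<Sum>i\<le>n. a i * ((w ^ m) ^ (N - k) * poly (cheb i) ((z m + inverse (z m)) / 2)))"
    unfolding poly_cheb_poly sum_distrib_left by (simp only: mult.left_commute)
  also have "\<dots> = (\<Sum>m<N. \<Sum>i\<le>n. a i * ((?r ^ i * (w ^ m) ^ (N - k + i) + inverse ?r ^ i * (w ^ m) ^ (N - k + (N - i))) / 2))"
    by (intro sum.cong refl) (simp only: tm atMost_iff)
  also have "\<dots> = (\<Sum>i\<le>n. \<Sum>m<N. a i * ((?r ^ i * (w ^ m) ^ (N - k + i) + inverse ?r ^ i * (w ^ m) ^ (N - k + (N - i))) / 2))"
    by (rule sum.swap)
  also have "\<dots> = (\<Sum>i\<le>n. a i * ((?r ^ i * (\<Sum>m<N. (w ^ m) ^ (N - k + i))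
      + inverse ?r ^ i * (\<Sum>m<N. (w ^ m) ^ (N - k + (N - i)))) / 2))"
    by (simp only: sum_distrib_left[symmetric] sum_divide_distrib[symmetric] sum.distrib)
  \<comment> \<open>For k = 0 both halves of T_0 = (1 + 1) / 2 contribute, which doubles the
    coefficient.\<close>
  also have "\<dots> = (\<Sum>i\<le>n. if i = k then a k * of_nat N * (?r ^ k + (if k = 0 then 1 else 0)) / 2 else 0)"
  proof (rule sum.cong[OF refl])
    fix i assume "i \<in> {..n}"
    then have i: "i \<le> n" by simp
    show "a i * ((?r ^ i * (\<Sum>m<N. (w ^ m) ^ (N - k + i)) + inverse ?r ^ i * (\<Sum>m<N. (w ^ m) ^ (N - k + (N - i)))) / 2)
        = (if i = k then a k * of_nat N * (?r ^ k + (if k = 0 then 1 else 0)) / 2 else 0)"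
      unfolding S d1[OF i] d2[OF i] by (auto simp: algebra_simps)
  qed
  also have "\<dots> = a k * of_nat N * (?r ^ k + (if k = 0 then 1 else 0)) / 2" using k by simp
  finally have eq: "(\<Sum>m<N. (w ^ m) ^ (N - k) * poly (cheb_poly n a) ((z m + inverse (z m)) / 2))
      = a k * of_nat N * (?r ^ k + (if k = 0 then 1 else 0)) / 2" .
  have "cmod (\<Sum>m<N. (w ^ m) ^ (N - k) * poly (cheb_poly n a) ((z m + inverse (z m)) / 2)) \<le> (\<Sum>m<N. M)"
    by (rule order_trans[OF norm_sum sum_mono]) (use M cz cw in \<open>simp add: norm_mult norm_power\<close>)
  also have "\<dots> = real N * M" by simp
  finally have le: "cmod (a k * of_nat N * (?r ^ k + (if k = 0 then 1 else 0)) / 2) \<le> real N * M" unfolding eq .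
  have one: "1 \<le> cmod (?r ^ k + (if k = 0 then 1 else 0))"
    using \<rho> by (auto simp: norm_power one_le_power)
  have "cmod (a k) * real N * 1 / 2 \<le> cmod (a k) * real N * cmod (?r ^ k + (if k = 0 then 1 else 0)) / 2"
    using one by (intro divide_right_mono mult_left_mono) auto
  also have "\<dots> \<le> real N * M" using le by (simp only: norm_mult norm_divide norm_of_nat norm_numeral)
  finally have "cmod (a k) / 2 \<le> M" using N by simp
  then show ?thesis by simp
qed

text \<open>With t = (w + 1/w) / 2 for \<open>w\<close> on the unit circle, x - t = (z - w) (z - cnj
  w) / (2 z), and both factors have modulus at least \<bar>z\<bar> - 1 = 1/n.\<close>

lemma ellipse_dist:
  fixes n :: nat
  assumes n: "1 \<le> n" and z: "cmod z = 1 + 1 / real n" and t: "-1 \<le> t" "t \<le> (1::real)"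
  shows "1 / (2 * real n * (real n + 1)) \<le> cmod ((z + inverse z) / 2 - of_real t)"
proof -
  define w where "w = cis (arccos t)"
  have "0 < cmod z" unfolding z by (simp add: add_pos_nonneg)
  then have z0: "z \<noteq> 0" by auto
  have w: "w + cnj w = 2 * of_real t" "w * cnj w = 1"
    using t by (simp_all add: w_def cis_cnj cis_mult complex_eq_iff cos_arccos)
  have "(z - w) * (z - cnj w) = z * z - (w + cnj w) * z + w * cnj w" by (simp add: algebra_simps)
  then have "(z + inverse z) / 2 - of_real t = (z - w) * (z - cnj w) / (2 * z)"
    using z0 by (simp add: w field_simps)
  then have eq: "cmod ((z + inverse z) / 2 - of_real t) = cmod (z - w) * cmod (z - cnj w) / (2 * cmod z)"
    by (simp add: norm_mult norm_divide)
  have "cmod w = 1" by (simp add: w_def)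
  then have a: "1 / real n \<le> cmod (z - w)" "1 / real n \<le> cmod (z - cnj w)"
    using norm_triangle_ineq2[of z w] norm_triangle_ineq2[of z "cnj w"] z by simp_all
  have "1 / real n * (1 / real n) / (2 * (1 + 1 / real n)) \<le> cmod (z - w) * cmod (z - cnj w) / (2 * (1 + 1 / real n))"
    using a by (intro divide_right_mono mult_mono) auto
  moreover have "1 / real n * (1 / real n) / (2 * (1 + 1 / real n)) = 1 / (2 * real n * (real n + 1))"
    using n by (simp add: field_simps)
  ultimately show ?thesis unfolding eq z by linarith
qed

text \<open>The radius 1 + 1/n is a compromise: \<bar>z\<bar>^n \<le> e \<le> 3 keeps T_n bounded,
  while the distance to [-1, 1] is only polynomially small in n.\<close>

lemma cheb_ellipse_le:
  fixes n :: nat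
  assumes n: "1 \<le> n" and z: "cmod z = 1 + 1 / real n"
  shows "cmod (poly (cheb n) ((z + inverse z) / 2)) \<le> 2"
proof -
  have "0 < cmod z" unfolding z by (simp add: add_pos_nonneg)
  then have z0: "z \<noteq> 0" by auto
  have "(1 + 1 / real n) ^ n \<le> exp (1 / real n) ^ n" by (intro power_mono exp_ge_add_one_self) auto
  also have "\<dots> = exp 1" using n by (simp add: exp_of_nat_mult[symmetric])
  also have "\<dots> \<le> 3" by (rule exp_le)
  finally have 1: "cmod (z ^ n) \<le> 3" by (simp add: norm_power z)
  have "inverse (1 + 1 / real n) \<le> 1" using le_imp_inverse_le[of 1 "1 + 1 / real n"] by simp
  then have "inverse (1 + 1 / real n) ^ n \<le> 1" by (intro power_le_one) simp_all
  then have "cmod (inverse z ^ n) \<le> 1" by (simp add: norm_power norm_inverse z)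
  then show ?thesis
    unfolding poly_cheb_joukowski[OF z0]
    using 1 norm_triangle_ineq[of "z ^ n" "inverse z ^ n"] by (simp add: norm_divide)
qed

section \<open>Perturbation of the characteristic polynomial\<close>

lemma ctrans_colleague_F: "ctrans (colleague_F n) = colleague_F n"
  by (auto simp: ctrans_def colleague_F_def fun_eq_iff max.commute)

text \<open>The numerical range of \<open>F\<close> is contained in the interval \<open>[-1, 1]\<close>.\<close>

lemma shifted_lower_bound:
  assumes x: "\<And>t. -1 \<le> t \<Longrightarrow> t \<le> 1 \<Longrightarrow> d \<le> cmod (x - of_real t)" and E: "op_le n E \<eta>"
  shows "(d - \<eta>) * vnorm {1..n} y
    \<le> vnorm {1..n} (mvec n (\<lambda>i j. x * idm i j - colleague_F n i j - E i j) y)"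
proof (cases "vnorm {1..n} y = 0")
  case True
  then show ?thesis by simp
next
  case False
  let ?v = "vnorm {1..n} y" and ?F = "colleague_F n"
  let ?M = "\<lambda>i j. x * idm i j - colleague_F n i j - E i j"
  have v: "0 < ?v" using False by (simp add: order_less_le)
  define r where "r = dot n y (mvec n ?F y)"
  have "cnj r = r"
    unfolding r_def dot_cnj dot_mvec_ctrans ctrans_colleague_F ..
  then have r: "r = of_real (Re r)" by (simp add: complex_eq_iff)
  have "cmod r \<le> ?v * ?v" unfolding r_def using op_leD[OF op_le_colleague_F, of n y y] by simp
  then have rv: "\<bar>Re r\<bar> \<le> ?v\<^sup>2" using r by (metis norm_of_real power2_eq_square)
  \<comment> \<open>The Rayleigh quotient of \<open>y\<close>, real because F is Hermitian; it is
    the point of [-1, 1] from which the distance of \<open>x\<close> is taken.\<close>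
  define t where "t = Re r / ?v\<^sup>2"
  have t: "-1 \<le> t" "t \<le> 1" using rv v by (auto simp: t_def field_simps abs_le_iff)
  have rt: "r = of_real t * of_real (?v\<^sup>2)" using v r by (simp add: t_def flip: of_real_mult)
  have "dot n y (mvec n ?M y) = x * dot n y (mvec n idm y) - r - dot n y (mvec n E y)"
  proof -
    have "dot n y (mvec n (\<lambda>i j. x * idm i j) y) = x * dot n y (mvec n idm y)"
      by (simp add: mvec_def dot_def sum_distrib_left mult_ac)
    then show ?thesis unfolding mvec_diff dot_diff r_def by simp
  qed
  also have "dot n y (mvec n idm y) = of_real (?v\<^sup>2)"
    unfolding dot_self[symmetric] by (intro dot_cong) (auto simp: mvec_idm)
  finally have eq: "dot n y (mvec n ?M y) = (x - of_real t) * of_real (?v\<^sup>2) - dot n y (mvec n E y)"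
    by (simp add: rt algebra_simps)
  have "cmod (x - of_real t) * ?v\<^sup>2 = cmod ((x - of_real t) * of_real (?v\<^sup>2))"
    by (simp add: norm_mult norm_power)
  also have "\<dots> \<le> cmod (dot n y (mvec n ?M y)) + cmod (dot n y (mvec n E y))"
    using norm_triangle_ineq[of "dot n y (mvec n ?M y)" "dot n y (mvec n E y)"] unfolding eq by simp
  also have "\<dots> \<le> ?v * vnorm {1..n} (mvec n ?M y) + \<eta> * (?v * ?v)"
    using cmod_dot_le[of n y "mvec n ?M y"] op_leD[OF E, of y y] by (intro add_mono)
  finally have "cmod (x - of_real t) * ?v\<^sup>2 \<le> ?v * vnorm {1..n} (mvec n ?M y) + \<eta> * (?v * ?v)" .
  moreover have "d * ?v\<^sup>2 \<le> cmod (x - of_real t) * ?v\<^sup>2" using x[OF t] by (intro mult_right_mono) auto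
  ultimately have "?v * ((d - \<eta>) * ?v) \<le> ?v * vnorm {1..n} (mvec n ?M y)"
    by (simp add: power2_eq_square algebra_simps)
  then show ?thesis using v by (simp only: mult_le_cancel_left_pos)
qed

text \<open>Both determinants are divided by that of M = xI - F. The unperturbed one gives 1 - w0,
  the perturbed one d (1 - w1), where d = det (I - Z E) with \<open>Z\<close> inverse to M is within
  3 n \<kappa> \<eta> of 1, and \<bar>1 - w1\<bar> \<le> 9 S \<kappa>. Their product accounts for
  27; the change of w adds 4 for \<open>E\<close> and 5 for the vectors. Every term has just one
  factor S.\<close>

lemma det_perturbation:
  fixes \<kappa> :: real
  assumes n: "1 \<le> n" and x: "\<And>t. -1 \<le> t \<Longrightarrow> t \<le> 1 \<Longrightarrow> 1 / \<kappa> \<le> cmod (x - of_real t)" and \<kappa>: "1 \<le> \<kappa>"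
    and E: "op_le n E \<eta>" "0 \<le> \<eta>" "2 * \<kappa> * \<eta> \<le> 1" "real n * (\<kappa> * \<eta>) \<le> 1" "fact n * 2 ^ n * (\<kappa> * \<eta>) \<le> 1"
    and u: "vnorm {1..n} u \<le> 1" "vnorm {1..n} (\<lambda>i. u' i - u i) \<le> \<mu>" "\<mu> \<le> 1"
    and v: "vnorm {1..n} (\<lambda>i. v' i - v i) \<le> \<mu> * S" "vnorm {1..n} v \<le> S" "1 \<le> S"
  shows "cmod (det (mt n (\<lambda>i j. x * idm i j - (colleague_F n i j + E i j + u' i * cnj (v' j))))
       - det (mt n (\<lambda>i j. x * idm i j - (colleague_F n i j + u i * cnj (v j)))))
     \<le> cmod (det (mt n (\<lambda>i j. x * idm i j - colleague_F n i j))) * (S * \<kappa>\<^sup>2 * (31 * real n * \<eta> + 5 * \<mu>))"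
proof -
  let ?M = "\<lambda>i j. x * idm i j - colleague_F n i j"
  let ?N = "\<lambda>i j. ?M i j - E i j"
  let ?V = "vnorm {1..n}"
  have \<mu>: "0 \<le> \<mu>" using u(2) vnorm_nonneg order_trans by blast
  have \<kappa>0: "0 < \<kappa>" using \<kappa> by simp
  have zero: "op_le n (\<lambda>i j. 0) 0" by (simp add: op_le_def mvec_def dot_def)
  have M: "?V y \<le> \<kappa> * ?V (mvec n ?M y)" for y
    using shifted_lower_bound[OF x zero, of y] \<kappa>0 by (simp add: field_simps)
  have N: "?V y \<le> 2 * \<kappa> * ?V (mvec n ?N y)" for y
  proof -
    \<comment> \<open>2 \<kappa> \<eta> \<le> 1 leaves at least half of the distance to the
      numerical range.\<close>
    have "1 / (2 * \<kappa>) \<le> 1 / \<kappa> - \<eta>" using E(3) \<kappa>0 by (simp add: field_simps)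
    then have "1 / (2 * \<kappa>) * ?V y \<le> (1 / \<kappa> - \<eta>) * ?V y" by (rule mult_right_mono) simp
    also have "\<dots> \<le> ?V (mvec n ?N y)" by (rule shifted_lower_bound[OF x E(1)])
    finally have "1 / (2 * \<kappa>) * ?V y \<le> ?V (mvec n ?N y)" .
    then show ?thesis using \<kappa>0 by (simp add: field_simps)
  qed
  have dM: "det (mt n ?M) \<noteq> 0" using M by (rule det_mt_nonzero)
  obtain Z where Z: "\<And>i j. i \<in> {1..n} \<Longrightarrow> j \<in> {1..n} \<Longrightarrow> mmul n ?M Z i j = idm i j"
    using mt_inverse[OF dM] by blast
  have dN: "det (mt n ?N) \<noteq> 0" using N by (rule det_mt_nonzero)
  obtain Y where Y: "\<And>i j. i \<in> {1..n} \<Longrightarrow> j \<in> {1..n} \<Longrightarrow> mmul n ?N Y i j = idm i j"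
    using mt_inverse[OF dN] by blast
  define y0 where "y0 = mvec n Z u"
  define y1 where "y1 = mvec n Y u'"
  have y0: "mvec n ?M y0 i = u i" if "i \<in> {1..n}" for i
    unfolding y0_def by (rule mt_solve[OF Z that])
  have y1: "mvec n ?N y1 i = u' i" if "i \<in> {1..n}" for i
    unfolding y1_def by (rule mt_solve[OF Y that])
  define w0 where "w0 = dot n v y0"
  define w1 where "w1 = dot n v' y1"
  define d where "d = det (mt n (\<lambda>i j. idm i j - mmul n Z E i j))"
  have det0: "det (mt n (\<lambda>i j. x * idm i j - (colleague_F n i j + u i * cnj (v j)))) = det (mt n ?M) * (1 - w0)"
    using det_minus_rank_one[of n ?M y0 u "\<lambda>j. cnj (v j)"] y0 by (simp add: w0_def dot_def algebra_simps)
  have det1: "det (mt n (\<lambda>i j. x * idm i j - (colleague_F n i j + E i j + u' i * cnj (v' j)))) = det (mt n ?N) * (1 - w1)"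
    using det_minus_rank_one[of n ?N y1 u' "\<lambda>j. cnj (v' j)"] y1 by (simp add: w1_def dot_def algebra_simps)
  have ME: "mmul n ?M (mmul n Z E) i j = E i j" if "i \<in> {1..n}" "j \<in> {1..n}" for i j
  proof -
    have "mmul n ?M (mmul n Z E) i j = mmul n (mmul n ?M Z) E i j" by (simp add: mmul_assoc)
    also have "\<dots> = mmul n idm E i j" using Z that by (intro mmul_cong) auto
    finally show ?thesis using that by (simp add: mmul_idm_left)
  qed
  have "mt n ?N = mt n (mmul n ?M (\<lambda>i j. idm i j - mmul n Z E i j))"
  proof (rule mt_cong)
    fix i j assume ij: "i \<in> {1..n}" "j \<in> {1..n}"
    show "?N i j = mmul n ?M (\<lambda>i j. idm i j - mmul n Z E i j) i j"
      unfolding mmul_diff_right ME[OF ij] using ij by (simp add: mmul_idm_right)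
  qed
  then have detN: "det (mt n ?N) = det (mt n ?M) * d"
    by (simp add: mt_mmul det_mult[OF mt_carrier mt_carrier] d_def)
  have ZE: "cmod (mmul n Z E i j) \<le> \<kappa> * \<eta>" if ij: "i \<in> {1..n}" "j \<in> {1..n}" for i j
  proof -
    have "cmod (mmul n Z E i j) \<le> ?V (\<lambda>i. mmul n Z E i j)" using ij by (intro cmod_le_vnorm) auto
    also have "\<dots> \<le> \<kappa> * ?V (mvec n ?M (\<lambda>i. mmul n Z E i j))" by (rule M)
    also have "?V (mvec n ?M (\<lambda>i. mmul n Z E i j)) = ?V (\<lambda>i. E i j)"
      using ME ij by (intro vnorm_cong) (simp add: mvec_def mmul_def)
    also have "\<dots> \<le> \<eta>" by (rule op_le_column[OF E(1,2) ij(2)])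
    finally show ?thesis using \<kappa>0 by simp
  qed
  have d1: "cmod (d - 1) \<le> 3 * real n * (\<kappa> * \<eta>)"
    unfolding d_def by (rule det_near_identity[OF ZE]) (use E \<kappa>0 n in auto)
  have u'2: "?V u' \<le> 2" using vnorm_triangle[of "{1..n}" "\<lambda>i. u' i - u i" u] u by simp
  have "\<mu> * S \<le> 1 * S" using u(3) v(3) by (intro mult_right_mono) auto
  moreover have "?V v' \<le> ?V (\<lambda>i. v' i - v i) + ?V v"
    using vnorm_triangle[of "{1..n}" "\<lambda>i. v' i - v i" v] by simp
  ultimately have v'2: "?V v' \<le> 2 * S" using v by linarith
  have "?V y1 \<le> 2 * \<kappa> * ?V (mvec n ?N y1)" by (rule N)
  also have "?V (mvec n ?N y1) = ?V u'" using y1 by (intro vnorm_cong)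
  finally have "?V y1 \<le> 2 * \<kappa> * ?V u'" .
  also have "\<dots> \<le> 2 * \<kappa> * 2" using u'2 \<kappa>0 by (intro mult_left_mono) auto
  finally have ny1: "?V y1 \<le> 4 * \<kappa>" by simp
  \<comment> \<open>M (y1 - y0) = (u' - u) + E y1, so the resolvent is applied to quantities that
    are already small.\<close>
  have "?V (\<lambda>i. y1 i - y0 i) \<le> \<kappa> * ?V (mvec n ?M (\<lambda>i. y1 i - y0 i))" by (rule M)
  also have "?V (mvec n ?M (\<lambda>i. y1 i - y0 i)) = ?V (\<lambda>i. (u' i - u i) + mvec n E y1 i)"
  proof (rule vnorm_cong)
    fix i assume i: "i \<in> {1..n}"
    have "mvec n ?M (\<lambda>i. y1 i - y0 i) i = mvec n ?N y1 i + mvec n E y1 i - mvec n ?M y0 i"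
      by (simp add: mvec_def algebra_simps sum.distrib sum_subtractf)
    then show "mvec n ?M (\<lambda>i. y1 i - y0 i) i = (u' i - u i) + mvec n E y1 i" using y0[OF i] y1[OF i] by simp
  qed
  also have "\<dots> \<le> \<mu> + \<eta> * (4 * \<kappa>)"
    using vnorm_triangle[of "{1..n}" "\<lambda>i. u' i - u i" "mvec n E y1"] u(2) vnorm_mvec_le[OF E(1,2), of y1]
      mult_left_mono[OF ny1 E(2)] by linarith
  finally have dy: "?V (\<lambda>i. y1 i - y0 i) \<le> \<kappa> * (\<mu> + \<eta> * (4 * \<kappa>))" using \<kappa>0 by simp
  have "cmod w1 \<le> ?V v' * ?V y1" unfolding w1_def by (rule cmod_dot_le)
  also have "\<dots> \<le> (2 * S) * (4 * \<kappa>)" using v'2 ny1 v by (intro mult_mono) auto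
  finally have nw1: "cmod w1 \<le> 8 * (S * \<kappa>)" by simp
  have "w1 - w0 = dot n (\<lambda>i. v' i - v i) y1 + dot n v (\<lambda>i. y1 i - y0 i)"
    by (simp add: w1_def w0_def dot_def algebra_simps sum.distrib sum_subtractf)
  then have "cmod (w1 - w0) \<le> cmod (dot n (\<lambda>i. v' i - v i) y1) + cmod (dot n v (\<lambda>i. y1 i - y0 i))"
    by (simp only: norm_triangle_ineq)
  also have "\<dots> \<le> (\<mu> * S) * (4 * \<kappa>) + S * (\<kappa> * (\<mu> + \<eta> * (4 * \<kappa>)))"
  proof (rule add_mono)
    show "cmod (dot n (\<lambda>i. v' i - v i) y1) \<le> (\<mu> * S) * (4 * \<kappa>)"
      by (rule order_trans[OF cmod_dot_le mult_mono]) (use v ny1 \<mu> in auto)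
    show "cmod (dot n v (\<lambda>i. y1 i - y0 i)) \<le> S * (\<kappa> * (\<mu> + \<eta> * (4 * \<kappa>)))"
      by (rule order_trans[OF cmod_dot_le mult_mono]) (use v dy in auto)
  qed
  also have "\<dots> = S * (5 * (\<kappa> * \<mu>) + 4 * (\<kappa>\<^sup>2 * \<eta>))" by (simp add: power2_eq_square algebra_simps)
  finally have dw: "cmod (w1 - w0) \<le> S * (5 * (\<kappa> * \<mu>) + 4 * (\<kappa>\<^sup>2 * \<eta>))" .
  have S\<kappa>: "1 \<le> S * \<kappa>" using mult_mono[OF v(3) \<kappa>] v(3) by simp
  have "cmod (d * (1 - w1) - (1 - w0)) = cmod ((d - 1) * (1 - w1) - (w1 - w0))" by (simp add: algebra_simps)
  also have "\<dots> \<le> cmod (d - 1) * cmod (1 - w1) + cmod (w1 - w0)"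
    by (metis norm_mult norm_triangle_ineq4)
  also have "\<dots> \<le> (3 * real n * (\<kappa> * \<eta>)) * (9 * (S * \<kappa>)) + S * (5 * (\<kappa> * \<mu>) + 4 * (\<kappa>\<^sup>2 * \<eta>))"
    using d1 dw nw1 S\<kappa> norm_triangle_ineq4[of 1 w1] E(2) \<kappa>0
    by (intro add_mono mult_mono) auto
  also have "\<dots> = S * (27 * (real n * (\<kappa>\<^sup>2 * \<eta>)) + 5 * (\<kappa> * \<mu>) + 4 * (\<kappa>\<^sup>2 * \<eta>))"
    by (simp add: power2_eq_square algebra_simps)
  also have "\<dots> \<le> S * (27 * (real n * (\<kappa>\<^sup>2 * \<eta>)) + 5 * (\<kappa>\<^sup>2 * \<mu>) + 4 * (real n * (\<kappa>\<^sup>2 * \<eta>)))"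
  proof (intro mult_left_mono add_mono)
    have "\<kappa> * 1 \<le> \<kappa> * \<kappa>" using \<kappa> by (intro mult_left_mono) auto
    then show "\<kappa> * \<mu> \<le> \<kappa>\<^sup>2 * \<mu>" using \<mu> by (intro mult_right_mono) (auto simp: power2_eq_square)
    show "\<kappa>\<^sup>2 * \<eta> \<le> real n * (\<kappa>\<^sup>2 * \<eta>)"
      using mult_right_mono[of 1 "real n" "\<kappa>\<^sup>2 * \<eta>"] n E(2) by simp
  qed (use v(3) in auto)
  also have "\<dots> = S * \<kappa>\<^sup>2 * (31 * real n * \<eta> + 5 * \<mu>)" by (simp add: algebra_simps)
  finally have fin: "cmod (d * (1 - w1) - (1 - w0)) \<le> S * \<kappa>\<^sup>2 * (31 * real n * \<eta> + 5 * \<mu>)" .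
  have "det (mt n ?N) * (1 - w1) - det (mt n ?M) * (1 - w0) = det (mt n ?M) * (d * (1 - w1) - (1 - w0))"
    unfolding detN by (simp add: algebra_simps)
  then show ?thesis unfolding det0 det1 norm_mult[symmetric]
    using mult_left_mono[OF fin norm_ge_zero[of "det (mt n ?M)"]] by (simp add: norm_mult)
qed

section \<open>From the backward error to the perturbed coefficients\<close>

lemma coeff_norm_ge: "k \<le> n \<Longrightarrow> cmod (p k) \<le> coeff_norm n p"
  unfolding coeff_norm_def using member_le_L2_set[of "{..n}" k "\<lambda>i. cmod (p i)"] by simp

lemma vnorm_colleague_u: "1 \<le> n \<Longrightarrow> vnorm {1..n} colleague_u = 1"
  using vnorm_unit[of 1 n] by (simp add: colleague_u_def[abs_def])

lemma vnorm_colleague_v: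
  assumes "p n = 1"
  shows "vnorm {1..n} (colleague_v n p) \<le> coeff_norm n p"
proof (rule power2_le_imp_le)
  have le: "cmod (colleague_v n p i) \<le> cmod (p (n - i))" if "i \<in> {1..n}" for i
  proof (cases "i = n")
    case True
    have "sqrt 2 \<le> 2" by (rule real_le_lsqrt) auto
    then have "sqrt 2 * cmod (p 0) \<le> 2 * cmod (p 0)" by (rule mult_right_mono) simp
    then show ?thesis using True that assms by (simp add: colleague_v_def colleague_vstar_def norm_mult norm_divide)
  next
    case False
    then show ?thesis using that assms by (simp add: colleague_v_def colleague_vstar_def norm_mult norm_divide)
  qed
  have "(vnorm {1..n} (colleague_v n p))\<^sup>2 \<le> (\<Sum>i = 1..n. (cmod (p (n - i)))\<^sup>2)"
    unfolding vnorm_sq using le by (intro sum_mono power_mono) auto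
  also have "\<dots> = (\<Sum>i<n. (cmod (p i))\<^sup>2)"
    by (rule sum.reindex_bij_witness[of _ "\<lambda>i. n - i" "\<lambda>i. n - i"]) auto
  also have "\<dots> \<le> (\<Sum>i\<le>n. (cmod (p i))\<^sup>2)" by (intro sum_mono2) auto
  also have "\<dots> = (coeff_norm n p)\<^sup>2" by (simp add: coeff_norm_def L2_set_def sum_nonneg)
  finally show "(vnorm {1..n} (colleague_v n p))\<^sup>2 \<le> (coeff_norm n p)\<^sup>2" .
qed (simp add: coeff_norm_def)

lemma coeff_norm_le:
  assumes "2 \<le> n" "\<And>k. k \<le> n \<Longrightarrow> cmod (a k) \<le> b" "0 \<le> b"
  shows "coeff_norm n a \<le> real n * b"
proof -
  have "coeff_norm n a \<le> L2_set (\<lambda>_. b) {..n}"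
    unfolding coeff_norm_def using assms(2) by (intro L2_set_mono) auto
  also have "\<dots> = sqrt (real n + 1) * b" using assms(3) by (simp add: L2_set_constant)
  also have "\<dots> \<le> real n * b"
  proof (rule mult_right_mono[OF _ assms(3)])
    have "real n * 2 \<le> real n * real n" using assms(1) by (intro mult_left_mono) auto
    moreover have "2 \<le> real n" using assms(1) by simp
    ultimately have "real n + 1 \<le> (real n)\<^sup>2" unfolding power2_eq_square by linarith
    then show "sqrt (real n + 1) \<le> real n" by (intro real_le_lsqrt) auto
  qed
  finally show ?thesis .
qed

text \<open>F is itself a colleague matrix, that of T_n, for which v vanishes.\<close>

lemma det_shifted_F:
  assumes "2 \<le> n"
  shows "2 ^ (n - 1) * det (mt n (\<lambda>i j. x * idm i j - colleague_F n i j)) = poly (cheb n) x"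
proof -
  let ?p = "\<lambda>i. if i = n then 1 else (0::complex)"
  have "colleague n ?p i j = colleague_F n i j" for i j
    using assms by (auto simp: colleague_def colleague_v_def colleague_vstar_def)
  moreover have "cheb_poly n ?p = cheb n"
  proof -
    have "cheb_poly n ?p = (\<Sum>i\<le>n. if i = n then cheb n else 0)"
      unfolding cheb_poly_def by (intro sum.cong) auto
    then show ?thesis by simp
  qed
  ultimately show ?thesis using colleague_det[OF assms, of ?p x] by simp
qed

text \<open>Both characteristic polynomials are monic, so their difference has degree below n and
  the leading Chebyshev coefficient stays 1. The factor 4 is 2 for T_n on the ellipse times 2 for
  reading off a coefficient; n compares the Euclidean norm with the largest coefficient.\<close>

lemma char_poly_perturbation:
  fixes n :: nat and p :: "nat \<Rightarrow> complex"
  defines "\<kappa> \<equiv> 2 * real n * (real n + 1)" and "S \<equiv> coeff_norm n p"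
  assumes n: "2 \<le> n" and p: "p n = 1"
    and E: "op_le n E \<eta>" "0 \<le> \<eta>" "2 * \<kappa> * \<eta> \<le> 1" "real n * (\<kappa> * \<eta>) \<le> 1" "fact n * 2 ^ n * (\<kappa> * \<eta>) \<le> 1"
    and u: "vnorm {1..n} (\<lambda>i. u i - colleague_u i) \<le> \<mu>" "\<mu> \<le> 1"
    and v: "vnorm {1..n} (\<lambda>i. v i - colleague_v n p i) \<le> \<mu> * S"
  shows "\<exists>\<delta>p. \<delta>p n = 0 \<and>
    Polynomial.smult (2 ^ (n - 1)) (char_poly (mt n (\<lambda>i j. colleague_F n i j + E i j + u i * cnj (v j))))
      = cheb_poly n (\<lambda>i. p i + \<delta>p i) \<and>
    coeff_norm n \<delta>p \<le> real n * (4 * (S * \<kappa>\<^sup>2 * (31 * real n * \<eta> + 5 * \<mu>)))"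
proof -
  let ?A = "mt n (\<lambda>i j. colleague_F n i j + E i j + u i * cnj (v j))"
  let ?C = "mt n (colleague n p)"
  define b where "b = S * \<kappa>\<^sup>2 * (31 * real n * \<eta> + 5 * \<mu>)"
  have \<mu>: "0 \<le> \<mu>" using u(1) vnorm_nonneg order_trans by blast
  have S: "1 \<le> S" using coeff_norm_ge[of n n p] p by (simp add: S_def)
  have b: "0 \<le> b" using S E(2) \<mu> by (simp add: b_def)
  have \<kappa>: "1 \<le> \<kappa>"
  proof -
    have "1 * 1 \<le> real n * (real n + 1)" using n by (intro mult_mono) auto
    then show ?thesis by (simp add: \<kappa>_def)
  qed
  define r where "r = Polynomial.smult (2 ^ (n - 1)) (char_poly ?A - char_poly ?C)"
  have "degree (char_poly ?A - char_poly ?C) \<le> n - 1"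
  proof (rule degree_le, intro allI impI)
    fix i assume "n - 1 < i"
    then consider "i = n" | "n < i" using n by linarith
    then show "coeff (char_poly ?A - char_poly ?C) i = 0"
      using degree_monic_char_poly[of ?A n] degree_monic_char_poly[of ?C n] by cases (auto simp: coeff_eq_0)
  qed
  then have "degree r \<le> n - 1" by (simp add: r_def)
  then obtain a where a: "r = cheb_poly (n - 1) a" using cheb_poly_exists by blast
  define \<delta>p where "\<delta>p i = (if i < n then a i else 0)" for i
  have r: "r = cheb_poly n \<delta>p"
  proof -
    have "{..n} = insert n {..n - 1}" using n by auto
    then have "cheb_poly n \<delta>p = Polynomial.smult (\<delta>p n) (cheb n) + (\<Sum>i\<le>n - 1. Polynomial.smult (\<delta>p i) (cheb i))"
      unfolding cheb_poly_def using n by simp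
    also have "(\<Sum>i\<le>n - 1. Polynomial.smult (\<delta>p i) (cheb i)) = cheb_poly (n - 1) a"
      unfolding cheb_poly_def using n by (intro sum.cong) (auto simp: \<delta>p_def)
    finally have "cheb_poly n \<delta>p = Polynomial.smult (\<delta>p n) (cheb n) + r" unfolding a .
    moreover have "\<delta>p n = 0" by (simp add: \<delta>p_def)
    ultimately show ?thesis by simp
  qed
  have "cmod (\<delta>p k) \<le> 2 * (2 * b)" if k: "k \<le> n" for k
  proof (rule cheb_coeff_le[where \<rho> = "1 + 1 / real n" and n = n])
    fix z :: complex assume z: "cmod z = 1 + 1 / real n"
    let ?x = "(z + inverse z) / 2"
    let ?M = "mt n (\<lambda>i j. ?x * idm i j - colleague_F n i j)"
    have "1 \<le> n" using n by simp
    have dist: "1 / \<kappa> \<le> cmod (?x - of_real t)" if "-1 \<le> t" "t \<le> 1" for t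
      unfolding \<kappa>_def by (rule ellipse_dist[OF \<open>1 \<le> n\<close> z that])
    have C: "colleague n p = (\<lambda>i j. colleague_F n i j + colleague_u i * cnj (colleague_v n p j))"
      by (simp add: colleague_def fun_eq_iff)
    have nu: "vnorm {1..n} colleague_u \<le> 1" using vnorm_colleague_u[OF \<open>1 \<le> n\<close>] by simp
    have nv: "vnorm {1..n} (colleague_v n p) \<le> S" unfolding S_def by (rule vnorm_colleague_v[of p n, OF p])
    have "poly r ?x = 2 ^ (n - 1) * (poly (char_poly ?A) ?x - poly (char_poly ?C) ?x)"
      by (simp add: r_def)
    then have "cmod (poly r ?x) = cmod (2 ^ (n - 1)) * cmod (poly (char_poly ?A) ?x - poly (char_poly ?C) ?x)"
      by (simp add: norm_mult)
    also have "\<dots> \<le> cmod (2 ^ (n - 1)) * (cmod (det ?M) * b)"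
      unfolding poly_char_poly_mt C b_def
      by (rule mult_left_mono[OF det_perturbation[OF \<open>1 \<le> n\<close> dist \<kappa> E nu u v nv S]]) simp_all
    also have "\<dots> = cmod (2 ^ (n - 1) * det ?M) * b" by (simp add: norm_mult)
    also have "\<dots> = cmod (poly (cheb n) ?x) * b" unfolding det_shifted_F[OF n] ..
    also have "\<dots> \<le> 2 * b" using cheb_ellipse_le[OF \<open>1 \<le> n\<close> z] b by (rule mult_right_mono)
    finally show "cmod (poly (cheb_poly n \<delta>p) ?x) \<le> 2 * b" unfolding r .
  qed (use k in auto)
  then have "coeff_norm n \<delta>p \<le> real n * (2 * (2 * b))" using b by (intro coeff_norm_le[OF n]) auto
  moreover have "Polynomial.smult (2 ^ (n - 1)) (char_poly ?A) = cheb_poly n (\<lambda>i. p i + \<delta>p i)"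
  proof -
    have "cheb_poly n (\<lambda>i. p i + \<delta>p i) = cheb_poly n p + cheb_poly n \<delta>p"
      by (simp add: cheb_poly_def smult_add_left sum.distrib)
    also have "\<dots> = Polynomial.smult (2 ^ (n - 1)) (char_poly ?C) + r"
      unfolding char_poly_colleague[of n p, OF n p] r ..
    finally show ?thesis by (simp add: r_def smult_diff_right)
  qed
  ultimately show ?thesis by (intro exI[of _ \<delta>p]) (simp add: \<delta>p_def b_def)
qed

lemma char_poly_backward:
  assumes "unitary n Q"
    and F: "\<And>i j. i \<in> {1..n} \<Longrightarrow> j \<in> {1..n} \<Longrightarrow> fgen s i j = mmul n (ctrans Q) (mmul n H Q) i j"
    and uv: "\<And>i. i \<in> {1..n} \<Longrightarrow> gu s i = mvec n (ctrans Q) u i" "\<And>i. i \<in> {1..n} \<Longrightarrow> gv s i = mvec n (ctrans Q) v i"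
  shows "char_poly (represented_mat n s) = char_poly (mt n (\<lambda>i j. H i j + u i * cnj (v j)))"
proof (rule char_poly_similar)
  let ?H = "\<lambda>i j. H i j + u i * cnj (v j)"
  have rep: "represented_mat n s = mt n (entry s)" by (simp add: represented_mat_def mt_def)
  have "mt n (entry s) = mt n (mmul n (ctrans Q) (mmul n ?H Q))"
  proof (rule mt_cong)
    fix i j assume ij: "i \<in> {1..n}" "j \<in> {1..n}"
    have "entry s i j = fgen s i j + gu s i * cnj (gv s j)" by (simp add: fgen_def)
    then show "entry s i j = mmul n (ctrans Q) (mmul n ?H Q) i j"
      unfolding F[OF ij] uv(1)[OF ij(1)] uv(2)[OF ij(2)] mmul_add_left mmul_outer_right mmul_add_right mmul_outer_left by simp
  qed
  then have eq: "represented_mat n s = mt n (ctrans Q) * mt n ?H * mt n Q"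
    unfolding rep mt_mmul by (simp add: assoc_mult_mat[OF mt_carrier mt_carrier mt_carrier])
  have "mt n (mmul n (ctrans Q) Q) = mt n idm" "mt n (mmul n Q (ctrans Q)) = mt n idm"
    using assms(1) by (auto intro!: mt_cong simp: unitary_def)
  then have "mt n (ctrans Q) * mt n Q = 1\<^sub>m n" "mt n Q * mt n (ctrans Q) = 1\<^sub>m n"
    by (simp_all add: mt_mmul mt_idm)
  then show "similar_mat (represented_mat n s) (mt n ?H)"
    unfolding similar_mat_def similar_mat_wit_def Let_def using eq
    by (intro exI[of _ "mt n (ctrans Q)"] exI[of _ "mt n Q"]) (auto simp: represented_mat_def)
qed

text \<open>\<epsilon> times the number R of rotations is at most 1/1000, so (1 + 26 \<epsilon>)^R
  \<le> exp (1/2) \<le> 2: each vector at most doubles its initial norm bound, whence 4.\<close>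

lemma run_gamma_hat_le:
  assumes "(qr_step n j \<epsilon> ar)\<^sup>*\<^sup>* (init_state n p) s"
    and j: "j = 1 \<or> j = 2" "j < n" and p: "p n = 1" and m: "standard_model \<epsilon> ar" and e: "0 \<le> \<epsilon>"
    and N: "1000 * \<epsilon> * (N + 1) \<le> 1" "real (num_rotations s) \<le> N"
  shows "gamma_hat j n s \<le> 4 * coeff_norm n p"
proof -
  have N0: "0 \<le> N" using N(2) by linarith
  have e1: "\<epsilon> \<le> 1 / 1000" using N e N0 mult_left_mono[of 1 "N + 1" "1000 * \<epsilon>"] by simp
  have n: "1 \<le> n" using j by simp
  let ?q = "(1 + 26 * \<epsilon>) ^ (length (rlog s) - 1)"
  have "?q \<le> exp (26 * \<epsilon>) ^ num_rotations s"
    unfolding num_rotations_def using e by (intro power_mono exp_ge_add_one_self) auto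
  also have "\<dots> = exp (real (num_rotations s) * (26 * \<epsilon>))" by (simp add: exp_of_nat_mult)
  also have "\<dots> \<le> exp (1 / 2)"
  proof -
    have "\<epsilon> * real (num_rotations s) \<le> \<epsilon> * (N + 1)" using N e by (intro mult_left_mono) auto
    moreover have "1000 * (\<epsilon> * (N + 1)) \<le> 1" using N(1) by (simp add: mult.assoc)
    moreover have "real (num_rotations s) * (26 * \<epsilon>) = 26 * (\<epsilon> * real (num_rotations s))" by simp
    ultimately have "real (num_rotations s) * (26 * \<epsilon>) \<le> 1 / 2" by linarith
    then show ?thesis by simp
  qed
  also have "\<dots> \<le> 2" by (rule exp_half_le2)
  finally have q: "?q \<le> 2" .
  have q0: "0 \<le> ?q" using e by simp
  note b = run_rlog_bounded[OF assms(1) j(1) m e e1]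
  have "gamma_hat j n s \<le> 2 * (2 * coeff_norm n p)"
  proof (rule gamma_hat_le[OF j(2)])
    show "rlog s \<noteq> []" using b by (auto simp: rlog_bounded_def)
    fix u v assume "(u, v) \<in> set (rlog s)"
    then have uv: "vnorm {1..n} u \<le> ?q * vnorm {1..n} colleague_u"
        "vnorm {1..n} v \<le> ?q * vnorm {1..n} (colleague_v n p)"
      using b unfolding rlog_bounded_def by blast+
    have "?q * vnorm {1..n} (colleague_v n p) \<le> 2 * coeff_norm n p"
      using q q0 vnorm_colleague_v[of p n, OF p] by (intro mult_mono) auto
    then show "vnorm {1..n} u \<le> 2 \<and> vnorm {1..n} v \<le> 2 * coeff_norm n p"
      using uv q unfolding vnorm_colleague_u[OF n] by linarith
  qed
  then show ?thesis by simp
qed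

lemma backward_error:
  fixes c :: real and n j :: nat and p :: "nat \<Rightarrow> complex"
  assumes j: "j = 1 \<or> j = 2" "j < n" and p: "p n = 1"
  shows "\<exists>\<epsilon>\<^sub>0>0. \<forall>\<epsilon> ar s. 0 < \<epsilon> \<longrightarrow> \<epsilon> \<le> \<epsilon>\<^sub>0 \<longrightarrow> standard_model \<epsilon> ar \<longrightarrow>
    qr_run n j \<epsilon> ar p s \<longrightarrow> real (num_rotations s) \<le> c * real n ^ 3 \<longrightarrow>
    (\<exists>\<delta>p. \<delta>p n = 0 \<and> computed_eigenvalues n s = proots (cheb_poly n (\<lambda>i. p i + \<delta>p i)) \<and>
       coeff_norm n \<delta>p \<le> 45000000 * (\<bar>c\<bar> + 1)\<^sup>2 * real n ^ 12 * max 1 (gamma_hat j n s) * coeff_norm n p * \<epsilon>)"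
proof -
  define S where "S = coeff_norm n p"
  \<comment> \<open>Chosen so that N + 1 \<le> b n^3 and b \<le> b^2 for every real c.\<close>
  define b where "b = \<bar>c\<bar> + 1"
  define \<kappa> where "\<kappa> = 2 * real n * (real n + 1)"
  \<comment> \<open>The bound for \<eta> / \<epsilon> with g replaced by its a priori bound 4 S;
    40012 = 40000 + 12 merges the two terms of \<open>eta_bound_le\<close>.\<close>
  define h where "h = 40012 * b\<^sup>2 * real n ^ 6 * (4 * S)"
  \<comment> \<open>Dominates the three factors 2, n and n! 2^n that multiply \<kappa> \<eta> in the
    smallness conditions of \<open>char_poly_perturbation\<close>.\<close>
  define q where "q = fact n * 2 ^ n * (2 * real n)"
  have n: "2 \<le> n" using j by auto
  have S: "1 \<le> S" using coeff_norm_ge[of n n p] p by (simp add: S_def)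
  have b: "1 \<le> b" by (simp add: b_def)
  have np: "1 \<le> real n ^ k" for k using n by (intro one_le_power) simp
  have bb: "b \<le> b\<^sup>2" using b mult_left_mono[of 1 b b] by (simp add: power2_eq_square)
  have \<kappa>: "1 \<le> \<kappa>" "\<kappa> \<le> 3 * (real n)\<^sup>2"
  proof -
    have "1 * 1 \<le> real n * (real n + 1)" using n by (intro mult_mono) auto
    then show "1 \<le> \<kappa>" by (simp add: \<kappa>_def)
    have "real n * 2 \<le> real n * real n" using n by (intro mult_left_mono) auto
    then show "\<kappa> \<le> 3 * (real n)\<^sup>2" by (simp add: \<kappa>_def power2_eq_square algebra_simps)
  qed
  have A: "1 \<le> fact n * (2::real) ^ n"
    using mult_mono[of 1 "fact n :: real" 1 "2 ^ n"] by (simp add: fact_ge_1)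
  have q: "fact n * 2 ^ n \<le> q" "real n \<le> q" "2 \<le> q" "1 \<le> q"
  proof -
    have n4: "4 \<le> 2 * real n" using n by simp
    show "fact n * 2 ^ n \<le> q" unfolding q_def using A n4 mult_left_mono[of 1 "2 * real n" "fact n * 2 ^ n"] by simp
    have "2 * real n \<le> q" unfolding q_def using A n4 mult_right_mono[of 1 "fact n * 2 ^ n" "2 * real n"] by simp
    then show "real n \<le> q" "2 \<le> q" "1 \<le> q" using n4 by simp_all
  qed
  have h1: "160048 * (b * real n ^ 3) \<le> h"
  proof -
    have "b * real n ^ 3 \<le> b\<^sup>2 * real n ^ 6"
      using bb b n by (intro mult_mono power_increasing) auto
    also have "\<dots> \<le> b\<^sup>2 * real n ^ 6 * S"
      using S mult_left_mono[of 1 S "b\<^sup>2 * real n ^ 6"] by simp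
    finally show ?thesis by (simp add: h_def mult_ac)
  qed
  have "1 * 1 \<le> b * real n ^ 3" using b np by (intro mult_mono) auto
  then have h0: "0 < h" using h1 by linarith
  define \<epsilon>\<^sub>0 where "\<epsilon>\<^sub>0 = 1 / (q * (\<kappa> * h))"
  have "0 < q * (\<kappa> * h)" using q \<kappa> h0 by simp
  then have "0 < \<epsilon>\<^sub>0" by (simp add: \<epsilon>\<^sub>0_def)
  moreover
  {
    fix \<epsilon> ar s
    assume e: "0 < \<epsilon>" "\<epsilon> \<le> \<epsilon>\<^sub>0" and m: "standard_model \<epsilon> ar" and run: "qr_run n j \<epsilon> ar p s"
      and R: "real (num_rotations s) \<le> c * real n ^ 3"
    define g where "g = max 1 (gamma_hat j n s)"
    define N where "N = \<bar>c\<bar> * real n ^ 3"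
    have e0: "0 \<le> \<epsilon>" using e by simp
    have steps: "(qr_step n j \<epsilon> ar)\<^sup>*\<^sup>* (init_state n p) s" using run by (simp add: qr_run_def)
    have N: "real (num_rotations s) \<le> N" "0 \<le> N" "N + 1 \<le> b * real n ^ 3"
    proof -
      have "c * real n ^ 3 \<le> N" unfolding N_def by (intro mult_right_mono) auto
      then show "real (num_rotations s) \<le> N" using R by linarith
      show "0 \<le> N" by (simp add: N_def)
      show "N + 1 \<le> b * real n ^ 3" using np[of 3] by (simp add: N_def b_def algebra_simps)
    qed
    have qk: "q * (\<kappa> * (\<epsilon> * h)) \<le> 1"
      using e \<open>0 < q * (\<kappa> * h)\<close> by (simp add: \<epsilon>\<^sub>0_def field_simps)
    have frac: "y * (\<kappa> * (\<epsilon> * h)) \<le> 1" if "y \<le> q" for y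
      using order_trans[OF mult_right_mono[OF that, of "\<kappa> * (\<epsilon> * h)"] qk] \<kappa> e0 h0 by simp
    have eh: "\<epsilon> * h \<le> 1"
      using frac[OF q(4)] \<kappa> mult_right_mono[of 1 \<kappa> "\<epsilon> * h"] e0 h0 by simp
    have small1: "1000 * \<epsilon> * (N + 1) \<le> 1"
    proof -
      have "1000 * (N + 1) \<le> 160048 * (b * real n ^ 3)" using N(2,3) by (intro mult_mono) auto
      also note h1
      finally have "1000 * (N + 1) \<le> h" .
      then have "\<epsilon> * (1000 * (N + 1)) \<le> \<epsilon> * h" using e0 by (rule mult_left_mono)
      then have "\<epsilon> * (1000 * (N + 1)) \<le> 1" using eh by linarith
      then show ?thesis by (simp only: mult_ac)
    qed
    have g: "1 \<le> g" "g \<le> 4 * S"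
      using run_gamma_hat_le[of n j \<epsilon> ar p s N, OF steps j p m e0 small1 N(1)] S by (auto simp: g_def S_def)
    have win: "window_le n j g s" unfolding g_def by (rule window_le_gamma_hat[OF j(2)])
    define \<eta> where "\<eta> = 40012 * b\<^sup>2 * real n ^ 6 * g * \<epsilon>"
    have \<eta>0: "0 \<le> \<eta>" using g e0 by (simp add: \<eta>_def)
    have \<eta>h: "\<eta> \<le> \<epsilon> * h"
    proof -
      have "(40012 * b\<^sup>2 * real n ^ 6 * \<epsilon>) * g \<le> (40012 * b\<^sup>2 * real n ^ 6 * \<epsilon>) * (4 * S)"
        using g e0 by (intro mult_left_mono) auto
      then show ?thesis by (simp add: \<eta>_def h_def mult_ac)
    qed
    have eta: "\<epsilon> * g * (40000 * (N + 1)\<^sup>2 + 12 * real (n\<^sup>2) * (N + 1)) \<le> \<eta>"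
    proof -
      have "(N + 1)\<^sup>2 \<le> (b * real n ^ 3)\<^sup>2" using N by (intro power_mono) auto
      then have 1: "(N + 1)\<^sup>2 \<le> b\<^sup>2 * real n ^ 6" by (simp add: power_mult_distrib flip: power_mult)
      have "real (n\<^sup>2) * (N + 1) \<le> real n ^ 3 * (b\<^sup>2 * real n ^ 3)"
      proof (rule mult_mono)
        show "real (n\<^sup>2) \<le> real n ^ 3" using n by (simp add: power_increasing)
        have "b * real n ^ 3 \<le> b\<^sup>2 * real n ^ 3" using bb by (intro mult_right_mono) auto
        then show "N + 1 \<le> b\<^sup>2 * real n ^ 3" using N by linarith
      qed (use N in auto)
      also have "\<dots> = b\<^sup>2 * (real n ^ 3 * real n ^ 3)" by (simp only: mult_ac)
      also have "real n ^ 3 * real n ^ 3 = real n ^ 6" by (simp flip: power_add)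
      finally have 2: "real (n\<^sup>2) * (N + 1) \<le> b\<^sup>2 * real n ^ 6" .
      have "40000 * (N + 1)\<^sup>2 + 12 * real (n\<^sup>2) * (N + 1) \<le> 40012 * (b\<^sup>2 * real n ^ 6)" using 1 2 by linarith
      then have "\<epsilon> * g * (40000 * (N + 1)\<^sup>2 + 12 * real (n\<^sup>2) * (N + 1)) \<le> \<epsilon> * g * (40012 * (b\<^sup>2 * real n ^ 6))"
        using e0 g by (intro mult_left_mono) auto
      then show ?thesis by (simp add: \<eta>_def mult_ac)
    qed
    then have small2: "\<epsilon> * g * (40000 * (N + 1)\<^sup>2 + 12 * real (n\<^sup>2) * (N + 1)) \<le> 1"
      using \<eta>h eh by linarith
    define \<mu> where "\<mu> = 120 * b\<^sup>2 * real n ^ 6 * g * \<epsilon>"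
    have \<mu>: "120 * \<epsilon> * real (num_rotations s) \<le> \<mu>"
    proof -
      have "real (num_rotations s) \<le> b * real n ^ 3" using N by linarith
      also have "\<dots> \<le> b\<^sup>2 * real n ^ 6" using bb b n by (intro mult_mono power_increasing) auto
      also have "\<dots> \<le> b\<^sup>2 * real n ^ 6 * g" using g mult_left_mono[of 1 g "b\<^sup>2 * real n ^ 6"] by simp
      finally have "120 * \<epsilon> * real (num_rotations s) \<le> 120 * \<epsilon> * (b\<^sup>2 * real n ^ 6 * g)"
        using e0 by (intro mult_left_mono) auto
      then show ?thesis by (simp add: \<mu>_def mult_ac)
    qed
    have \<mu>1: "\<mu> \<le> 1"
    proof -
      have "\<mu> \<le> \<eta>" unfolding \<mu>_def \<eta>_def using g e0 by (intro mult_right_mono) auto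
      then show ?thesis using \<eta>h eh by linarith
    qed
    have "invar n N \<epsilon> g (colleague_F n) colleague_u (colleague_v n p) s"
      by (rule run_invar[OF steps j(1) n m e0 small1 g(1) small2 win N(1,2)])
    then have "backward n (colleague_F n) colleague_u (colleague_v n p) s (eta_bound n N \<epsilon> g s)
        (120 * \<epsilon> * real (num_rotations s))" by (simp add: invar_def)
    then obtain Q E u v where Q: "unitary n Q"
      and F: "\<And>i j. i \<in> {1..n} \<Longrightarrow> j \<in> {1..n} \<Longrightarrow>
        fgen s i j = mmul n (ctrans Q) (mmul n (\<lambda>i j. colleague_F n i j + E i j) Q) i j"
      and uv: "\<And>i. i \<in> {1..n} \<Longrightarrow> gu s i = mvec n (ctrans Q) u i"
        "\<And>i. i \<in> {1..n} \<Longrightarrow> gv s i = mvec n (ctrans Q) v i"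
      and E: "op_le n E (eta_bound n N \<epsilon> g s)"
      and du: "vnorm {1..n} (\<lambda>i. u i - colleague_u i) \<le> 120 * \<epsilon> * real (num_rotations s) * vnorm {1..n} colleague_u"
      and dv: "vnorm {1..n} (\<lambda>i. v i - colleague_v n p i)
        \<le> 120 * \<epsilon> * real (num_rotations s) * vnorm {1..n} (colleague_v n p)"
      unfolding backward_def by blast
    have E': "op_le n E \<eta>"
      by (rule op_le_mono[OF E order_trans[OF eta_bound_le[OF e0 g(1) N(1)] eta]])
    have du': "vnorm {1..n} (\<lambda>i. u i - colleague_u i) \<le> \<mu>"
    proof -
      have "1 \<le> n" using n by simp
      then show ?thesis using du \<mu> unfolding vnorm_colleague_u[OF \<open>1 \<le> n\<close>] by linarith
    qed
    have dv': "vnorm {1..n} (\<lambda>i. v i - colleague_v n p i) \<le> \<mu> * coeff_norm n p"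
      by (rule order_trans[OF dv mult_mono[OF \<mu> vnorm_colleague_v[of p n, OF p]]]) (use \<mu>_def g e0 in auto)
    have \<kappa>\<eta>: "y * (\<kappa> * \<eta>) \<le> 1" if "y \<le> q" "0 \<le> y" for y
    proof -
      have "y * (\<kappa> * \<eta>) \<le> y * (\<kappa> * (\<epsilon> * h))" using that(2) \<kappa> \<eta>h by (intro mult_left_mono) auto
      then show ?thesis using frac[OF that(1)] by linarith
    qed
    have s3: "2 * \<kappa> * \<eta> \<le> 1" "real n * (\<kappa> * \<eta>) \<le> 1" "fact n * 2 ^ n * (\<kappa> * \<eta>) \<le> 1"
      using \<kappa>\<eta>[OF q(3)] \<kappa>\<eta>[OF q(2)] \<kappa>\<eta>[OF q(1)] by (simp_all add: mult.assoc)
    obtain \<delta>p where \<delta>p: "\<delta>p n = 0"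
      "Polynomial.smult (2 ^ (n - 1)) (char_poly (mt n (\<lambda>i j. colleague_F n i j + E i j + u i * cnj (v j))))
        = cheb_poly n (\<lambda>i. p i + \<delta>p i)"
      "coeff_norm n \<delta>p \<le> real n * (4 * (S * \<kappa>\<^sup>2 * (31 * real n * \<eta> + 5 * \<mu>)))"
      using char_poly_perturbation[of n p, OF n p E' \<eta>0 s3[unfolded \<kappa>_def] du' \<mu>1 dv'] unfolding \<kappa>_def S_def by blast
    have "computed_eigenvalues n s = proots (Polynomial.smult (2 ^ (n - 1)) (char_poly (represented_mat n s)))"
      by (simp add: computed_eigenvalues_def)
    also have "char_poly (represented_mat n s)
        = char_poly (mt n (\<lambda>i j. colleague_F n i j + E i j + u i * cnj (v j)))"
      by (rule char_poly_backward[OF Q F uv])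
    finally have ev: "computed_eigenvalues n s = proots (cheb_poly n (\<lambda>i. p i + \<delta>p i))" unfolding \<delta>p(2) .
    have "coeff_norm n \<delta>p \<le> 45000000 * b\<^sup>2 * real n ^ 12 * g * S * \<epsilon>"
    proof -
      \<comment> \<open>45000000 is 4 times 9 times 1250000: 4 from
        \<open>char_poly_perturbation\<close>, 9 n^4 from \<kappa>^2, and 31 times 40012 plus 5
        times 120 is below 1250000. With n^7 in \<open>x\<close> the power of n is 1 + 4 + 7 =
        12.\<close>
      define x where "x = b\<^sup>2 * real n ^ 7 * g * \<epsilon>"
      have x0: "0 \<le> x" using g e0 by (simp add: x_def)
      have "0 \<le> \<mu>" using g e0 by (simp add: \<mu>_def)
      then have nonneg: "0 \<le> 31 * real n * \<eta> + 5 * \<mu>" using \<eta>0 by simp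
      have "real n ^ 6 \<le> real n ^ 7" using n by (intro power_increasing) auto
      then have "\<mu> \<le> 120 * x"
        using g e0 mult_left_mono[of "real n ^ 6" "real n ^ 7" "120 * b\<^sup>2 * g * \<epsilon>"]
        by (simp add: \<mu>_def x_def mult_ac)
      moreover have "real n * \<eta> = 40012 * x"
        by (simp add: \<eta>_def x_def eval_nat_numeral mult_ac)
      ultimately have "31 * real n * \<eta> + 5 * \<mu> \<le> 1250000 * x" using x0 by simp
      moreover have "\<kappa>\<^sup>2 \<le> (3 * (real n)\<^sup>2)\<^sup>2" using \<kappa> by (intro power_mono) auto
      then have "S * \<kappa>\<^sup>2 \<le> S * (9 * real n ^ 4)"
        using S by (intro mult_left_mono) (auto simp: power_mult_distrib simp flip: power_mult)
      ultimately have "S * \<kappa>\<^sup>2 * (31 * real n * \<eta> + 5 * \<mu>) \<le> S * (9 * real n ^ 4) * (1250000 * x)"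
        using S x0 nonneg by (intro mult_mono) auto
      then have "real n * (4 * (S * \<kappa>\<^sup>2 * (31 * real n * \<eta> + 5 * \<mu>))) \<le> real n * (4 * (S * (9 * real n ^ 4) * (1250000 * x)))"
        by (intro mult_left_mono) auto
      also have "\<dots> = 45000000 * b\<^sup>2 * (real n * real n ^ 4 * real n ^ 7) * g * S * \<epsilon>"
        by (simp add: x_def mult_ac)
      also have "real n * real n ^ 4 * real n ^ 7 = real n ^ 12" by (simp add: eval_nat_numeral)
      finally show ?thesis using \<delta>p(3) by linarith
    qed
    then have "\<exists>\<delta>p. \<delta>p n = 0 \<and> computed_eigenvalues n s = proots (cheb_poly n (\<lambda>i. p i + \<delta>p i)) \<and>
       coeff_norm n \<delta>p \<le> 45000000 * (\<bar>c\<bar> + 1)\<^sup>2 * real n ^ 12 * max 1 (gamma_hat j n s) * coeff_norm n p * \<epsilon>"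
      using \<delta>p(1) ev unfolding b_def g_def S_def by blast
  }
  ultimately show ?thesis by blast
qed

theorem theorem3p7:
  fixes c :: real
  shows "\<exists>P :: real poly. degree P \<le> 12 \<and>
    (\<forall>(n::nat) (j::nat) (p :: nat \<Rightarrow> complex).
       (j = 1 \<or> (j = 2 \<and> (\<forall>i\<le>n. p i \<in> \<real>))) \<longrightarrow> j < n \<longrightarrow> p n = 1 \<longrightarrow>
       (\<exists>K \<epsilon>\<^sub>0. 0 < \<epsilon>\<^sub>0 \<and>
         (\<forall>\<epsilon> ar s. 0 < \<epsilon> \<longrightarrow> \<epsilon> \<le> \<epsilon>\<^sub>0 \<longrightarrow> standard_model \<epsilon> ar \<longrightarrow>
            qr_run n j \<epsilon> ar p s \<longrightarrow> real (num_rotations s) \<le> c * real n ^ 3 \<longrightarrow>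
            (\<exists>\<delta>p :: nat \<Rightarrow> complex. \<delta>p n = 0 \<and>
               computed_eigenvalues n s = proots (cheb_poly n (\<lambda>i. p i + \<delta>p i)) \<and>
               coeff_norm n \<delta>p
                 \<le> poly P (real n) * max 1 (gamma_hat j n s) * coeff_norm n p * \<epsilon> + K * \<epsilon>\<^sup>2))))"
proof (intro exI[of _ "monom (45000000 * (\<bar>c\<bar> + 1)\<^sup>2) 12"] conjI allI impI)
  show "degree (monom (45000000 * (\<bar>c\<bar> + 1)\<^sup>2) 12) \<le> 12" by (rule degree_monom_le)
  fix n j :: nat and p :: "nat \<Rightarrow> complex"
  assume "j = 1 \<or> (j = 2 \<and> (\<forall>i\<le>n. p i \<in> \<real>))" "j < n" "p n = 1"
  then obtain \<epsilon>\<^sub>0 where "0 < \<epsilon>\<^sub>0" and err: "\<forall>\<epsilon> ar s. 0 < \<epsilon> \<longrightarrow> \<epsilon> \<le> \<epsilon>\<^sub>0 \<longrightarrow> standard_model \<epsilon> ar \<longrightarrow>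
    qr_run n j \<epsilon> ar p s \<longrightarrow> real (num_rotations s) \<le> c * real n ^ 3 \<longrightarrow>
    (\<exists>\<delta>p. \<delta>p n = 0 \<and> computed_eigenvalues n s = proots (cheb_poly n (\<lambda>i. p i + \<delta>p i)) \<and>
       coeff_norm n \<delta>p \<le> 45000000 * (\<bar>c\<bar> + 1)\<^sup>2 * real n ^ 12 * max 1 (gamma_hat j n s) * coeff_norm n p * \<epsilon>)"
    using backward_error[of j n p c] by blast
  show "\<exists>K \<epsilon>\<^sub>0. 0 < \<epsilon>\<^sub>0 \<and>
         (\<forall>\<epsilon> ar s. 0 < \<epsilon> \<longrightarrow> \<epsilon> \<le> \<epsilon>\<^sub>0 \<longrightarrow> standard_model \<epsilon> ar \<longrightarrow>
            qr_run n j \<epsilon> ar p s \<longrightarrow> real (num_rotations s) \<le> c * real n ^ 3 \<longrightarrow>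
            (\<exists>\<delta>p :: nat \<Rightarrow> complex. \<delta>p n = 0 \<and>
               computed_eigenvalues n s = proots (cheb_poly n (\<lambda>i. p i + \<delta>p i)) \<and>
               coeff_norm n \<delta>p
                 \<le> poly (monom (45000000 * (\<bar>c\<bar> + 1)\<^sup>2) 12) (real n) * max 1 (gamma_hat j n s) * coeff_norm n p * \<epsilon> + K * \<epsilon>\<^sup>2))"
    \<comment> \<open>K = 0: the threshold has already absorbed every second-order term.\<close>
    by (intro exI[of _ 0] exI[of _ \<epsilon>\<^sub>0] conjI) (use \<open>0 < \<epsilon>\<^sub>0\<close> err in \<open>simp_all add: poly_monom\<close>)
qed

end
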